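(* Let $p\in\,]-1,1[$ be a nonzero real number and let $\mathcal A,\mathcal B$ be unital $C^*$-algebras. Assume that $\phi:\mathcal A^{++}\to \mathcal B^{++}$ is a continuous bijective map such that \[ \phi(A\,\mathsf{m}_p\, B)=\phi(A)\,\mathfrak{m}_p\, \phi(B)\quad\text{for all } A,B\in \mathcal A^{++}. \] Then the algebras $\mathcal A$ and $\mathcal B$ are both commutative.
   Context: All $C^*$-algebras are complex and unital; $]-1,1[$ denotes the open interval. For a $C^*$-algebra $\mathcal A$, $\mathcal A^{+}$ denotes the set of self-adjoint elements with nonnegative spectrum, and $\mathcal A^{++}$ (the positive definite cone) denotes the set of invertible elements of $\mathcal A^{+}$. Real powers of elements of $\mathcal A^{++}$ are defined by continuous functional calculus. Continuity of $\phi$ is with respect to the norm topologies. The conventional $p$th power mean on $\mathcal A^{++}$ is \[ A\,\mathsf{m}_p\, B=\left(\frac{A^p+B^p}{2}\right)^{\frac1p},\quad A,B\in \mathcal A^{++}. \] The Kubo-Ando $p$th power mean on $\mathcal B^{++}$ is \[ A\,\mathfrak{m}_p\, B=A^{\frac12}\left(\frac{I+(A^{-\frac12} B A^{-\frac12})^p}{2}\right)^{\frac1p} A^{\frac12},\quad A,B\in \mathcal B^{++}, \] where $I$ is the unit. *)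

theory Defs
  imports "HOL-Analysis.Analysis"
begin

class cstar_algebra = real_normed_algebra_1 + banach +
  fixes scaleC :: "complex \<Rightarrow> 'a \<Rightarrow> 'a"
    and star :: "'a \<Rightarrow> 'a"
  assumes scaleC_of_real: "scaleC (complex_of_real r) x = scaleR r x"
    and scaleC_add_right: "scaleC c (x + y) = scaleC c x + scaleC c y"
    and scaleC_add_left: "scaleC (c + d) x = scaleC c x + scaleC d x"
    and scaleC_scaleC: "scaleC c (scaleC d x) = scaleC (c * d) x"
    and mult_scaleC_left: "scaleC c x * y = scaleC c (x * y)"
    and mult_scaleC_right: "x * scaleC c y = scaleC c (x * y)"
    and norm_scaleC: "norm (scaleC c x) = cmod c * norm x"
    and star_star: "star (star x) = x"
    and star_add: "star (x + y) = star x + star y"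
    and star_scaleC: "star (scaleC c x) = scaleC (cnj c) (star x)"
    and star_mult: "star (x * y) = star y * star x"
    and cstar_identity: "norm (star x * x) = (norm x)\<^sup>2"

definition invertible_elem :: "'a::cstar_algebra \<Rightarrow> bool" where
  "invertible_elem a \<longleftrightarrow> (\<exists>b. a * b = 1 \<and> b * a = 1)"

definition cstar_spectrum :: "'a::cstar_algebra \<Rightarrow> complex set" where
  "cstar_spectrum a = {z. \<not> invertible_elem (a - scaleC z 1)}"

definition pos_cone :: "'a::cstar_algebra set" where
  "pos_cone = {a. star a = a \<and> cstar_spectrum a \<subseteq> complex_of_real ` {0..}}"

definition posdef_cone :: "'a::cstar_algebra set" where
  "posdef_cone = {a \<in> pos_cone. invertible_elem a}"

text \<open>The continuous functional calculus at \<open>a\<close> is the isometric unital star-homomorphism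
  from the continuous functions on the spectrum of \<open>a\<close> (with the supremum norm) that sends
  the identity function to \<open>a\<close>. Elements of the function algebra are represented by functions
  on all of \<open>complex\<close>; the isometry clause makes \<open>\<Phi> f\<close> depend only on the
  restriction of \<open>f\<close> to the spectrum.\<close>

definition is_functional_calculus ::
    "'a::cstar_algebra \<Rightarrow> ((complex \<Rightarrow> complex) \<Rightarrow> 'a) \<Rightarrow> bool" where
  "is_functional_calculus a \<Phi> \<longleftrightarrow>
     \<Phi> (\<lambda>z. z) = a \<and> \<Phi> (\<lambda>z. 1) = 1 \<and>
     (\<forall>f g. continuous_on (cstar_spectrum a) f \<longrightarrow> continuous_on (cstar_spectrum a) g \<longrightarrow>
        \<Phi> (\<lambda>z. f z + g z) = \<Phi> f + \<Phi> g \<and>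
        \<Phi> (\<lambda>z. f z * g z) = \<Phi> f * \<Phi> g) \<and>
     (\<forall>f c. continuous_on (cstar_spectrum a) f \<longrightarrow>
        \<Phi> (\<lambda>z. c * f z) = scaleC c (\<Phi> f) \<and>
        \<Phi> (\<lambda>z. cnj (f z)) = star (\<Phi> f) \<and>
        norm (\<Phi> f) = (SUP z\<in>cstar_spectrum a. cmod (f z)))"

definition cfc :: "(complex \<Rightarrow> complex) \<Rightarrow> 'a::cstar_algebra \<Rightarrow> 'a" where
  "cfc f a = (THE b. \<exists>\<Phi>. is_functional_calculus a \<Phi> \<and> \<Phi> f = b)"

text \<open>Only meaningful on \<open>posdef_cone\<close>, where the spectrum is a compact set of positive
  reals, so that \<open>Re z\<close> is \<open>z\<close> itself and the function is continuous on it for every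
  real exponent.\<close>

definition cpower :: "'a::cstar_algebra \<Rightarrow> real \<Rightarrow> 'a" where
  "cpower a r = cfc (\<lambda>z. complex_of_real (Re z powr r)) a"

definition conv_power_mean :: "real \<Rightarrow> 'a::cstar_algebra \<Rightarrow> 'a \<Rightarrow> 'a" where
  "conv_power_mean p a b = cpower ((1/2) *\<^sub>R (cpower a p + cpower b p)) (1/p)"

definition kubo_ando_power_mean :: "real \<Rightarrow> 'a::cstar_algebra \<Rightarrow> 'a \<Rightarrow> 'a" where
  "kubo_ando_power_mean p a b =
     cpower a (1/2) *
     cpower ((1/2) *\<^sub>R (1 + cpower (cpower a (-1/2) * b * cpower a (-1/2)) p)) (1/p) *
     cpower a (1/2)"

end

theory Submission
  imports Defs "HOL-Computational_Algebra.Fundamental_Theorem_Algebra"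
begin

text \<open>
  Put \<open>\<psi> A = \<phi> (A powr (1/p))\<close>. Then \<open>\<psi>\<close> is a bijection of the cones that turns the
  arithmetic mean into the Kubo-Ando mean \<open>\<mm>\<close>. The arithmetic mean is medial, hence so is
  \<open>\<mm>\<close>; in particular \<open>(X \<mm> 1) \<mm> (Z \<mm> 1) = (X \<mm> Z) \<mm> 1\<close>. Expanding this at
  \<open>X = 1 + e (b + a)\<close>, \<open>Z = 1 + e (b - a)\<close>, both sides agree up to second order, and at third
  order they differ by \<open>(p - 1) (p + 1) / 32\<close> times the double commutator \<open>[a, [a, b]]\<close>. Since
  \<open>-1 < p < 1\<close>, all these double commutators of self-adjoint elements vanish, which forces the
  second algebra to be commutative. Its Kubo-Ando mean is then the conventional one, so
  \<open>A \<mapsto> (\<psi> A) powr p\<close> preserves arithmetic means. After normalisation it extends to a unital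
  order isomorphism of the self-adjoint parts, which by Kadison's inequality in both directions
  preserves squares, and so the first algebra inherits from the second the associativity of the
  Jordan product; this again says \<open>[a, [a, b]] = 0\<close>.
\<close>

text \<open>The factor \<open>(p - 1) * (p + 1)\<close> has a meaning: at the endpoints the
  Kubo-Ando mean is the arithmetic mean (\<open>p = 1\<close>) or the harmonic mean
  (\<open>p = -1\<close>), which inversion conjugates to the arithmetic one. Both are medial in
  every algebra, so an obstruction to mediality has to vanish there. Third order is the first place
  for an obstruction. Both sides agree when \<open>a\<close> and \<open>b\<close> commute, and a
  self-adjoint quadratic expression with real coefficients that vanishes for commuting
  \<open>a\<close>, \<open>b\<close> is zero, because the commutator is skew-adjoint. At third order
  \<open>[a, [a, b]]\<close> and \<open>[b, [b, a]]\<close> could occur; exchanging \<open>X\<close>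
  and \<open>Z\<close>, that is \<open>a\<close> and \<open>- a\<close>, leaves both sides unchanged
  and rules out the second, which is odd in \<open>a\<close>. The long preparation has its cause in
  \<open>cfc\<close>, a definite description: nothing can be computed with it before existence and
  uniqueness of the functional calculus are established for self-adjoint elements, and the isometry
  clause requires the spectral radius formula, hence a nonempty spectrum.\<close>

lemma scaleC_one [simp]: "scaleC 1 x = (x::'a::cstar_algebra)"
  using scaleC_of_real[of 1 x] by simp

lemma scaleC_zero_left [simp]: "scaleC 0 x = (0::'a::cstar_algebra)"
  using scaleC_of_real[of 0 x] by simp

lemma scaleC_zero_right [simp]: "scaleC c 0 = (0::'a::cstar_algebra)"
  using scaleC_add_right[of c 0 0] by simp

lemma scaleC_minus_left: "scaleC (- c) x = - scaleC c (x::'a::cstar_algebra)"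
  using scaleC_add_left[of c "-c" x] by (simp add: eq_neg_iff_add_eq_0 add.commute)

lemma scaleC_minus_right: "scaleC c (- x) = - scaleC c (x::'a::cstar_algebra)"
  using scaleC_add_right[of c x "-x"] by (simp add: eq_neg_iff_add_eq_0 add.commute)

lemma scaleC_diff_right: "scaleC c (x - y) = scaleC c x - scaleC c (y::'a::cstar_algebra)"
  using scaleC_add_right[of c x "-y"] by (simp add: scaleC_minus_right)

lemma scaleC_of_real_one: "scaleC (complex_of_real r) (1::'a::cstar_algebra) = of_real r"
  using scaleC_of_real[of r "1::'a"] by (simp add: of_real_def)

lemma norm_scaleC_one [simp]: "norm (scaleC z (1::'a::cstar_algebra)) = cmod z"
  by (simp add: norm_scaleC)

lemma star_zero [simp]: "star (0::'a::cstar_algebra) = 0"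
  using star_add[of 0 "0::'a"] by simp

lemma star_one [simp]: "star (1::'a::cstar_algebra) = 1"
  by (metis mult.left_neutral mult.right_neutral star_mult star_star)

lemma star_minus: "star (- x) = - star (x::'a::cstar_algebra)"
  using star_add[of x "-x"] by (simp add: eq_neg_iff_add_eq_0 add.commute)

lemma star_diff: "star (x - y) = star x - star (y::'a::cstar_algebra)"
  using star_add[of x "-y"] by (simp add: star_minus)

lemma star_scaleR: "star (r *\<^sub>R x) = r *\<^sub>R star (x::'a::cstar_algebra)"
  by (metis complex_cnj_complex_of_real scaleC_of_real star_scaleC)

lemma star_of_real [simp]: "star (of_real r) = (of_real r :: 'a::cstar_algebra)"
  by (simp add: of_real_def star_scaleR)

lemma star_power: "star (x ^ n) = star (x::'a::cstar_algebra) ^ n"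
  by (induction n) (auto simp: star_mult power_commutes)

lemma star_sum: "star (sum f I) = (\<Sum>i\<in>I. star (f i :: 'a::cstar_algebra))"
  by (induction I rule: infinite_finite_induct) (auto simp: star_add)

lemmas star_simps = star_star star_add star_diff star_minus star_scaleR star_mult star_power

lemma norm_star [simp]: "norm (star x) = norm (x::'a::cstar_algebra)"
proof -
  have le: "norm y \<le> norm (star y)" for y :: 'a
  proof (cases "y = 0")
    case False
    have "norm y * norm y \<le> norm (star y) * norm y"
      using norm_mult_ineq[of "star y" y] cstar_identity[of y] by (simp add: power2_eq_square)
    then show ?thesis using False by simp
  qed auto
  from le[of x] le[of "star x"] show ?thesis by (simp add: star_star)
qed

lemma bounded_linear_star: "bounded_linear (star :: 'a::cstar_algebra \<Rightarrow> 'a)"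
  by (rule bounded_linear_intro[where K=1]) (auto simp: star_add star_scaleR)

lemma bounded_linear_scaleC: "bounded_linear (scaleC c :: 'a::cstar_algebra \<Rightarrow> 'a)"
proof (rule bounded_linear_intro[where K="cmod c"])
  show "scaleC c (r *\<^sub>R x) = r *\<^sub>R scaleC c x" for r and x :: 'a
    by (simp flip: scaleC_of_real add: scaleC_scaleC mult.commute)
qed (auto simp: scaleC_add_right norm_scaleC mult.commute)

subsection \<open>Invertible elements and the spectrum\<close>

definition ainv :: "'a::cstar_algebra \<Rightarrow> 'a" where
  "ainv a = (THE b. a * b = 1 \<and> b * a = 1)"

lemma ainv_eqI:
  fixes a b :: "'a::cstar_algebra"
  assumes "a * b = 1" "b * a = 1"
  shows "ainv a = b"
  unfolding ainv_def
proof (rule the_equality)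
  fix c assume "a * c = 1 \<and> c * a = 1"
  then show "c = b" by (metis assms(1) mult.assoc mult.left_neutral mult.right_neutral)
qed (use assms in auto)

lemma ainv:
  fixes a :: "'a::cstar_algebra"
  assumes "invertible_elem a"
  shows "a * ainv a = 1" "ainv a * a = 1"
  using assms ainv_eqI unfolding invertible_elem_def by auto

lemma invertible_elemI: "a * b = 1 \<Longrightarrow> b * a = 1 \<Longrightarrow> invertible_elem a"
  unfolding invertible_elem_def by blast

lemma invertible_one [simp]: "invertible_elem 1" "invertible_elem (- 1)"
  by (rule invertible_elemI[of _ 1], auto) (rule invertible_elemI[of _ "-1"], auto)

lemma invertible_mult:
  fixes a b :: "'a::cstar_algebra"
  assumes "invertible_elem a" "invertible_elem b"
  shows "invertible_elem (a * b)"
proof (rule invertible_elemI)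
  show "a * b * (ainv b * ainv a) = 1" "ainv b * ainv a * (a * b) = 1"
    using ainv[OF assms(1)] ainv[OF assms(2)]
    by (metis mult.assoc mult.right_neutral)+
qed

text \<open>If \<open>c\<close> inverts \<open>a * b\<close>, then \<open>b * c\<close> is a right
  inverse of \<open>a\<close>, and commutation turns it into a left inverse as well. Spectral
  mapping for polynomials rests on this.\<close>

lemma invertible_commuting_factor:
  fixes a b :: "'a::cstar_algebra"
  assumes "invertible_elem (a * b)" "a * b = b * a"
  shows "invertible_elem a"
proof (rule invertible_elemI)
  define c where "c = ainv (a * b)"
  have c: "a * b * c = 1" "c * (a * b) = 1" using ainv[OF assms(1)] by (auto simp: c_def)
  show "a * (b * c) = 1" using c by (simp add: mult.assoc)
  have "b * c = c * b"
    by (metis (no_types, lifting) assms(2) c mult.assoc mult.left_neutral mult.right_neutral)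
  then show "b * c * a = 1" using c assms(2) by (simp add: mult.assoc)
qed

lemma invertible_scaleC:
  fixes a :: "'a::cstar_algebra"
  assumes "c \<noteq> 0" shows "invertible_elem (scaleC c a) \<longleftrightarrow> invertible_elem a"
proof -
  have *: "invertible_elem (scaleC c a)" if "c \<noteq> 0" "invertible_elem a" for c and a :: 'a
    by (rule invertible_elemI[of _ "scaleC (1/c) (ainv a)"])
      (use that in \<open>auto simp: mult_scaleC_left mult_scaleC_right scaleC_scaleC ainv\<close>)
  show ?thesis using *[OF assms, of a] *[of "1/c" "scaleC c a"] assms by (auto simp: scaleC_scaleC)
qed

lemma invertible_one_minus:
  fixes x :: "'a::cstar_algebra"
  assumes "norm x < 1"
  shows "invertible_elem (1 - x)"
proof -
  define s where "s = (\<Sum>n. x ^ n)"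
  have sm: "summable (\<lambda>n. x ^ n)" by (rule complete_algebra_summable_geometric[OF assms])
  have 1: "s = 1 + (\<Sum>n. x ^ Suc n)" unfolding s_def using suminf_split_head[OF sm] by simp
  have 2: "(\<Sum>n. x ^ Suc n) = x * s" unfolding s_def using suminf_mult[OF sm, of x] by simp
  have 3: "(\<Sum>n. x ^ Suc n) = s * x" unfolding s_def using suminf_mult2[OF sm, of x]
    by (simp add: power_commutes)
  show ?thesis by (rule invertible_elemI[of _ s]) (use 1 2 3 in \<open>auto simp: algebra_simps\<close>)
qed

lemma invertible_near:
  fixes a :: "'a::cstar_algebra"
  assumes "invertible_elem a" "norm (a - y) * norm (ainv a) < 1"
  shows "invertible_elem y"
proof -
  have "y = a * (1 - ainv a * (a - y))"
    using ainv[OF assms(1)] by (simp add: algebra_simps flip: mult.assoc)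
  moreover have "norm (ainv a * (a - y)) < 1"
    using norm_mult_ineq[of "ainv a" "a - y"] assms(2) by (simp add: mult.commute)
  ultimately show ?thesis using invertible_mult[OF assms(1) invertible_one_minus] by metis
qed

lemma ainv_diff:
  fixes a :: "'a::cstar_algebra"
  assumes "invertible_elem a" "invertible_elem y"
  shows "ainv y - ainv a = ainv y * (a - y) * ainv a"
proof -
  have "ainv y * (a - y) * ainv a = ainv y * (a * ainv a) - (ainv y * y) * ainv a"
    by (simp add: algebra_simps)
  then show ?thesis using ainv[OF assms(1)] ainv[OF assms(2)] by simp
qed

lemma open_invertible: "open {a::'a::cstar_algebra. invertible_elem a}"
  unfolding open_dist
proof (safe)
  fix a :: 'a assume a: "invertible_elem a"
  then have pos: "norm (ainv a) > 0" using ainv(1)[OF a] by auto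
  show "\<exists>e>0. \<forall>y. dist y a < e \<longrightarrow> y \<in> Collect invertible_elem"
    by (rule exI[of _ "1 / norm (ainv a)"])
      (use pos invertible_near[OF a] in \<open>auto simp: dist_norm norm_minus_commute field_simps\<close>)
qed

lemma continuous_on_ainv: "continuous_on {a::'a::cstar_algebra. invertible_elem a} ainv"
  unfolding continuous_on_def
proof safe
  fix a :: 'a assume a: "invertible_elem a"
  define K where "K = norm (ainv a)"
  have pos: "K > 0" using ainv(1)[OF a] by (auto simp: K_def)
  have bd: "norm (ainv y - ainv a) \<le> 2 * K^2 * dist y a"
    if "invertible_elem y" "dist y a < 1 / (2 * K)" for y
  proof -
    have d: "dist y a * K \<le> 1/2" using that pos by (simp add: field_simps)
    have "norm (ainv y * (a - y) * ainv a) \<le> norm (ainv y) * dist y a * K"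
      unfolding K_def dist_norm norm_minus_commute[of y a]
      by (meson norm_mult_ineq order.trans mult_right_mono norm_ge_zero)
    then have 1: "norm (ainv y - ainv a) \<le> norm (ainv y) * dist y a * K"
      by (simp add: ainv_diff[OF a that(1)])
    \<comment> \<open>Within distance \<open>1 / (2 * K)\<close> the unknown
      \<open>norm (ainv y)\<close> reappears with a factor of at most 1/2 and can be absorbed, which
      yields the a priori bound \<open>2 * K\<close>.\<close>
    have "norm (ainv y) * (dist y a * K) \<le> norm (ainv y) * (1/2)"
      by (rule mult_left_mono[OF d]) auto
    then have "norm (ainv y) \<le> 2 * K" using 1 norm_triangle_sub[of "ainv y" "ainv a"] K_def by (simp add: mult.assoc)
    then have "norm (ainv y) * (dist y a * K) \<le> (2 * K) * (dist y a * K)"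
      using pos by (intro mult_right_mono) auto
    then show ?thesis using 1 by (simp add: power2_eq_square mult_ac)
  qed
  have "eventually (\<lambda>y. invertible_elem y \<and> dist y a < 1 / (2 * K)) (at a within Collect invertible_elem)"
    unfolding eventually_at using pos by (intro exI[of _ "1 / (2*K)"]) auto
  then have "eventually (\<lambda>y. norm (ainv y - ainv a) \<le> 2 * K^2 * dist y a) (at a within Collect invertible_elem)"
    by eventually_elim (use bd in auto)
  moreover have "((\<lambda>y. 2 * K^2 * dist y a) \<longlongrightarrow> 2 * K^2 * dist a a) (at a within Collect invertible_elem)"
    by (intro tendsto_intros)
  ultimately show "(ainv \<longlongrightarrow> ainv a) (at a within Collect invertible_elem)"
    using Lim_null_comparison[of "\<lambda>y. ainv y - ainv a" "\<lambda>y. 2 * K^2 * dist y a"] by (simp add: LIM_zero_iff)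
qed

lemma norm_spectrum_le:
  fixes a :: "'a::cstar_algebra"
  assumes "z \<in> cstar_spectrum a"
  shows "cmod z \<le> norm a"
proof (rule ccontr)
  assume "\<not> ?thesis"
  then have less: "norm a < cmod z" and z0: "z \<noteq> 0" by auto
  then have "norm (scaleC (1/z) a) < 1" by (simp add: norm_scaleC norm_divide)
  then have "invertible_elem (scaleC (-z) (1 - scaleC (1/z) a))"
    using z0 invertible_one_minus invertible_scaleC[of "-z" "1 - scaleC (1/z) a"] by simp
  moreover have "scaleC (-z) (1 - scaleC (1/z) a) = a - scaleC z 1"
    using z0 by (simp add: scaleC_diff_right scaleC_scaleC scaleC_minus_left)
  ultimately show False using assms by (simp add: cstar_spectrum_def)
qed

lemma continuous_scaleC_one: "continuous_on S (\<lambda>z. scaleC z (1::'a::cstar_algebra))"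
proof (rule linear_continuous_on)
  show "bounded_linear (\<lambda>z. scaleC z (1::'a))"
  proof (rule bounded_linear_intro[where K=1])
    show "scaleC (r *\<^sub>R z) (1::'a) = r *\<^sub>R scaleC z 1" for r z
      by (simp flip: scaleC_of_real add: scaleC_scaleC scaleR_conv_of_real)
  qed (auto simp: scaleC_add_left)
qed

lemma compact_spectrum: "compact (cstar_spectrum (a::'a::cstar_algebra))"
proof -
  have "bounded (cstar_spectrum a)"
    unfolding bounded_iff using norm_spectrum_le by blast
  moreover have "closed (cstar_spectrum a)"
  proof -
    have "continuous_on UNIV (\<lambda>z. a - scaleC z 1)"
      by (intro continuous_intros continuous_scaleC_one)
    then have "open ((\<lambda>z. a - scaleC z 1) -` {a. invertible_elem a})"
      using open_invertible continuous_on_open_vimage[OF open_UNIV] by fastforce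
    moreover have "(\<lambda>z. a - scaleC z 1) -` {a. invertible_elem a} = - cstar_spectrum a"
      by (auto simp: cstar_spectrum_def)
    ultimately show ?thesis by (simp add: closed_def)
  qed
  ultimately show ?thesis by (simp add: compact_eq_bounded_closed)
qed

text \<open>Shifting \<open>a\<close> by \<open>\<i> * t\<close> moves \<open>z\<close> to imaginary
  part \<open>Im z + t\<close>, while by the C*-identity the squared norm stays below
  \<open>(norm a)\<^sup>2 + t\<^sup>2\<close>. The terms quadratic in \<open>t\<close> cancel, and a
  bound that remains linear in \<open>t\<close> fails for a suitable \<open>t\<close> unless
  \<open>Im z = 0\<close>.\<close>

lemma selfadjoint_spectrum_real:
  fixes a :: "'a::cstar_algebra"
  assumes sa: "star a = a" and z: "z \<in> cstar_spectrum a"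
  shows "Im z = 0"
proof (rule ccontr)
  assume im: "Im z \<noteq> 0"
  have le: "(Im z + t)\<^sup>2 \<le> (norm a)\<^sup>2 + t\<^sup>2" for t :: real
  proof -
    define b where "b = a + scaleC (\<i> * t) 1"
    have "b - scaleC (z + \<i> * t) 1 = a - scaleC z 1"
      unfolding b_def by (simp add: scaleC_add_left)
    then have "z + \<i> * t \<in> cstar_spectrum b" using z by (simp add: cstar_spectrum_def)
    then have "cmod (z + \<i> * t) \<le> norm b" by (rule norm_spectrum_le)
    moreover have "\<bar>Im z + t\<bar> \<le> cmod (z + \<i> * t)"
      using abs_Im_le_cmod[of "z + \<i> * t"] by simp
    ultimately have "(Im z + t)\<^sup>2 \<le> (norm b)\<^sup>2"
      by (simp flip: abs_le_square_iff)
    also have "\<dots> = norm (star b * b)" by (simp add: cstar_identity)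
    also have "star b * b = a * a + of_real (t\<^sup>2)"
    proof -
      define u :: 'a where "u = scaleC (\<i> * t) 1"
      have "star u = - u" by (simp add: u_def star_scaleC scaleC_minus_left)
      moreover have "u * u = - of_real (t\<^sup>2)"
        by (simp add: u_def mult_scaleC_left scaleC_scaleC power2_eq_square scaleC_minus_left mult_ac
            flip: scaleC_of_real_one)
      moreover have "u * a = a * u" by (simp add: u_def mult_scaleC_left mult_scaleC_right)
      ultimately show ?thesis by (simp add: b_def star_add sa algebra_simps flip: u_def)
    qed
    also have "norm \<dots> \<le> (norm a)\<^sup>2 + t\<^sup>2"
      using norm_triangle_ineq[of "a * a" "of_real (t\<^sup>2)"] norm_mult_ineq[of a a]
      by (simp add: power2_eq_square[of "norm a"] del: of_real_power)
    finally show ?thesis .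
  qed
  show False
  proof -
    have "(Im z)\<^sup>2 + 2 * (Im z * t) \<le> (norm a)\<^sup>2" for t
      using le[of t] by (simp add: power2_sum)
    from this[of "((norm a)\<^sup>2 + 1) / Im z"] im
    have "(Im z)\<^sup>2 + 2 * ((norm a)\<^sup>2 + 1) \<le> (norm a)\<^sup>2" by simp
    then show False by (smt (verit) zero_le_power2)
  qed
qed

subsection \<open>The spectral radius of a self-adjoint element\<close>

lemma norm_selfadjoint_power:
  fixes a :: "'a::cstar_algebra"
  assumes "star a = a"
  shows "norm (a ^ (2 ^ k)) = norm a ^ (2 ^ k)"
proof (induction k)
  case (Suc k)
  have "norm (a ^ (2 ^ Suc k)) = norm (star (a ^ (2 ^ k)) * a ^ (2 ^ k))"
    using assms by (simp add: star_power mult_2 power_add)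
  also have "\<dots> = (norm a ^ (2 ^ k))\<^sup>2" by (simp add: cstar_identity Suc)
  finally show ?case by (simp flip: power_mult add: mult.commute)
qed simp

text \<open>Partial fractions of \<open>1 / (1 - c * c)\<close>. This is the doubling step: it
  expresses the resolvent of a square by those of \<open>c\<close> and \<open>- c\<close>.\<close>

lemma ainv_one_minus_square:
  fixes c :: "'a::cstar_algebra"
  assumes 1: "invertible_elem (1 - c)" and 2: "invertible_elem (1 + c)"
  shows "invertible_elem (1 - c * c)"
    and "ainv (1 - c * c) = (1/2) *\<^sub>R (ainv (1 - c) + ainv (1 + c))"
proof -
  define u v where "u = ainv (1 - c)" and "v = ainv (1 + c)"
  have u: "(1 - c) * u = 1" "u * (1 - c) = 1" and v: "(1 + c) * v = 1" "v * (1 + c) = 1"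
    using ainv[OF 1] ainv[OF 2] by (auto simp: u_def v_def)
  have f: "1 - c * c = (1 + c) * (1 - c)" "1 - c * c = (1 - c) * (1 + c)"
    by (auto simp: algebra_simps)
  have a: "(1 - c * c) * u = 1 + c" "u * (1 - c * c) = 1 + c"
    by (subst f(1), simp only: mult.assoc u) (simp, subst f(2), simp only: mult.assoc[symmetric] u, simp)
  have b: "(1 - c * c) * v = 1 - c" "v * (1 - c * c) = 1 - c"
    by (subst f(2), simp only: mult.assoc v) (simp, subst f(1), simp only: mult.assoc[symmetric] v, simp)
  have "(1 - c * c) * ((1/2) *\<^sub>R (u + v)) = (1/2) *\<^sub>R ((1 + c) + (1 - c))"
    "((1/2) *\<^sub>R (u + v)) * (1 - c * c) = (1/2) *\<^sub>R ((1 + c) + (1 - c))"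
    using a b by (simp_all add: distrib_left distrib_right)
  then have *: "(1 - c * c) * ((1/2) *\<^sub>R (u + v)) = 1" "((1/2) *\<^sub>R (u + v)) * (1 - c * c) = 1"
    by (simp_all flip: scaleR_2)
  show "invertible_elem (1 - c * c)" using * by (rule invertible_elemI)
  show "ainv (1 - c * c) = (1/2) *\<^sub>R (ainv (1 - c) + ainv (1 + c))"
    using ainv_eqI[OF *] by (simp add: u_def v_def)
qed

text \<open>
  Rickart's argument, which needs no vector-valued complex analysis: if the resolvent of \<open>c\<close>,
  \<open>norm c = 1\<close>, exists up to the unit circle, it is uniformly continuous there, and the averaging
  identity above carries the estimate for \<open>c\<close> at the radii 1 and \<open>r < 1\<close> over to all
  \<open>c ^ (2 ^ k)\<close>. As \<open>(r c) ^ (2 ^ k)\<close> tends to 0, this contradicts \<open>norm (c ^ (2 ^ k)) = 1\<close>.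
\<close>

lemma spectral_radius_selfadjoint:
  fixes b :: "'a::cstar_algebra"
  assumes sa: "star b = b"
  shows "\<exists>z\<in>cstar_spectrum b. norm b \<le> cmod z"
proof (rule ccontr)
  assume neg: "\<not> ?thesis"
  have b0: "b \<noteq> 0"
  proof
    assume "b = 0"
    then have "0 \<in> cstar_spectrum b" by (auto simp: cstar_spectrum_def invertible_elem_def)
    with neg \<open>b = 0\<close> show False by auto
  qed
  define c where "c = (1 / norm b) *\<^sub>R b"
  have c1: "norm c = 1" and csa: "star c = c" using b0 sa by (auto simp: c_def star_scaleR)
  have inv: "invertible_elem (1 - scaleC w c)" if "cmod w \<le> 1" for w
  proof (cases "w = 0")
    case False
    define z where "z = of_real (norm b) / w"
    have "cmod z \<ge> norm b" using that False b0 by (simp add: z_def norm_divide field_simps)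
    then have "z \<notin> cstar_spectrum b" using neg
      by (metis less_eq_real_def neg norm_spectrum_le)
    then have "invertible_elem (scaleC (- (w / of_real (norm b))) (b - scaleC z 1))"
      using False b0 by (subst invertible_scaleC) (auto simp: cstar_spectrum_def)
    moreover have "scaleC (- (w / of_real (norm b))) (b - scaleC z 1) = 1 - scaleC w c"
      using False b0
      by (simp add: scaleC_diff_right scaleC_scaleC scaleC_minus_left z_def c_def flip: scaleC_of_real)
    ultimately show ?thesis by simp
  qed auto
  define G where "G w = ainv (1 - scaleC w c)" for w
  have "continuous_on (cball 0 1) G"
    unfolding G_def
  proof (rule continuous_on_compose2[OF continuous_on_ainv])
    have "continuous_on (cball 0 1) (\<lambda>w. 1 - scaleC w 1 * c)"
      by (intro continuous_intros continuous_scaleC_one)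
    then show "continuous_on (cball 0 1) (\<lambda>w. 1 - scaleC w c)" by (simp add: mult_scaleC_left)
  qed (use inv in auto)
  then have "uniformly_continuous_on (cball 0 1) G"
    by (intro compact_uniformly_continuous) auto
  then obtain d where d: "d > 0" "\<And>x y. x \<in> cball 0 1 \<Longrightarrow> y \<in> cball 0 1 \<Longrightarrow> dist x y < d \<Longrightarrow> dist (G x) (G y) < 1/4"
    unfolding uniformly_continuous_on_def by (metis zero_less_divide_1_iff zero_less_numeral)
  \<comment> \<open>The maximum keeps \<open>r\<close> nonnegative when \<open>d\<close> is large;
    \<open>1 - r < d\<close> holds in either case.\<close>
  define r where "r = max 0 (1 - d/2)"
  have r: "0 \<le> r" "r < 1" "1 - r < d" using d(1) by (auto simp: r_def max_def)
  define H where "H = (\<lambda>s w k. 1 - scaleC (of_real (s ^ (2^k)) * w) (c ^ (2^k)))"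
  have step: "invertible_elem (H 1 w k) \<and> invertible_elem (H r w k) \<and>
     norm (ainv (H 1 w k) - ainv (H r w k)) \<le> 1/4" if "cmod w = 1" for w k
    using that
  proof (induction k arbitrary: w)
    case 0
    have rw: "cmod (complex_of_real r * w) \<le> 1" using 0 r by (simp add: norm_mult)
    have "w - complex_of_real r * w = complex_of_real (1 - r) * w" by (simp add: algebra_simps)
    then have "dist w (complex_of_real r * w) = 1 - r" using 0 r by (simp only: dist_norm norm_mult norm_of_real) simp
    then have "dist (G w) (G (of_real r * w)) < 1/4"
      using d(2)[of w "of_real r * w"] 0 rw r by auto
    then show ?case using 0 rw inv by (simp add: H_def G_def dist_norm)
  next
    case (Suc k)
    \<comment> \<open>Both square roots \<open>v\<close> and \<open>- v\<close> of \<open>w\<close>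
      lie on the unit circle, so the induction hypothesis applies to each; averaging the two
      estimates preserves the bound 1/4.\<close>
    define v where "v = csqrt w"
    have v2: "v * v = w" by (metis power2_csqrt power2_eq_square v_def)
    have nv: "cmod v = 1" "cmod (-v) = 1"
      using Suc.prems v2 by (metis norm_ge_zero norm_mult norm_minus_cancel abs_of_nonneg real_sqrt_abs2 real_sqrt_one)+
    note IH = Suc.IH[OF nv(1)] Suc.IH[OF nv(2)]
    define C where "C s = scaleC (of_real (s ^ (2^k)) * v) (c ^ (2^k))" for s
    have H1: "H s v k = 1 - C s" "H s (-v) k = 1 + C s" for s
      by (auto simp: H_def C_def scaleC_minus_left)
    have CC: "C s * C s = scaleC (of_real (s ^ (2^Suc k)) * w) (c ^ (2^Suc k))" for s
      unfolding C_def v2[symmetric]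
      by (simp add: mult_scaleC_left mult_scaleC_right scaleC_scaleC mult_2 power_add mult_ac)
    then have H2: "H s w (Suc k) = 1 - C s * C s" for s by (simp add: H_def)
    have i: "invertible_elem (1 - C s)" "invertible_elem (1 + C s)" if "s = 1 \<or> s = r" for s
      using that IH H1 by metis+
    have "ainv (H 1 w (Suc k)) - ainv (H r w (Suc k)) =
       (1/2) *\<^sub>R ((ainv (H 1 v k) - ainv (H r v k)) + (ainv (H 1 (-v) k) - ainv (H r (-v) k)))"
      using ainv_one_minus_square(2)[of "C 1"] ainv_one_minus_square(2)[of "C r"] i
      unfolding H2 H1 by (simp add: algebra_simps)
    also have "norm \<dots> \<le> 1/2 * (1/4 + 1/4)"
      unfolding norm_scaleR using IH by (intro mult_mono norm_triangle_mono) auto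
    finally show ?case using ainv_one_minus_square(1)[of "C 1"] ainv_one_minus_square(1)[of "C r"] i
      unfolding H2 by auto
  qed
  obtain k where k: "r ^ (2 ^ k) < 1/8"
  proof -
    obtain n where n: "r ^ n < 1/8" using real_arch_pow_inv[of "1/8" r] r by auto
    have "r ^ (2 ^ n) \<le> r ^ n" using r less_exp[of n] by (intro power_decreasing) auto
    with n show ?thesis by (intro that[of n]) linarith
  qed
  define y z where "y = c ^ (2^k)" and "z = (r ^ (2^k)) *\<^sub>R y"
  have ny: "norm y = 1" using norm_selfadjoint_power[OF csa, of k] c1 by (simp add: y_def)
  have nz: "norm z < 1/8" using k ny r by (simp add: z_def)
  have H: "H 1 1 k = 1 - y" "H r 1 k = 1 - z"
    by (auto simp: H_def y_def z_def scaleC_of_real simp flip: of_real_power)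
  have iy: "invertible_elem (1 - y)" and iz: "invertible_elem (1 - z)"
    and close: "norm (ainv (1 - y) - ainv (1 - z)) \<le> 1/4"
    using step[of 1 k] unfolding H by auto
  \<comment> \<open>From \<open>norm z < 1/8\<close> one gets 1/7, rounded up to 1/6; adding the 1/4
    from \<open>close\<close> gives 5/12. The contradiction at the end is
    \<open>1 = norm y \<le> 5/12 + 5/12\<close>.\<close>
  have "norm (ainv (1 - z) - 1) \<le> 1/6"
  proof -
    have "ainv (1 - z) - 1 = ainv (1 - z) * z"
      using ainv(2)[OF iz] by (simp add: algebra_simps)
    then have le: "norm (ainv (1 - z) - 1) \<le> norm (ainv (1 - z)) * norm z"
      using norm_mult_ineq by metis
    have "norm (ainv (1 - z)) * norm z \<le> norm (ainv (1 - z)) * (1/8)"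
      using nz by (intro mult_left_mono) auto
    moreover have "norm (ainv (1 - z)) \<le> norm (ainv (1 - z) - 1) + 1"
      using norm_triangle_sub[of "ainv (1 - z)" 1] by simp
    ultimately show ?thesis using le by linarith
  qed
  then have e: "norm (ainv (1 - y) - 1) \<le> 5/12"
    using close norm_triangle_ineq[of "ainv (1 - y) - ainv (1 - z)" "ainv (1 - z) - 1"] by simp
  have "y = (ainv (1 - y) - 1) - (ainv (1 - y) - 1) * y"
    using ainv(2)[OF iy] by (simp add: algebra_simps)
  then have "norm y \<le> norm (ainv (1 - y) - 1) + norm ((ainv (1 - y) - 1) * y)"
    by (metis norm_triangle_ineq4)
  also have "\<dots> \<le> 5/12 + 5/12 * 1"
    using e norm_mult_ineq[of "ainv (1 - y) - 1" y] ny by simp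
  finally show False using ny by simp
qed

lemma spectrum_nonempty: "star a = a \<Longrightarrow> cstar_spectrum (a::'a::cstar_algebra) \<noteq> {}"
  using spectral_radius_selfadjoint by blast

subsection \<open>Polynomials in an element\<close>

text \<open>Horner's scheme with complex coefficients and an argument from a possibly noncommutative
  algebra, to which \<open>poly\<close> does not apply.\<close>

definition peval :: "complex poly \<Rightarrow> 'a::cstar_algebra \<Rightarrow> 'a" where
  "peval p a = fold_coeffs (\<lambda>c x. scaleC c 1 + a * x) p 0"

lemma peval_0 [simp]: "peval 0 a = 0"
  by (simp add: peval_def)

lemma peval_pCons [simp]: "peval (pCons c p) a = scaleC c 1 + a * peval p a"
  by (cases "p = 0 \<and> c = 0") (auto simp: peval_def)

lemma peval_add: "peval (p + q) a = peval p a + peval q a"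
  by (induction p q rule: poly_induct2) (auto simp: algebra_simps scaleC_add_left)

lemma peval_smult: "peval (smult c p) a = scaleC c (peval p a)"
  by (induction p) (auto simp: scaleC_add_right scaleC_scaleC mult_scaleC_right)

lemma peval_mult: "peval (p * q) a = peval p a * peval q a"
  by (induction p) (auto simp: algebra_simps peval_add peval_smult mult_scaleC_left)

lemma peval_diff: "peval (p - q) a = peval p a - peval q a"
proof -
  have "p - q = p + smult (-1) q" by simp
  then show ?thesis by (simp only: peval_add peval_smult) (simp add: scaleC_minus_left)
qed

lemma peval_cnj:
  assumes "star a = a"
  shows "peval (map_poly cnj p) a = star (peval p a)"
proof (induction p)
  case (pCons c p)
  have comm: "a * peval p a = peval p a * a" for p
    using peval_mult[of "[:0,1:]" p a] peval_mult[of p "[:0,1:]" a] by (simp add: mult.commute)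
  have "a * star (peval p a) = star (peval p a) * a"
    using comm[of p] assms by (metis star_mult)
  with pCons show ?case by (simp add: map_poly_pCons star_add star_mult star_scaleC assms)
qed auto

text \<open>The fundamental theorem of algebra splits \<open>p\<close> into linear factors, and
  \<open>a - z\<close> is invertible at every root \<open>z\<close> of \<open>p\<close> by
  assumption.\<close>

lemma invertible_peval:
  fixes a :: "'a::cstar_algebra"
  assumes "p \<noteq> 0" "\<And>z. poly p z = 0 \<Longrightarrow> z \<notin> cstar_spectrum a"
  shows "invertible_elem (peval p a)"
  using assms
proof (induction "degree p" arbitrary: p)
  case 0
  then obtain c where "p = [:c:]" "c \<noteq> 0" using degree_eq_zeroE by (metis pCons_0_0)
  then show ?case by (simp add: invertible_scaleC)
next
  case (Suc n)
  have "\<exists>z. poly p z = 0"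
    using Suc.hyps(2) by (intro fundamental_theorem_of_algebra_alt) auto
  then obtain z q where z: "poly p z = 0" and p: "p = [:-z, 1:] * q"
    by (metis dvdE poly_eq_0_iff_dvd)
  have q: "q \<noteq> 0" "n = degree q" using Suc.prems(1) Suc.hyps(2) degree_mult_eq[of "[:-z, 1:]" q] unfolding p by fastforce+
  have "invertible_elem (peval q a)"
    using Suc.hyps(1)[OF q(2) q(1)] Suc.prems(2) p by auto
  moreover have "invertible_elem (peval [:-z, 1:] a)"
    using Suc.prems(2)[OF z] by (simp add: cstar_spectrum_def scaleC_minus_left)
  ultimately show ?case unfolding p peval_mult by (intro invertible_mult)
qed

lemma spectrum_peval:
  fixes a :: "'a::cstar_algebra"
  assumes "cstar_spectrum a \<noteq> {}"
  shows "cstar_spectrum (peval p a) = poly p ` cstar_spectrum a"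
proof safe
  fix w assume w: "w \<in> cstar_spectrum (peval p a)"
  have e: "peval (p - [:w:]) a = peval p a - scaleC w 1" by (simp add: peval_diff)
  then have "\<not> invertible_elem (peval (p - [:w:]) a)" using w by (simp add: cstar_spectrum_def)
  \<comment> \<open>A constant polynomial has no linear factor to look at; here the nonempty
    spectrum supplies a preimage of \<open>w\<close>.\<close>
  moreover have "w \<in> poly p ` cstar_spectrum a" if "p - [:w:] = 0"
  proof -
    have "p = [:w:]" using that by simp
    then show ?thesis using assms by (auto simp: image_iff)
  qed
  ultimately show "w \<in> poly p ` cstar_spectrum a"
    using invertible_peval[of "p - [:w:]" a] by force
next
  fix z assume z: "z \<in> cstar_spectrum a"
  show "poly p z \<in> cstar_spectrum (peval p a)"
  proof (rule ccontr)
    assume "\<not> ?thesis"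
    moreover have "[:-z, 1:] dvd p - [:poly p z:]" by (subst poly_eq_0_iff_dvd[symmetric]) simp
    then obtain q where q: "p - [:poly p z:] = [:-z, 1:] * q" by (elim dvdE)
    then have "peval (p - [:poly p z:]) a = peval [:-z, 1:] a * peval q a"
      by (simp only: peval_mult)
    then have "peval p a - scaleC (poly p z) 1 = peval [:-z, 1:] a * peval q a"
      by (simp add: peval_diff)
    ultimately have "invertible_elem (peval [:-z, 1:] a * peval q a)" by (simp add: cstar_spectrum_def)
    then have "invertible_elem (peval [:-z, 1:] a)"
      by (rule invertible_commuting_factor) (simp only: peval_mult[symmetric] mult.commute)
    with z show False by (simp add: cstar_spectrum_def scaleC_minus_left)
  qed
qed

text \<open>\<open>peval p a\<close> is in general not self-adjoint, so the spectral radius formula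
  is applied to \<open>star (peval p a) * peval p a\<close>, again a polynomial in \<open>a\<close>,
  and the C*-identity takes the square root. Thus evaluation is isometric for the supremum norm on
  the spectrum, which allows passing from polynomials to continuous functions.\<close>

lemma norm_peval:
  fixes a :: "'a::cstar_algebra"
  assumes sa: "star a = a"
  shows "\<And>z. z \<in> cstar_spectrum a \<Longrightarrow> cmod (poly p z) \<le> norm (peval p a)"
    and "\<exists>z\<in>cstar_spectrum a. norm (peval p a) \<le> cmod (poly p z)"
proof -
  note sp = spectrum_peval[OF spectrum_nonempty[OF sa]]
  show "\<And>z. z \<in> cstar_spectrum a \<Longrightarrow> cmod (poly p z) \<le> norm (peval p a)"
    using norm_spectrum_le sp by (metis imageI)
  define q where "q = map_poly cnj p * p"
  have q: "peval q a = star (peval p a) * peval p a" by (simp add: q_def peval_mult peval_cnj[OF sa])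
  have "star (peval q a) = peval q a" by (simp add: q star_mult star_star)
  then obtain w where w: "w \<in> cstar_spectrum (peval q a)" "norm (peval q a) \<le> cmod w"
    using spectral_radius_selfadjoint by blast
  then obtain z where z: "z \<in> cstar_spectrum a" "w = poly q z" using sp by blast
  have "cnj z = z" using selfadjoint_spectrum_real[OF sa z(1)] by (simp add: complex_eq_iff)
  then have "(norm (peval p a))\<^sup>2 \<le> (cmod (poly p z))\<^sup>2"
    using w(2) unfolding q cstar_identity z(2)
    by (simp add: q_def \<open>cnj z = z\<close> norm_mult power2_eq_square[of "cmod _"])
  then show "\<exists>z\<in>cstar_spectrum a. norm (peval p a) \<le> cmod (poly p z)"
    using z(1) by (meson norm_ge_zero power2_le_imp_le)
qed

subsection \<open>The continuous functional calculus of a self-adjoint element\<close>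

text \<open>Stone-Weierstrass on \<open>complex\<close> produces polynomials in \<open>Re z\<close>
  and \<open>Im z\<close>. On the real axis, where the spectrum lies, each of them is a polynomial
  in \<open>z\<close>, a linear form \<open>f\<close> becoming \<open>z * f 1\<close>.\<close>

lemma real_polynomial_function_complex_poly:
  assumes "real_polynomial_function (g :: complex \<Rightarrow> real)"
  shows "\<exists>p. \<forall>z. Im z = 0 \<longrightarrow> complex_of_real (g z) = poly p z"
  using assms
proof induction
  case (linear f)
  have "complex_of_real (f z) = poly [:0, of_real (f 1):] z" if "Im z = 0" for z
  proof -
    have z: "z = Re z *\<^sub>R 1" using that by (simp add: complex_eq_iff)
    have "f z = Re z * f 1" by (subst z) (simp add: linear_simps(5)[OF linear] del: scaleR_conv_of_real)
    then show ?thesis using that by (simp add: complex_eq_iff)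
  qed
  then show ?case by blast
next
  case (const c) then show ?case by (intro exI[of _ "[:of_real c:]"]) auto
next
  case (add f g) then show ?case by (metis of_real_add poly_add)
next
  case (mult f g) then show ?case by (metis of_real_mult poly_mult)
qed

lemma uniform_poly_approx:
  assumes S: "compact S" "\<And>z. z \<in> S \<Longrightarrow> Im z = 0" and f: "continuous_on S f"
  shows "\<exists>P :: nat \<Rightarrow> complex poly. uniform_limit S (\<lambda>n. poly (P n)) f sequentially"
proof -
  have approx: "\<exists>p. \<forall>z\<in>S. cmod (poly p z - f z) < e" if "e > 0" for e
  proof -
    have e: "e / 2 > 0" using that by simp
    obtain g where g: "real_polynomial_function g" "\<And>x. x \<in> S \<Longrightarrow> \<bar>Re (f x) - g x\<bar> < e/2"
      using Stone_Weierstrass_real_polynomial_function[OF S(1) continuous_on_Re[OF f] e] by blast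
    obtain h where h: "real_polynomial_function h" "\<And>x. x \<in> S \<Longrightarrow> \<bar>Im (f x) - h x\<bar> < e/2"
      using Stone_Weierstrass_real_polynomial_function[OF S(1) continuous_on_Im[OF f] e] by blast
    obtain p q where pq: "\<And>z. Im z = 0 \<Longrightarrow> complex_of_real (g z) = poly p z"
       "\<And>z. Im z = 0 \<Longrightarrow> complex_of_real (h z) = poly q z"
      using real_polynomial_function_complex_poly g(1) h(1) by meson
    have "cmod (poly (p + smult \<i> q) z - f z) < e" if z: "z \<in> S" for z
    proof -
      have "poly (p + smult \<i> q) z - f z = of_real (g z - Re (f z)) + \<i> * of_real (h z - Im (f z))"
        using pq[OF S(2)[OF z]] by (simp add: complex_eq_iff flip: pq)
      then have "cmod (poly (p + smult \<i> q) z - f z) \<le> \<bar>g z - Re (f z)\<bar> + \<bar>h z - Im (f z)\<bar>"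
        by (metis norm_triangle_ineq norm_of_real norm_mult norm_ii mult_1)
      then show ?thesis using g(2)[OF z] h(2)[OF z] by linarith
    qed
    then show ?thesis by blast
  qed
  have "\<forall>n. \<exists>p. \<forall>z\<in>S. cmod (poly p z - f z) < inverse (real (Suc n))"
    using approx by simp
  then obtain P where P: "\<And>n z. z \<in> S \<Longrightarrow> cmod (poly (P n) z - f z) < inverse (real (Suc n))"
    by metis
  have "uniform_limit S (\<lambda>n. poly (P n)) f sequentially"
  proof (rule uniform_limitI)
    fix e :: real assume "e > 0"
    then have "\<forall>\<^sub>F n in sequentially. inverse (real (Suc n)) < e"
      using LIMSEQ_inverse_real_of_nat by (rule order_tendstoD(2)[rotated])
    then show "\<forall>\<^sub>F n in sequentially. \<forall>z\<in>S. dist (poly (P n) z) (f z) < e"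
      by eventually_elim (metis P dist_norm order_less_trans)
  qed
  then show ?thesis by blast
qed

text \<open>Closure of the graph of \<open>poly p \<mapsto> peval p a\<close>. As a relation it
  needs no chosen approximating sequence; the algebraic laws pass to limits, and functionality
  follows from the isometry.\<close>

definition fc_rel :: "'a::cstar_algebra \<Rightarrow> (complex \<Rightarrow> complex) \<Rightarrow> 'a \<Rightarrow> bool" where
  "fc_rel a f y \<longleftrightarrow> (\<exists>P. uniform_limit (cstar_spectrum a) (\<lambda>n. poly (P n)) f sequentially \<and>
     (\<lambda>n. peval (P n) a) \<longlonglongrightarrow> y)"

lemma fc_rel_poly: "fc_rel a (poly p) (peval p a)"
  unfolding fc_rel_def by (intro exI[of _ "\<lambda>n. p"]) (auto intro: uniform_limit_const)

lemma poly_fun_simps: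
  "poly (p + q) = (\<lambda>z. poly p z + poly q z)" "poly (p * q) = (\<lambda>z. poly p z * poly q z)"
  "poly (smult c p) = (\<lambda>z. c * poly p z)" "poly 0 = (\<lambda>z. 0)"
  by auto

lemma fc_rel_add: "fc_rel a f x \<Longrightarrow> fc_rel a g y \<Longrightarrow> fc_rel a (\<lambda>z. f z + g z) (x + y)"
  unfolding fc_rel_def
proof (elim exE conjE)
  fix P Q assume "uniform_limit (cstar_spectrum a) (\<lambda>n. poly (P n)) f sequentially"
   "uniform_limit (cstar_spectrum a) (\<lambda>n. poly (Q n)) g sequentially"
   "(\<lambda>n. peval (P n) a) \<longlonglongrightarrow> x" "(\<lambda>n. peval (Q n) a) \<longlonglongrightarrow> y"
  then show "\<exists>P. uniform_limit (cstar_spectrum a) (\<lambda>n. poly (P n)) (\<lambda>z. f z + g z) sequentially \<and>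
      (\<lambda>n. peval (P n) a) \<longlonglongrightarrow> x + y"
    by (intro exI[of _ "\<lambda>n. P n + Q n"]) (auto simp: peval_add poly_fun_simps intro!: uniform_limit_add tendsto_add)
qed

lemma bounded_image_spectrum:
  "continuous_on (cstar_spectrum a) f \<Longrightarrow> bounded (f ` cstar_spectrum (a::'a::cstar_algebra))"
  using compact_continuous_image compact_spectrum compact_imp_bounded by blast

lemma fc_rel_mult:
  assumes "fc_rel a f x" "fc_rel a g y"
    "continuous_on (cstar_spectrum a) f" "continuous_on (cstar_spectrum a) g"
  shows "fc_rel a (\<lambda>z. f z * g z) (x * y)"
  using assms(1,2) unfolding fc_rel_def
proof (elim exE conjE)
  fix P Q assume "uniform_limit (cstar_spectrum a) (\<lambda>n. poly (P n)) f sequentially"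
   "uniform_limit (cstar_spectrum a) (\<lambda>n. poly (Q n)) g sequentially"
   "(\<lambda>n. peval (P n) a) \<longlonglongrightarrow> x" "(\<lambda>n. peval (Q n) a) \<longlonglongrightarrow> y"
  then show "\<exists>P. uniform_limit (cstar_spectrum a) (\<lambda>n. poly (P n)) (\<lambda>z. f z * g z) sequentially \<and>
      (\<lambda>n. peval (P n) a) \<longlonglongrightarrow> x * y"
    by (intro exI[of _ "\<lambda>n. P n * Q n"])
       (auto simp: peval_mult poly_fun_simps intro!: uniform_lim_mult tendsto_mult bounded_image_spectrum assms)
qed

lemma fc_rel_scaleC:
  assumes "fc_rel a f x" shows "fc_rel a (\<lambda>z. c * f z) (scaleC c x)"
  using assms unfolding fc_rel_def
proof (elim exE conjE)
  fix P assume "uniform_limit (cstar_spectrum a) (\<lambda>n. poly (P n)) f sequentially"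
   "(\<lambda>n. peval (P n) a) \<longlonglongrightarrow> x"
  then show "\<exists>P. uniform_limit (cstar_spectrum a) (\<lambda>n. poly (P n)) (\<lambda>z. c * f z) sequentially \<and>
      (\<lambda>n. peval (P n) a) \<longlonglongrightarrow> scaleC c x"
    by (intro exI[of _ "\<lambda>n. smult c (P n)"])
      (auto simp: peval_smult poly_fun_simps intro!: bounded_linear.uniform_limit[OF bounded_linear_mult_right]
        bounded_linear.tendsto[OF bounded_linear_scaleC])
qed

lemma fc_rel_star:
  assumes "fc_rel a f x" "star a = a" shows "fc_rel a (\<lambda>z. cnj (f z)) (star x)"
  using assms(1) unfolding fc_rel_def
proof (elim exE conjE)
  fix P assume P: "uniform_limit (cstar_spectrum a) (\<lambda>n. poly (P n)) f sequentially"
   "(\<lambda>n. peval (P n) a) \<longlonglongrightarrow> x"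
  have "uniform_limit (cstar_spectrum a) (\<lambda>n z. cnj (poly (P n) z)) (\<lambda>z. cnj (f z)) sequentially"
    by (intro bounded_linear.uniform_limit[OF bounded_linear_cnj] P)
  moreover have "cnj (poly (P n) z) = poly (map_poly cnj (P n)) z" if "z \<in> cstar_spectrum a" for n z
  proof -
    have "cnj z = z" using selfadjoint_spectrum_real[OF assms(2) that] by (simp add: complex_eq_iff)
    then show ?thesis by simp
  qed
  ultimately have "uniform_limit (cstar_spectrum a) (\<lambda>n. poly (map_poly cnj (P n))) (\<lambda>z. cnj (f z)) sequentially"
    using uniform_limit_cong'[of "cstar_spectrum a" "\<lambda>n z. cnj (poly (P n) z)"] by (smt (verit, best))
  then show "\<exists>P. uniform_limit (cstar_spectrum a) (\<lambda>n. poly (P n)) (\<lambda>z. cnj (f z)) sequentially \<and>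
      (\<lambda>n. peval (P n) a) \<longlonglongrightarrow> star x"
    using P(2) by (intro exI[of _ "\<lambda>n. map_poly cnj (P n)"])
      (auto simp: peval_cnj[OF assms(2)] intro!: bounded_linear.tendsto[OF bounded_linear_star])
qed

lemma fc_rel_norm:
  assumes "fc_rel a f x" "star a = a"
  shows "\<And>z. z \<in> cstar_spectrum a \<Longrightarrow> cmod (f z) \<le> norm x"
    and "(\<And>z. z \<in> cstar_spectrum a \<Longrightarrow> cmod (f z) \<le> B) \<Longrightarrow> norm x \<le> B"
proof -
  obtain P where P: "uniform_limit (cstar_spectrum a) (\<lambda>n. poly (P n)) f sequentially"
   "(\<lambda>n. peval (P n) a) \<longlonglongrightarrow> x"
    using assms(1) by (auto simp: fc_rel_def)
  show "cmod (f z) \<le> norm x" if "z \<in> cstar_spectrum a" for z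
  proof (rule tendsto_le)
    show "(\<lambda>n. cmod (poly (P n) z)) \<longlonglongrightarrow> cmod (f z)"
      using tendsto_uniform_limitI[OF P(1) that] by (rule tendsto_norm)
    show "(\<lambda>n. norm (peval (P n) a)) \<longlonglongrightarrow> norm x" using P(2) by (rule tendsto_norm)
  qed (use norm_peval(1)[OF assms(2) that] in auto)
  show "norm x \<le> B" if B: "\<And>z. z \<in> cstar_spectrum a \<Longrightarrow> cmod (f z) \<le> B"
  proof (rule field_le_epsilon)
    fix e :: real assume "e > 0"
    have ev: "\<forall>\<^sub>F n in sequentially. norm (peval (P n) a) \<le> B + e"
      using uniform_limitD[OF P(1) \<open>e > 0\<close>]
    proof eventually_elim
      case (elim n)
      obtain z where z: "z \<in> cstar_spectrum a" "norm (peval (P n) a) \<le> cmod (poly (P n) z)"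
        using norm_peval(2)[OF assms(2)] by blast
      have "cmod (poly (P n) z) \<le> cmod (f z) + cmod (poly (P n) z - f z)"
        by (metis add.commute diff_add_cancel norm_triangle_ineq)
      then show ?case using z B[OF z(1)] elim by (force simp: dist_norm)
    qed
    then show "norm x \<le> B + e"
      by (intro tendsto_upperbound[OF tendsto_norm[OF P(2)] ev]) auto
  qed
qed

lemma fc_rel_unique:
  assumes "fc_rel a f x" "fc_rel a g y" "star a = a"
    "\<And>z. z \<in> cstar_spectrum a \<Longrightarrow> f z = g z"
  shows "x = y"
proof -
  have "fc_rel a (\<lambda>z. f z + (-1) * g z) (x + scaleC (-1) y)"
    by (intro fc_rel_add fc_rel_scaleC assms)
  from fc_rel_norm(2)[OF this assms(3), of 0] assms(4) show ?thesis
    by (simp add: scaleC_minus_left)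
qed

lemma fc_rel_ex:
  assumes "star a = a" "continuous_on (cstar_spectrum a) f"
  shows "\<exists>x. fc_rel a f x"
proof -
  obtain P where P: "uniform_limit (cstar_spectrum a) (\<lambda>n. poly (P n)) f sequentially"
    using uniform_poly_approx[OF compact_spectrum selfadjoint_spectrum_real[OF assms(1)] assms(2)] by auto
  have "Cauchy (\<lambda>n. peval (P n) a)"
  proof (rule CauchyI)
    fix e :: real assume e: "e > 0"
    then obtain M where M: "\<And>n z. n \<ge> M \<Longrightarrow> z \<in> cstar_spectrum a \<Longrightarrow> dist (poly (P n) z) (f z) < e/2"
      using uniform_limitD[OF P, of "e/2"] by (auto simp: eventually_sequentially)
    have "norm (peval (P m) a - peval (P n) a) < e" if mn: "m \<ge> M" "n \<ge> M" for m n
    proof -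
      obtain z where z: "z \<in> cstar_spectrum a" "norm (peval (P m - P n) a) \<le> cmod (poly (P m - P n) z)"
        using norm_peval(2)[OF assms(1)] by blast
      have "cmod (poly (P m - P n) z) < e"
        using dist_triangle_half_l[OF M[OF mn(1) z(1)] M[OF mn(2) z(1)]] by (simp add: dist_norm)
      then show ?thesis using z(2) by (simp add: peval_diff)
    qed
    then show "\<exists>M. \<forall>m\<ge>M. \<forall>n\<ge>M. norm (peval (P m) a - peval (P n) a) < e" by blast
  qed
  then show ?thesis using P by (auto simp: fc_rel_def Cauchy_convergent_iff convergent_def)
qed

lemma is_functional_calculusI:
  fixes a :: "'a::cstar_algebra"
  assumes sa: "star a = a" and \<Psi>: "\<And>f. continuous_on (cstar_spectrum a) f \<Longrightarrow> fc_rel a f (\<Psi> f)"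
  shows "is_functional_calculus a \<Psi>"
proof -
  note u = fc_rel_unique[OF \<Psi> _ sa refl]
  have c: "continuous_on (cstar_spectrum a) (\<lambda>z. z)" "continuous_on (cstar_spectrum a) (\<lambda>z. 1)"
    by (auto intro: continuous_intros)
  have "poly [:0, 1:] = (\<lambda>z::complex. z)" "poly [:1:] = (\<lambda>z::complex. 1)" by auto
  with fc_rel_poly[of a "[:0, 1:]"] fc_rel_poly[of a "[:1:]"]
  have "fc_rel a (\<lambda>z. z) a" "fc_rel a (\<lambda>z. 1) 1" by auto
  moreover have "norm (\<Psi> f) = (SUP z\<in>cstar_spectrum a. cmod (f z))"
    if f: "continuous_on (cstar_spectrum a) f" for f
    using fc_rel_norm[OF \<Psi>[OF f] sa] spectrum_nonempty[OF sa]
    by (intro cSup_eq_non_empty[symmetric]) auto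
  ultimately show ?thesis
    unfolding is_functional_calculus_def
    using c by (auto intro!: u fc_rel_add fc_rel_mult fc_rel_scaleC fc_rel_star[OF _ sa] \<Psi> continuous_intros)
qed

text \<open>Uniqueness: a map with the defining properties sends \<open>poly p\<close> to
  \<open>peval p a\<close>, and its isometry clause forces its value at \<open>f\<close> to be the
  limit along any uniform polynomial approximation.\<close>

lemma functional_calculus_fc_rel:
  fixes a :: "'a::cstar_algebra"
  assumes sa: "star a = a" and \<Phi>: "is_functional_calculus a \<Phi>" and f: "continuous_on (cstar_spectrum a) f"
  shows "fc_rel a f (\<Phi> f)"
proof -
  note \<Phi>' = \<Phi>[unfolded is_functional_calculus_def]
  have add: "\<Phi> (\<lambda>z. g z + h z) = \<Phi> g + \<Phi> h" and mult: "\<Phi> (\<lambda>z. g z * h z) = \<Phi> g * \<Phi> h"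
    if "continuous_on (cstar_spectrum a) g" "continuous_on (cstar_spectrum a) h" for g h
    using \<Phi>' that by blast+
  have sc: "\<Phi> (\<lambda>z. c * g z) = scaleC c (\<Phi> g)" and nrm: "norm (\<Phi> g) = (SUP z\<in>cstar_spectrum a. cmod (g z))"
    if "continuous_on (cstar_spectrum a) g" for g c
    using \<Phi>' that by blast+
  have id: "\<Phi> (\<lambda>z. z) = a" and one: "\<Phi> (\<lambda>z. 1) = 1" using \<Phi>' by blast+
  have const: "\<Phi> (\<lambda>z. c) = scaleC c 1" for c
    using sc[of "\<lambda>z. 1" c] one by simp
  have poly: "\<Phi> (poly p) = peval p a" for p
  proof (induction p)
    case 0
    then show ?case using const[of 0] by (simp add: poly_fun_simps)
  next
    case (pCons c p)
    have "poly (pCons c p) = (\<lambda>z. c + z * poly p z)" by auto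
    moreover have "\<Phi> (\<lambda>z. c + z * poly p z) = \<Phi> (\<lambda>z. c) + \<Phi> (\<lambda>z. z) * \<Phi> (poly p)"
      by (subst add, (auto intro!: continuous_intros)[2], subst mult) (auto intro!: continuous_intros)
    ultimately show ?case by (simp add: const id pCons)
  qed
  obtain P where P: "uniform_limit (cstar_spectrum a) (\<lambda>n. poly (P n)) f sequentially"
    using uniform_poly_approx[OF compact_spectrum selfadjoint_spectrum_real[OF sa] f] by auto
  have "(\<lambda>n. peval (P n) a) \<longlonglongrightarrow> \<Phi> f"
  proof (rule metric_LIMSEQ_I)
    fix r :: real assume r: "r > 0"
    then obtain M where M: "\<And>n z. n \<ge> M \<Longrightarrow> z \<in> cstar_spectrum a \<Longrightarrow> dist (poly (P n) z) (f z) < r/2"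
      using uniform_limitD[OF P, of "r/2"] by (auto simp: eventually_sequentially)
    have "dist (peval (P n) a) (\<Phi> f) < r" if "n \<ge> M" for n
    proof -
      define g where "g z = poly (P n) z + (-1) * f z" for z
      have g: "continuous_on (cstar_spectrum a) g" unfolding g_def by (intro continuous_intros f)
      have "\<Phi> g = \<Phi> (poly (P n)) + scaleC (-1) (\<Phi> f)"
        unfolding g_def using f using sc[OF f, of "-1"] by (subst add) (auto intro!: continuous_intros)
      then have "dist (peval (P n) a) (\<Phi> f) = norm (\<Phi> g)"
        by (simp add: dist_norm poly scaleC_minus_left)
      also have "\<dots> \<le> r/2"
        unfolding nrm[OF g] using M[OF that] spectrum_nonempty[OF sa]
        by (intro cSUP_least) (auto simp: g_def dist_norm less_imp_le)
      finally show ?thesis using r by simp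
    qed
    then show "\<exists>no. \<forall>n\<ge>no. dist (peval (P n) a) (\<Phi> f) < r" by blast
  qed
  then show ?thesis using P by (auto simp: fc_rel_def)
qed

text \<open>Existence and uniqueness together resolve the definite description in
  \<open>cfc\<close>; from here on it is handled through \<open>fc_rel\<close> only.\<close>

lemma cfc_rel:
  fixes a :: "'a::cstar_algebra"
  assumes sa: "star a = a" and f: "continuous_on (cstar_spectrum a) f"
  shows "fc_rel a f (cfc f a)"
proof -
  define \<Psi> where "\<Psi> f = (SOME x. fc_rel a f x)" for f
  have \<Psi>: "fc_rel a f (\<Psi> f)" if "continuous_on (cstar_spectrum a) f" for f
    unfolding \<Psi>_def using fc_rel_ex[OF sa that] by (rule someI_ex)
  have "cfc f a = \<Psi> f"
    unfolding cfc_def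
  proof (rule the_equality)
    show "\<exists>\<Phi>. is_functional_calculus a \<Phi> \<and> \<Phi> f = \<Psi> f"
      using is_functional_calculusI[OF sa \<Psi>] by blast
    show "b = \<Psi> f" if "\<exists>\<Phi>. is_functional_calculus a \<Phi> \<and> \<Phi> f = b" for b
      using that functional_calculus_fc_rel[OF sa _ f] fc_rel_unique[OF _ \<Psi>[OF f] sa refl] by blast
  qed
  then show ?thesis using \<Psi>[OF f] by simp
qed

lemma cfc_eqI: "star a = a \<Longrightarrow> continuous_on (cstar_spectrum a) f \<Longrightarrow> fc_rel a f x \<Longrightarrow> cfc f a = x"
  using fc_rel_unique[OF cfc_rel] by blast

context
  fixes a :: "'a::cstar_algebra"
  assumes sa: "star a = a"
begin

lemma cfc_cong:
  assumes "continuous_on (cstar_spectrum a) f" "\<And>z. z \<in> cstar_spectrum a \<Longrightarrow> f z = g z"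
  shows "cfc f a = cfc g a"
proof -
  have "continuous_on (cstar_spectrum a) g" using assms continuous_on_cong by metis
  then show ?thesis using fc_rel_unique[OF cfc_rel[OF sa assms(1)] cfc_rel[OF sa]] sa assms(2) by blast
qed

lemma cfc_poly: "cfc (poly p) a = peval p a"
  by (intro cfc_eqI sa fc_rel_poly continuous_intros)

lemma cfc_id: "cfc (\<lambda>z. z) a = a"
  using cfc_poly[of "[:0,1:]"] by (simp add: fun_eq_iff[of "poly _"] cong: cfc_cong) 

lemma cfc_const: "cfc (\<lambda>z. c) a = scaleC c 1"
proof -
  have "poly [:c:] = (\<lambda>z. c)" by auto
  then show ?thesis using cfc_poly[of "[:c:]"] by simp
qed

lemma cfc_add:
  assumes "continuous_on (cstar_spectrum a) f" "continuous_on (cstar_spectrum a) g"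
  shows "cfc (\<lambda>z. f z + g z) a = cfc f a + cfc g a"
  using assms by (intro cfc_eqI fc_rel_add cfc_rel sa continuous_intros)

lemma cfc_mult:
  assumes "continuous_on (cstar_spectrum a) f" "continuous_on (cstar_spectrum a) g"
  shows "cfc (\<lambda>z. f z * g z) a = cfc f a * cfc g a"
  using assms by (intro cfc_eqI fc_rel_mult cfc_rel sa continuous_intros)

lemma cfc_scaleC:
  assumes "continuous_on (cstar_spectrum a) f"
  shows "cfc (\<lambda>z. c * f z) a = scaleC c (cfc f a)"
  using assms by (intro cfc_eqI fc_rel_scaleC cfc_rel sa continuous_intros)

lemma cfc_diff:
  assumes "continuous_on (cstar_spectrum a) f" "continuous_on (cstar_spectrum a) g"
  shows "cfc (\<lambda>z. f z - g z) a = cfc f a - cfc g a"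
  using cfc_add[OF assms(1), of "\<lambda>z. (-1) * g z"] cfc_scaleC[OF assms(2), of "-1"] assms(2)
  by (simp add: scaleC_minus_left continuous_on_minus)

lemma star_cfc:
  assumes "continuous_on (cstar_spectrum a) f"
  shows "star (cfc f a) = cfc (\<lambda>z. cnj (f z)) a"
  using assms by (intro cfc_eqI[symmetric] fc_rel_star cfc_rel sa continuous_intros)

lemma cfc_commute:
  assumes "continuous_on (cstar_spectrum a) f" "continuous_on (cstar_spectrum a) g"
  shows "cfc f a * cfc g a = cfc g a * cfc f a"
  using cfc_mult[OF assms] cfc_mult[OF assms(2,1)] by (simp add: mult.commute)

lemma cmod_le_norm_cfc:
  assumes "continuous_on (cstar_spectrum a) f" "z \<in> cstar_spectrum a"
  shows "cmod (f z) \<le> norm (cfc f a)"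
  using fc_rel_norm(1)[OF cfc_rel[OF sa assms(1)] sa assms(2)] .

lemma norm_cfc_le:
  assumes "continuous_on (cstar_spectrum a) f" "\<And>z. z \<in> cstar_spectrum a \<Longrightarrow> cmod (f z) \<le> B"
  shows "norm (cfc f a) \<le> B"
  using fc_rel_norm(2)[OF cfc_rel[OF sa assms(1)] sa assms(2)] .

text \<open>Off the image of \<open>f\<close> the function \<open>1 / (f z - w)\<close> is
  continuous on the spectrum and provides the inverse. Conversely, each
  \<open>peval (P n) a - poly (P n) z\<close> is singular, and the singular elements form a closed
  set.\<close>

lemma spectrum_cfc:
  assumes f: "continuous_on (cstar_spectrum a) f"
  shows "cstar_spectrum (cfc f a) = f ` cstar_spectrum a"
proof safe
  fix w assume w: "w \<in> cstar_spectrum (cfc f a)"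
  show "w \<in> f ` cstar_spectrum a"
  proof (rule ccontr)
    assume n: "w \<notin> f ` cstar_spectrum a"
    then have c: "continuous_on (cstar_spectrum a) (\<lambda>z. 1 / (f z - w))" "continuous_on (cstar_spectrum a) (\<lambda>z. f z - w)"
      by (auto intro!: continuous_intros f)
    have d: "cfc (\<lambda>z. f z - w) a = cfc f a - scaleC w 1"
      by (simp add: cfc_diff f continuous_intros cfc_const)
    have "cfc (\<lambda>z. 1) a = cfc (\<lambda>z. (f z - w) * (1 / (f z - w))) a"
      by (rule cfc_cong) (use n in \<open>auto intro!: continuous_intros\<close>)
    then have "cfc (\<lambda>z. f z - w) a * cfc (\<lambda>z. 1 / (f z - w)) a = 1"
      unfolding cfc_mult[OF c(2) c(1)] cfc_const by simp
    with cfc_commute[OF c] have "invertible_elem (cfc f a - scaleC w 1)"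
      by (intro invertible_elemI[of _ "cfc (\<lambda>z. 1 / (f z - w)) a"]) (auto simp: d)
    then show False using w by (simp add: cstar_spectrum_def)
  qed
next
  fix z assume z: "z \<in> cstar_spectrum a"
  obtain P where P: "uniform_limit (cstar_spectrum a) (\<lambda>n. poly (P n)) f sequentially"
    "(\<lambda>n. peval (P n) a) \<longlonglongrightarrow> cfc f a"
    using cfc_rel[OF sa f] by (auto simp: fc_rel_def)
  have "(\<lambda>n. peval (P n) a - scaleC (poly (P n) z) 1) \<longlonglongrightarrow> cfc f a - scaleC (f z) 1"
  proof (intro tendsto_diff P)
    have "isCont (\<lambda>w. scaleC w (1::'a)) (f z)"
      using continuous_scaleC_one[of UNIV, where 'a='a] by (simp add: continuous_on_eq_continuous_at)
    then show "(\<lambda>n. scaleC (poly (P n) z) (1::'a)) \<longlonglongrightarrow> scaleC (f z) 1"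
      using tendsto_uniform_limitI[OF P(1) z] by (rule isCont_tendsto_compose)
  qed
  then have lim: "(\<lambda>n. peval (P n) a - scaleC (poly (P n) z) 1) \<longlonglongrightarrow> cfc f a - scaleC (f z) 1" .
  have cl: "closed (- {a::'a. invertible_elem a})" using open_invertible by auto
  have "poly (P n) z \<in> cstar_spectrum (peval (P n) a)" for n
    using imageI[OF z, of "poly (P n)"] unfolding spectrum_peval[OF spectrum_nonempty[OF sa]] .
  then have "peval (P n) a - scaleC (poly (P n) z) 1 \<in> - {a. invertible_elem a}" for n
    unfolding cstar_spectrum_def by simp
  then have "cfc f a - scaleC (f z) 1 \<in> - {a. invertible_elem a}"
    by (rule closed_sequentially[OF cl _ lim])
  then show "f z \<in> cstar_spectrum (cfc f a)" by (simp add: cstar_spectrum_def)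
qed

text \<open>The map \<open>h \<mapsto> cfc (\<lambda>z. h (f z)) a\<close> satisfies all the clauses
  of a functional calculus at \<open>cfc f a\<close>, so uniqueness identifies it with
  \<open>cfc h (cfc f a)\<close>.\<close>

lemma cfc_compose:
  assumes f: "continuous_on (cstar_spectrum a) f" and real: "\<And>z. z \<in> cstar_spectrum a \<Longrightarrow> Im (f z) = 0"
    and g: "continuous_on (f ` cstar_spectrum a) g"
  shows "star (cfc f a) = cfc f a" "cfc g (cfc f a) = cfc (\<lambda>z. g (f z)) a"
proof -
  show sa': "star (cfc f a) = cfc f a"
    unfolding star_cfc[OF f]
    by (rule cfc_cong[symmetric]) (use f real in \<open>auto simp: complex_eq_iff\<close>)
  have c: "continuous_on (cstar_spectrum a) (\<lambda>z. h (f z))" if "continuous_on (f ` cstar_spectrum a) h" for h :: "complex \<Rightarrow> complex"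
    using continuous_on_compose[OF f that] by (simp add: o_def)
  have "is_functional_calculus (cfc f a) (\<lambda>h. cfc (\<lambda>z. h (f z)) a)"
    unfolding is_functional_calculus_def spectrum_cfc[OF f]
  proof (intro conjI allI impI)
    fix h k :: "complex \<Rightarrow> complex" and c assume h: "continuous_on (f ` cstar_spectrum a) h"
    show "norm (cfc (\<lambda>z. h (f z)) a) = (SUP z\<in>f ` cstar_spectrum a. cmod (h z))"
      using cmod_le_norm_cfc[OF c[OF h]] norm_cfc_le[OF c[OF h]] spectrum_nonempty[OF sa]
      by (intro cSup_eq_non_empty[symmetric]) auto
    show "cfc (\<lambda>z. cnj (h (f z))) a = star (cfc (\<lambda>z. h (f z)) a)" using star_cfc[OF c[OF h]] by simp
    show "cfc (\<lambda>z. c * h (f z)) a = scaleC c (cfc (\<lambda>z. h (f z)) a)" using cfc_scaleC[OF c[OF h]] by simp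
    assume k: "continuous_on (f ` cstar_spectrum a) k"
    show "cfc (\<lambda>z. h (f z) + k (f z)) a = cfc (\<lambda>z. h (f z)) a + cfc (\<lambda>z. k (f z)) a"
      by (intro cfc_add c h k)
    show "cfc (\<lambda>z. h (f z) * k (f z)) a = cfc (\<lambda>z. h (f z)) a * cfc (\<lambda>z. k (f z)) a"
      by (intro cfc_mult c h k)
  qed (auto simp: cfc_const)
  from functional_calculus_fc_rel[OF sa' this] show "cfc g (cfc f a) = cfc (\<lambda>z. g (f z)) a"
    using g sa' by (intro cfc_eqI) (auto simp: spectrum_cfc[OF f])
qed

end

subsection \<open>Real functions of a self-adjoint element\<close>

definition rspec :: "'a::cstar_algebra \<Rightarrow> real set" where
  "rspec a = Re ` cstar_spectrum a"

text \<open>On self-adjoint elements the spectrum is real, so nothing is lost under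
  \<open>Re\<close>, and inequalities between functions become available.\<close>

definition rcfc :: "(real \<Rightarrow> real) \<Rightarrow> 'a::cstar_algebra \<Rightarrow> 'a" where
  "rcfc f a = cfc (\<lambda>z. complex_of_real (f (Re z))) a"

lemma compact_rspec: "compact (rspec a)"
  unfolding rspec_def by (intro compact_continuous_image compact_spectrum continuous_intros)

lemma abs_le_norm_rspec: "x \<in> rspec a \<Longrightarrow> \<bar>x\<bar> \<le> norm a"
  unfolding rspec_def using norm_spectrum_le abs_Re_le_cmod order_trans by blast

lemma continuous_on_rspecI:
  "continuous_on (rspec a) f \<Longrightarrow> continuous_on (cstar_spectrum a) (\<lambda>z. complex_of_real (f (Re z)))"
  unfolding rspec_def
  by (rule continuous_on_of_real, rule continuous_on_compose2, assumption)
    (auto intro!: continuous_intros)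

context
  fixes a :: "'a::cstar_algebra"
  assumes sa: "star a = a"
begin

lemma rspec_nonempty: "rspec a \<noteq> {}"
  using spectrum_nonempty[OF sa] by (simp add: rspec_def)

lemma of_real_rspec: "cstar_spectrum a = complex_of_real ` rspec a"
proof -
  have "complex_of_real (Re z) = z" if "z \<in> cstar_spectrum a" for z
    using selfadjoint_spectrum_real[OF sa that] by (simp add: complex_eq_iff)
  then show ?thesis by (force simp: rspec_def)
qed

lemma rspec_iff: "x \<in> rspec a \<longleftrightarrow> \<not> invertible_elem (a - of_real x)"
proof -
  have "x \<in> rspec a \<longleftrightarrow> complex_of_real x \<in> cstar_spectrum a" by (auto simp: of_real_rspec)
  then show ?thesis by (simp add: cstar_spectrum_def scaleC_of_real_one)
qed

lemma star_rcfc: "continuous_on (rspec a) f \<Longrightarrow> star (rcfc f a) = rcfc f a"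
  unfolding rcfc_def using star_cfc[OF sa continuous_on_rspecI] by simp

lemma rspec_rcfc: "continuous_on (rspec a) f \<Longrightarrow> rspec (rcfc f a) = f ` rspec a"
  unfolding rspec_def rcfc_def by (subst spectrum_cfc[OF sa continuous_on_rspecI]) (auto simp: rspec_def image_image)

lemma rcfc_rcfc:
  assumes "continuous_on (rspec a) f" "continuous_on (f ` rspec a) g"
  shows "rcfc g (rcfc f a) = rcfc (\<lambda>x. g (f x)) a"
proof -
  have "continuous_on ((\<lambda>z. complex_of_real (f (Re z))) ` cstar_spectrum a) (\<lambda>z. complex_of_real (g (Re z)))"
    by (intro continuous_on_of_real continuous_on_compose2[OF assms(2)]) (auto simp: rspec_def intro!: continuous_intros)
  from cfc_compose(2)[OF sa continuous_on_rspecI[OF assms(1)] _ this] show ?thesis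
    by (simp add: rcfc_def)
qed

lemma rcfc_cong:
  assumes "continuous_on (rspec a) f" "\<And>x. x \<in> rspec a \<Longrightarrow> f x = g x"
  shows "rcfc f a = rcfc g a"
  unfolding rcfc_def by (rule cfc_cong[OF sa continuous_on_rspecI[OF assms(1)]]) (auto simp: assms rspec_def)

lemma rcfc_id: "rcfc (\<lambda>x. x) a = a"
proof -
  have "cfc (\<lambda>z. z) a = rcfc (\<lambda>x. x) a" unfolding rcfc_def
    by (rule cfc_cong[OF sa]) (auto intro: continuous_intros simp: of_real_rspec)
  then show ?thesis using cfc_id[OF sa] by simp
qed

lemma rcfc_const: "rcfc (\<lambda>x. c) a = of_real c"
  unfolding rcfc_def by (simp add: cfc_const[OF sa] scaleC_of_real_one)

lemma rcfc_add:
  assumes "continuous_on (rspec a) f" "continuous_on (rspec a) g"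
  shows "rcfc (\<lambda>x. f x + g x) a = rcfc f a + rcfc g a"
  unfolding rcfc_def using cfc_add[OF sa continuous_on_rspecI[OF assms(1)] continuous_on_rspecI[OF assms(2)]] by simp

lemma rcfc_diff:
  assumes "continuous_on (rspec a) f" "continuous_on (rspec a) g"
  shows "rcfc (\<lambda>x. f x - g x) a = rcfc f a - rcfc g a"
  unfolding rcfc_def using cfc_diff[OF sa continuous_on_rspecI[OF assms(1)] continuous_on_rspecI[OF assms(2)]] by simp

lemma rcfc_mult:
  assumes "continuous_on (rspec a) f" "continuous_on (rspec a) g"
  shows "rcfc (\<lambda>x. f x * g x) a = rcfc f a * rcfc g a"
  unfolding rcfc_def using cfc_mult[OF sa continuous_on_rspecI[OF assms(1)] continuous_on_rspecI[OF assms(2)]] by simp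

lemma rcfc_cmult:
  assumes "continuous_on (rspec a) f"
  shows "rcfc (\<lambda>x. c * f x) a = c *\<^sub>R rcfc f a"
  unfolding rcfc_def using cfc_scaleC[OF sa continuous_on_rspecI[OF assms], of "of_real c"]
  by (simp add: scaleC_of_real)

lemma rcfc_sum:
  assumes "finite I" "\<And>i. i \<in> I \<Longrightarrow> continuous_on (rspec a) (f i)"
  shows "rcfc (\<lambda>x. \<Sum>i\<in>I. f i x) a = (\<Sum>i\<in>I. rcfc (f i) a)"
  using assms by (induction I rule: finite_induct) (auto simp: rcfc_const rcfc_add continuous_on_sum)

lemma norm_rcfc_le:
  assumes "continuous_on (rspec a) f" "\<And>x. x \<in> rspec a \<Longrightarrow> \<bar>f x\<bar> \<le> B"
  shows "norm (rcfc f a) \<le> B"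
  unfolding rcfc_def by (rule norm_cfc_le[OF sa continuous_on_rspecI[OF assms(1)]]) (auto simp: rspec_def assms(2))

lemma abs_le_norm_rcfc:
  assumes "continuous_on (rspec a) f" "x \<in> rspec a"
  shows "\<bar>f x\<bar> \<le> norm (rcfc f a)"
proof -
  obtain z where "z \<in> cstar_spectrum a" "x = Re z" using assms(2) by (auto simp: rspec_def)
  then show ?thesis using cmod_le_norm_cfc[OF sa continuous_on_rspecI[OF assms(1)]] by (fastforce simp: rcfc_def)
qed

lemma rspec_diff_of_real: "rspec (a - of_real t) = (\<lambda>x. x - t) ` rspec a"
  using rspec_rcfc[of "\<lambda>x. x - t"] rcfc_diff[of "\<lambda>x. x" "\<lambda>x. t"] by (simp add: rcfc_id rcfc_const continuous_intros)

lemma square_rcfc: "a * a = rcfc (\<lambda>x. x * x) a"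
  by (simp add: rcfc_mult rcfc_id)

end

subsection \<open>The positive cone\<close>

lemma pos_cone_iff: "a \<in> pos_cone \<longleftrightarrow> star a = a \<and> (\<forall>x\<in>rspec a. 0 \<le> x)"
proof (cases "star a = a")
  case True
  then show ?thesis by (auto simp: pos_cone_def of_real_rspec[OF True])
qed (auto simp: pos_cone_def)

lemma posdef_cone_iff: "a \<in> posdef_cone \<longleftrightarrow> star a = a \<and> (\<forall>x\<in>rspec a. 0 < x)"
proof (cases "star a = a")
  case True
  have "invertible_elem a \<longleftrightarrow> 0 \<notin> rspec a" using rspec_iff[OF True, of 0] by simp
  then show ?thesis unfolding posdef_cone_def by (auto simp: pos_cone_iff order.order_iff_strict)
qed (auto simp: posdef_cone_def pos_cone_iff)

lemma posdef_cone_pos: "a \<in> posdef_cone \<Longrightarrow> a \<in> pos_cone"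
  by (simp add: posdef_cone_def)

lemma pos_cone_sa: "a \<in> pos_cone \<Longrightarrow> star a = a"
  by (simp add: pos_cone_def)

lemma posdef_cone_sa: "a \<in> posdef_cone \<Longrightarrow> star a = a"
  by (simp add: posdef_cone_def pos_cone_def)

lemma posdef_cone_invertible: "a \<in> posdef_cone \<Longrightarrow> invertible_elem a"
  by (simp add: posdef_cone_def)

text \<open>A real number \<open>x\<close> with \<open>\<bar>x\<bar> \<le> t\<close> is nonnegative
  iff \<open>\<bar>t - x\<bar> \<le> t\<close>. Expressed by norms, positivity is stable under sums
  by the triangle inequality and is visibly a closed condition.\<close>

lemma pos_cone_norm_iff:
  assumes "star a = a" "norm a \<le> t"
  shows "a \<in> pos_cone \<longleftrightarrow> norm (of_real t - a) \<le> t"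
proof -
  have e: "of_real t - a = rcfc (\<lambda>x. t - x) a"
    using assms(1) by (simp add: rcfc_diff rcfc_id rcfc_const continuous_intros)
  have c: "continuous_on (rspec a) (\<lambda>x. t - x)" by (intro continuous_intros)
  have le: "\<bar>x\<bar> \<le> t" if "x \<in> rspec a" for x using abs_le_norm_rspec[OF that] assms(2) by simp
  show ?thesis
  proof
    assume "a \<in> pos_cone"
    then show "norm (of_real t - a) \<le> t"
      unfolding e by (intro norm_rcfc_le assms c) (use le in \<open>fastforce simp: pos_cone_iff\<close>)
  next
    assume n: "norm (of_real t - a) \<le> t"
    have "0 \<le> x" if "x \<in> rspec a" for x
      using abs_le_norm_rcfc[OF assms(1) c that] n unfolding e by linarith
    then show "a \<in> pos_cone" using assms(1) by (simp add: pos_cone_iff)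
  qed
qed

lemma pos_cone_add:
  assumes "a \<in> pos_cone" "b \<in> pos_cone"
  shows "a + b \<in> pos_cone"
proof -
  have sa: "star a = a" "star b = b" using assms by (auto simp: pos_cone_def)
  have "norm (of_real (norm a) - a) \<le> norm a" "norm (of_real (norm b) - b) \<le> norm b"
    using assms sa pos_cone_norm_iff by blast+
  then have "norm (of_real (norm a + norm b) - (a + b)) \<le> norm a + norm b"
    using norm_triangle_ineq[of "of_real (norm a) - a" "of_real (norm b) - b"] by (simp add: algebra_simps)
  then show ?thesis
    using sa norm_triangle_ineq[of a b] pos_cone_norm_iff[of "a + b" "norm a + norm b"]
    by (simp add: star_add)
qed

lemma pos_cone_zero: "0 \<in> pos_cone"
  using pos_cone_norm_iff[of 0 0] by simp

lemma pos_cone_sum: "(\<And>i. i \<in> I \<Longrightarrow> f i \<in> pos_cone) \<Longrightarrow> sum f I \<in> pos_cone"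
  by (induction I rule: infinite_finite_induct) (auto simp: pos_cone_add pos_cone_zero)

lemma rcfc_pos:
  assumes "star a = a" "continuous_on (rspec a) f" "\<And>x. x \<in> rspec a \<Longrightarrow> 0 \<le> f x"
  shows "rcfc f a \<in> pos_cone"
  using assms by (auto simp: pos_cone_iff star_rcfc rspec_rcfc)

lemma rcfc_posdef:
  assumes "star a = a" "continuous_on (rspec a) f" "\<And>x. x \<in> rspec a \<Longrightarrow> 0 < f x"
  shows "rcfc f a \<in> posdef_cone"
  using assms by (auto simp: posdef_cone_iff star_rcfc rspec_rcfc)

lemma scaleR_rcfc: "star a = a \<Longrightarrow> t *\<^sub>R a = rcfc (\<lambda>x. t * x) a"
  by (simp add: rcfc_cmult rcfc_id)

lemma pos_cone_scaleR: "a \<in> pos_cone \<Longrightarrow> 0 \<le> t \<Longrightarrow> t *\<^sub>R a \<in> pos_cone"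
  by (simp add: scaleR_rcfc pos_cone_sa) (rule rcfc_pos, auto simp: pos_cone_iff intro!: continuous_intros)

lemma posdef_cone_scaleR: "a \<in> posdef_cone \<Longrightarrow> 0 < t \<Longrightarrow> t *\<^sub>R a \<in> posdef_cone"
  by (simp add: scaleR_rcfc posdef_cone_sa) (rule rcfc_posdef, auto simp: posdef_cone_iff intro!: continuous_intros)

lemma pos_cone_antisym:
  assumes "a \<in> pos_cone" "- a \<in> pos_cone"
  shows "a = 0"
proof -
  have sa: "star a = a" using assms(1) by (simp add: pos_cone_def)
  have "rspec (- a) = (\<lambda>x. -1 * x) ` rspec a"
    using rspec_rcfc[OF sa, of "\<lambda>x. -1 * x"] scaleR_rcfc[OF sa, of "-1"] by (simp add: continuous_intros)
  then have "x = 0" if "x \<in> rspec a" for x using assms that by (force simp: pos_cone_iff)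
  then have "norm (rcfc (\<lambda>x. x) a) \<le> 0" by (intro norm_rcfc_le sa continuous_intros) auto
  then show ?thesis by (simp add: rcfc_id[OF sa])
qed

lemma closed_pos_cone: "closed (pos_cone :: 'a::cstar_algebra set)"
proof -
  have "a \<in> pos_cone \<longleftrightarrow> star a = a \<and> norm (of_real (norm a) - a) \<le> norm a" for a :: 'a
    using pos_cone_norm_iff[of a "norm a"] pos_cone_sa[of a] by auto
  then have eq: "(pos_cone :: 'a set) = {a. star a = a} \<inter> {a. norm (of_real (norm a) - a) \<le> norm a}"
    by auto
  show ?thesis
    unfolding eq
    by (intro closed_Int closed_Collect_eq closed_Collect_le continuous_intros
        linear_continuous_on[OF bounded_linear_star])
qed

text \<open>The compact spectrum attains its infimum, which is then the gap \<open>d\<close>. Adding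
  a positive element keeps such a gap.\<close>

lemma posdef_cone_iff_pos:
  "a \<in> posdef_cone \<longleftrightarrow> (\<exists>d>0. a - of_real d \<in> pos_cone)"
proof (cases "star a = a")
  case sa: True
  show ?thesis
  proof
    assume "a \<in> posdef_cone"
    then obtain d where "d \<in> rspec a" "\<And>x. x \<in> rspec a \<Longrightarrow> d \<le> x" "d > 0"
      using compact_attains_inf[OF compact_rspec rspec_nonempty[OF sa]] by (auto simp: posdef_cone_iff)
    then show "\<exists>d>0. a - of_real d \<in> pos_cone"
      by (intro exI[of _ d]) (auto simp: pos_cone_iff star_diff sa rspec_diff_of_real)
  qed (use sa in \<open>force simp: pos_cone_iff posdef_cone_iff star_diff rspec_diff_of_real\<close>)
next
  case False
  then have "a \<notin> posdef_cone" using posdef_cone_sa by blast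
  moreover have "star a = a" if "star (a - of_real d) = a - of_real d" for d
    using that by (simp add: star_diff)
  ultimately show ?thesis using False pos_cone_sa by blast
qed

lemma posdef_cone_add_pos:
  assumes "a \<in> posdef_cone" "b \<in> pos_cone"
  shows "a + b \<in> posdef_cone"
proof -
  obtain d where "d > 0" "a - of_real d \<in> pos_cone" using assms(1) posdef_cone_iff_pos by blast
  then have "d > 0 \<and> a + b - of_real d \<in> pos_cone"
    using pos_cone_add[OF _ assms(2), of "a - of_real d"] by (simp add: algebra_simps)
  then show ?thesis using posdef_cone_iff_pos by blast
qed

lemma posdef_cone_add: "a \<in> posdef_cone \<Longrightarrow> b \<in> posdef_cone \<Longrightarrow> a + b \<in> posdef_cone"
  by (intro posdef_cone_add_pos posdef_cone_pos)

lemma posdef_cone_of_real: "0 < t \<Longrightarrow> of_real t \<in> (posdef_cone :: 'a::cstar_algebra set)"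
  unfolding posdef_cone_iff_pos using pos_cone_zero by (intro exI[of _ t]) auto

lemma posdef_cone_one: "1 \<in> (posdef_cone :: 'a::cstar_algebra set)"
  using posdef_cone_of_real[of 1] by simp

lemma posdef_cone_shift:
  assumes "star a = a" "norm a < t"
  shows "of_real t + a \<in> posdef_cone"
proof -
  have "of_real t + a = rcfc (\<lambda>x. t + x) a"
    using assms(1) by (simp add: rcfc_add rcfc_id rcfc_const continuous_intros)
  moreover have "rcfc (\<lambda>x. t + x) a \<in> posdef_cone"
    by (intro rcfc_posdef assms continuous_intros) (use abs_le_norm_rspec[of _ a] assms(2) in fastforce)
  ultimately show ?thesis by simp
qed

lemma posdef_cone_near_one:
  assumes "star a = a" "norm (a - 1) < 1"
  shows "a \<in> posdef_cone"
  using posdef_cone_shift[of "a - 1" 1] assms by (simp add: star_diff)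

lemma selfadjoint_square_pos: "star h = h \<Longrightarrow> h * h \<in> pos_cone"
  by (simp add: square_rcfc) (rule rcfc_pos, auto intro!: continuous_intros)

subsection \<open>Powers\<close>

lemma cpower_rcfc: "cpower a r = rcfc (\<lambda>x. x powr r) a"
  by (simp add: cpower_def rcfc_def)

context
  fixes a :: "'a::cstar_algebra"
  assumes a: "a \<in> posdef_cone"
begin

lemma continuous_on_powr_rspec: "continuous_on (rspec a) (\<lambda>x. x powr r)"
  using a by (intro continuous_intros) (auto simp: posdef_cone_iff)

lemma cpower_posdef: "cpower a r \<in> posdef_cone"
  unfolding cpower_rcfc using a
  by (intro rcfc_posdef continuous_on_powr_rspec posdef_cone_sa) (auto simp: posdef_cone_iff)

lemma cpower_add: "cpower a r * cpower a s = cpower a (r + s)"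
  unfolding cpower_rcfc
  by (simp add: rcfc_mult[symmetric] posdef_cone_sa a continuous_on_powr_rspec powr_add)

lemma cpower_0: "cpower a 0 = 1"
proof -
  have "rcfc (\<lambda>x. x powr 0) a = rcfc (\<lambda>x. 1) a"
    using a by (intro rcfc_cong continuous_on_powr_rspec) (auto simp: posdef_cone_iff)
  then show ?thesis using a by (simp add: cpower_rcfc rcfc_const posdef_cone_sa)
qed

lemma cpower_1: "cpower a 1 = a"
proof -
  have "rcfc (\<lambda>x. x powr 1) a = rcfc (\<lambda>x. x) a"
    using a by (intro rcfc_cong continuous_on_powr_rspec) (auto simp: posdef_cone_iff)
  then show ?thesis using a by (simp add: cpower_rcfc rcfc_id posdef_cone_sa)
qed

lemma cpower_cpower: "cpower (cpower a r) s = cpower a (r * s)"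
proof -
  have "rcfc (\<lambda>x. x powr s) (rcfc (\<lambda>x. x powr r) a) = rcfc (\<lambda>x. (x powr r) powr s) a"
    using a by (intro rcfc_rcfc continuous_on_powr_rspec posdef_cone_sa) (auto simp: posdef_cone_iff intro!: continuous_intros)
  then show ?thesis by (simp add: cpower_rcfc powr_powr)
qed

lemma cpower_minus: "cpower a r * cpower a (- r) = 1" "cpower a (- r) * cpower a r = 1"
  by (simp_all add: cpower_add cpower_0)

lemma cpower_half: "cpower a (1/2) * cpower a (1/2) = a"
  by (simp add: cpower_add cpower_1)

end

lemma bij_betw_cpower:
  assumes "r \<noteq> 0"
  shows "bij_betw (\<lambda>a. cpower a r) posdef_cone (posdef_cone :: 'a::cstar_algebra set)"
proof (rule bij_betw_byWitness[where f'="\<lambda>a. cpower a (1/r)"])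
qed (use assms in \<open>auto simp: cpower_cpower cpower_1 cpower_posdef\<close>)

subsection \<open>Congruence preserves positivity\<close>

text \<open>
  With \<open>W = (T T\<^sup>*)\<^sup>-\<^sup>1\<close> one has \<open>T\<^sup>* q T - x = T\<^sup>* (q - x W) T\<close>, which is invertible for \<open>x < 0\<close>. The
  positivity of arbitrary \<open>c\<^sup>* c\<close> is thus never needed.
\<close>

lemma congruence_pos:
  fixes T S q :: "'a::cstar_algebra"
  assumes q: "q \<in> pos_cone" and TT: "T * star T \<in> posdef_cone" and S: "T * S = 1" "S * T = 1"
  shows "star T * q * T \<in> pos_cone"
proof -
  define W where "W = star S * S"
  have sTS: "star T * star S = 1" "star S * star T = 1" using S by (metis star_mult star_one)+
  have "W * (T * star T) = 1"
    unfolding W_def using S sTS by (metis mult.assoc mult.right_neutral)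
  then have "W = cpower (T * star T) (-1)"
    using cpower_minus(1)[OF TT, of 1] cpower_1[OF TT] by (metis mult.assoc mult.left_neutral mult.right_neutral)
  then have W: "W \<in> posdef_cone" using cpower_posdef[OF TT] by simp
  have WT: "star T * W * T = 1" unfolding W_def using S sTS by (metis mult.assoc mult.right_neutral)
  have sa: "star (star T * q * T) = star T * q * T"
    using q by (simp add: star_mult star_star pos_cone_sa mult.assoc)
  have "0 \<le> x" if x: "x \<in> rspec (star T * q * T)" for x
  proof (rule ccontr)
    assume "\<not> 0 \<le> x"
    then have "(-x) *\<^sub>R W + q \<in> posdef_cone" using W q by (intro posdef_cone_add_pos posdef_cone_scaleR) auto
    then have "invertible_elem ((-x) *\<^sub>R W + q)" by (rule posdef_cone_invertible)
    moreover have "invertible_elem T" "invertible_elem (star T)" using S sTS by (auto intro: invertible_elemI)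
    ultimately have "invertible_elem (star T * ((-x) *\<^sub>R W + q) * T)" by (intro invertible_mult)
    moreover have "star T * ((-x) *\<^sub>R W + q) * T = star T * q * T - of_real x"
      using WT by (simp add: algebra_simps of_real_def)
    ultimately show False using x rspec_iff[OF sa] by simp
  qed
  then show ?thesis using sa by (simp add: pos_cone_iff)
qed

lemma congruence_posdef:
  fixes q T :: "'a::cstar_algebra"
  assumes q: "q \<in> posdef_cone" and T: "T \<in> posdef_cone"
  shows "T * q * T \<in> posdef_cone"
proof -
  note S = cpower_minus[OF T, of 1, unfolded cpower_1[OF T]]
  have "T * T = cpower T 2" using cpower_add[OF T, of 1 1] cpower_1[OF T] by simp
  then have "star T * q * T \<in> pos_cone"
    using T q cpower_posdef[OF T, of 2] by (intro congruence_pos[OF _ _ S] posdef_cone_pos) (auto simp: posdef_cone_sa)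
  moreover have "invertible_elem (T * q * T)"
    using T q by (intro invertible_mult posdef_cone_invertible)
  ultimately show ?thesis using T by (simp add: posdef_cone_def pos_cone_def)
qed

text \<open>A singular \<open>m\<close> is perturbed to \<open>m + \<i> * d\<close> with real
  \<open>d > 0\<close>: this is invertible because the spectrum of \<open>m\<close> is real, and its
  product with its adjoint is \<open>m * m + d * d\<close>, which is positive definite. Then
  \<open>d\<close> tends to 0 in the closed cone.\<close>

lemma congruence_selfadjoint_pos:
  fixes q m :: "'a::cstar_algebra"
  assumes q: "q \<in> pos_cone" and m: "star m = m"
  shows "m * q * m \<in> pos_cone"
proof -
  define T where "T n = m + scaleC (\<i> * inverse (real (Suc n))) 1" for n
  have sT: "star (T n) = m - scaleC (\<i> * inverse (real (Suc n))) 1" for n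
    by (simp add: T_def star_add star_scaleC m scaleC_minus_left)
  have pos: "star (T n) * q * T n \<in> pos_cone" for n
  proof -
    define d where "d = inverse (real (Suc n))"
    have d: "d > 0" by (simp add: d_def)
    have "T n = m - scaleC (- (\<i> * d)) 1" by (simp add: T_def d_def scaleC_minus_left)
    moreover have "- (\<i> * d) \<notin> cstar_spectrum m"
      using selfadjoint_spectrum_real[OF m, of "- (\<i> * d)"] d by auto
    ultimately have inv: "invertible_elem (T n)" by (simp add: cstar_spectrum_def)
    have "T n * star (T n) = m * m + of_real (d * d)"
      unfolding sT unfolding T_def d_def[symmetric]
      by (simp add: algebra_simps mult_scaleC_left mult_scaleC_right scaleC_scaleC scaleC_minus_left
          scaleC_add_right flip: scaleC_of_real_one)
    then have "T n * star (T n) \<in> posdef_cone"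
      using posdef_cone_add_pos[OF posdef_cone_of_real[of "d * d"] selfadjoint_square_pos[OF m]] d
      by (simp add: add.commute)
    then show ?thesis using congruence_pos[OF q _ ainv[OF inv]] by simp
  qed
  have lim: "(\<lambda>n. scaleC (\<i> * inverse (real (Suc n))) (1::'a)) \<longlonglongrightarrow> 0"
  proof (rule tendsto_norm_zero_cancel)
    have "norm (scaleC (\<i> * inverse (real (Suc n))) (1::'a)) = inverse (real (Suc n))" for n
      by (simp add: norm_mult norm_inverse del: of_nat_Suc)
    then show "(\<lambda>n. norm (scaleC (\<i> * inverse (real (Suc n))) (1::'a))) \<longlonglongrightarrow> 0"
      using LIMSEQ_inverse_real_of_nat by presburger
  qed
  have "T \<longlonglongrightarrow> m + 0"
    unfolding T_def by (rule tendsto_add[OF tendsto_const lim])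
  moreover have "(\<lambda>n. star (T n)) \<longlonglongrightarrow> m - 0"
    unfolding sT by (rule tendsto_diff[OF tendsto_const lim])
  ultimately have "(\<lambda>n. star (T n) * q * T n) \<longlonglongrightarrow> (m - 0) * q * (m + 0)"
    by (intro tendsto_mult tendsto_const)
  from closed_sequentially[OF closed_pos_cone pos this] show ?thesis by simp
qed

subsection \<open>Exponentials and powers of commuting elements\<close>

text \<open>The partial sums of the exponential series are polynomials converging uniformly on the
  disc of radius \<open>norm h\<close>, which contains the spectrum. This links the power series,
  which knows about sums of commuting elements, to the functional calculus, which knows about
  powers.\<close>

lemma exp_rcfc:
  fixes h :: "'a::cstar_algebra"
  assumes sa: "star h = h"
  shows "exp h = rcfc exp h"
proof -
  define P :: "nat \<Rightarrow> complex poly" where "P n = (\<Sum>k<n. monom (inverse (fact k)) k)" for n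
  have mon: "peval (monom c k) h = scaleC c (h ^ k)" for c k
    by (induction k) (auto simp: monom_0 monom_Suc mult_scaleC_right)
  have "peval (P n) h = (\<Sum>k<n. inverse (fact k) *\<^sub>R h ^ k)" for n
    unfolding P_def
    by (induction n) (auto simp: peval_add mon simp flip: scaleC_of_real)
  then have 1: "(\<lambda>n. peval (P n) h) \<longlonglongrightarrow> exp h"
    using exp_converges[of h] by (simp add: sums_def)
  have lim: "uniform_limit (cball 0 (norm h)) (\<lambda>n x. \<Sum>i<n. inverse (fact i) * (x - 0) ^ i)
    (\<lambda>x::complex. \<Sum>i. inverse (fact i) * (x - 0) ^ i) sequentially"
    
  proof (rule powser_uniform_limit)
    have "conv_radius (\<lambda>i. inverse (fact i) :: complex) = \<infinity>"
      by (rule conv_radius_inftyI'') (rule summable_exp)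
    then show "ereal (norm h) < conv_radius (\<lambda>i. inverse (fact i) :: complex)" by simp
  qed
  then have "uniform_limit (cball 0 (norm h)) (\<lambda>n. poly (P n)) exp sequentially"
  proof -
    have "poly (P n) = (\<lambda>x. \<Sum>i<n. inverse (fact i) * (x - 0) ^ i)" for n
      by (simp add: P_def poly_sum poly_monom fun_eq_iff)
    moreover have "exp = (\<lambda>x::complex. \<Sum>i. inverse (fact i) * (x - 0) ^ i)"
      by (simp add: exp_def scaleR_conv_of_real fun_eq_iff)
    ultimately show ?thesis using lim by simp
  qed
  then have "uniform_limit (cstar_spectrum h) (\<lambda>n. poly (P n)) exp sequentially"
    by (rule uniform_limit_on_subset) (auto simp: norm_spectrum_le)
  with 1 have "fc_rel h exp (exp h)" by (auto simp: fc_rel_def)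
  then have "cfc exp h = exp h" by (intro cfc_eqI sa continuous_intros)
  moreover have "cfc exp h = rcfc exp h" unfolding rcfc_def
    by (rule cfc_cong[OF sa]) (auto intro!: continuous_intros simp: of_real_rspec[OF sa] exp_of_real)
  ultimately show ?thesis by simp
qed

lemma cpower_exp:
  fixes h :: "'a::cstar_algebra"
  assumes sa: "star h = h"
  shows "exp h \<in> posdef_cone" "cpower (exp h) r = exp (r *\<^sub>R h)"
proof -
  show "exp h \<in> posdef_cone"
    unfolding exp_rcfc[OF sa] by (intro rcfc_posdef sa continuous_intros) auto
  have "cpower (exp h) r = rcfc (\<lambda>x. exp x powr r) h"
    unfolding exp_rcfc[OF sa] cpower_rcfc by (intro rcfc_rcfc sa continuous_intros) auto
  also have "\<dots> = rcfc (\<lambda>x. exp (r * x)) h" by (simp add: powr_def)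
  also have "\<dots> = rcfc exp (rcfc (\<lambda>x. r * x) h)"
    by (intro rcfc_rcfc[symmetric] sa continuous_intros)
  also have "\<dots> = exp (r *\<^sub>R h)"
    using exp_rcfc[of "r *\<^sub>R h"] sa by (simp add: star_scaleR scaleR_rcfc[OF sa, symmetric])
  finally show "cpower (exp h) r = exp (r *\<^sub>R h)" .
qed

lemma posdef_cone_exp:
  fixes a :: "'a::cstar_algebra"
  assumes "a \<in> posdef_cone"
  shows "\<exists>h. star h = h \<and> a = exp h"
proof (intro exI conjI)
  have sa: "star a = a" and c: "continuous_on (rspec a) ln"
    using assms by (auto simp: posdef_cone_iff intro!: continuous_intros)
  show s: "star (rcfc ln a) = rcfc ln a" using star_rcfc[OF sa c] .
  have "exp (rcfc ln a) = rcfc (\<lambda>x. exp (ln x)) a"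
    unfolding exp_rcfc[OF s] by (intro rcfc_rcfc sa c continuous_intros)
  also have "\<dots> = rcfc (\<lambda>x. x) a"
    using assms by (intro rcfc_cong sa continuous_intros c) (auto simp: posdef_cone_iff)
  finally show "a = exp (rcfc ln a)" by (simp add: rcfc_id sa)
qed

text \<open>The powers of \<open>a\<close>, \<open>b\<close> and \<open>a * b\<close> are functional
  calculi at three different elements. Logarithms bring them together: exponentials of commuting
  elements multiply, and a power scales the exponent.\<close>

lemma cpower_mult_commutative:
  fixes a b :: "'a::cstar_algebra"
  assumes comm: "\<And>x y :: 'a. x * y = y * x" and "a \<in> posdef_cone" "b \<in> posdef_cone"
  shows "a * b \<in> posdef_cone" "cpower (a * b) r = cpower a r * cpower b r"
proof -
  obtain h k where h: "star h = h" "a = exp h" and k: "star k = k" "b = exp k"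
    using posdef_cone_exp assms(2,3) by metis
  have e: "exp (x + y) = exp x * exp y" for x y :: 'a by (rule exp_add_commuting[OF comm])
  have hk: "star (h + k) = h + k" using h k by (simp add: star_add)
  show "a * b \<in> posdef_cone" "cpower (a * b) r = cpower a r * cpower b r"
    using cpower_exp[OF hk] cpower_exp(2)[OF h(1)] cpower_exp(2)[OF k(1)]
    by (simp_all add: h(2) k(2) scaleR_add_right flip: e)
qed

subsection \<open>Expansions to third order\<close>

text \<open>Landau's O of \<open>e ^ k\<close> as \<open>e\<close> decreases to 0. The one-sided
  filter makes \<open>e\<close> positive, so no absolute values appear.\<close>

definition Oh :: "nat \<Rightarrow> (real \<Rightarrow> 'a::real_normed_vector) \<Rightarrow> bool" where
  "Oh k F \<longleftrightarrow> (\<exists>C. \<forall>\<^sub>F e in at_right 0. norm (F e) \<le> C * e ^ k)"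

lemma eventually_between_0_1: "\<forall>\<^sub>F e in at_right (0::real). 0 < e \<and> e < 1"
  unfolding eventually_at_right_field by (intro exI[of _ 1]) auto

lemma Oh_add:
  assumes "Oh k F" "Oh k G" shows "Oh k (\<lambda>e. F e + G e)"
proof -
  obtain C D where "\<forall>\<^sub>F e in at_right 0. norm (F e) \<le> C * e ^ k" "\<forall>\<^sub>F e in at_right 0. norm (G e) \<le> D * e ^ k"
    using assms by (auto simp: Oh_def)
  then have "\<forall>\<^sub>F e in at_right 0. norm (F e + G e) \<le> (C + D) * e ^ k"
    by eventually_elim (simp add: distrib_right norm_triangle_mono)
  then show ?thesis by (auto simp: Oh_def)
qed

lemma Oh_scaleR:
  assumes "Oh k F" shows "Oh k (\<lambda>e. c *\<^sub>R F e)"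
proof -
  obtain C where "\<forall>\<^sub>F e in at_right 0. norm (F e) \<le> C * e ^ k" using assms by (auto simp: Oh_def)
  then have "\<forall>\<^sub>F e in at_right 0. norm (c *\<^sub>R F e) \<le> (\<bar>c\<bar> * C) * e ^ k"
    by eventually_elim (simp add: mult.assoc mult_left_mono)
  then show ?thesis by (auto simp: Oh_def)
qed

lemma Oh_diff: "Oh k F \<Longrightarrow> Oh k G \<Longrightarrow> Oh k (\<lambda>e. F e - G e)"
  using Oh_add[of k F "\<lambda>e. (-1) *\<^sub>R G e"] Oh_scaleR[of k G "-1"] by simp

lemma Oh_mult:
  fixes F G :: "real \<Rightarrow> 'a::real_normed_algebra"
  assumes "Oh k F" "Oh l G" shows "Oh (k + l) (\<lambda>e. F e * G e)"
proof -
  obtain C D where CD: "\<forall>\<^sub>F e in at_right 0. norm (F e) \<le> C * e ^ k" "\<forall>\<^sub>F e in at_right 0. norm (G e) \<le> D * e ^ l"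
    using assms by (auto simp: Oh_def)
  have "\<forall>\<^sub>F e in at_right 0. norm (F e * G e) \<le> (C * D) * e ^ (k + l)"
    using CD eventually_between_0_1
  proof eventually_elim
    case (elim e)
    then have "norm (F e) * norm (G e) \<le> (C * e ^ k) * (D * e ^ l)"
      by (intro mult_mono) (auto intro: order_trans[OF norm_ge_zero])
    then show ?case using norm_mult_ineq[of "F e" "G e"] by (simp add: power_add mult_ac)
  qed
  then show ?thesis by (auto simp: Oh_def)
qed

lemma Oh_mono:
  assumes "Oh k F" "l \<le> k" shows "Oh l F"
proof -
  obtain C where C: "\<forall>\<^sub>F e in at_right 0. norm (F e) \<le> C * e ^ k" using assms by (auto simp: Oh_def)
  have "\<forall>\<^sub>F e in at_right 0. norm (F e) \<le> \<bar>C\<bar> * e ^ l"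
    using C eventually_between_0_1
  proof eventually_elim
    case (elim e)
    have "C * e ^ k \<le> \<bar>C\<bar> * e ^ l"
      using elim assms(2) by (intro mult_mono power_decreasing) auto
    then show ?case using elim by linarith
  qed
  then show ?thesis by (auto simp: Oh_def)
qed

lemma Oh_power: "l \<le> k \<Longrightarrow> Oh l (\<lambda>e. e ^ k *\<^sub>R c)"
proof (rule Oh_mono)
  show "Oh k (\<lambda>e. e ^ k *\<^sub>R c)"
    unfolding Oh_def using eventually_between_0_1
    by (intro exI[of _ "norm c"]) (auto elim!: eventually_mono)
qed

lemma Oh_const: "Oh 0 (\<lambda>e. c)"
  using Oh_power[of 0 0 c] by simp

lemma Oh_cong:
  assumes "Oh k F" "\<forall>\<^sub>F e in at_right 0. F e = G e" shows "Oh k G"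
proof -
  obtain C where "\<forall>\<^sub>F e in at_right 0. norm (F e) \<le> C * e ^ k" using assms by (auto simp: Oh_def)
  with assms(2) have "\<forall>\<^sub>F e in at_right 0. norm (G e) \<le> C * e ^ k"
    by eventually_elim simp
  then show ?thesis by (auto simp: Oh_def)
qed

lemma Oh_power_cancel:
  assumes "Oh (Suc k) (\<lambda>e. e ^ k *\<^sub>R c)" shows "c = 0"
proof -
  obtain C where C: "\<forall>\<^sub>F e in at_right 0. norm (e ^ k *\<^sub>R c) \<le> C * e ^ Suc k" using assms by (auto simp: Oh_def)
  have "\<forall>\<^sub>F e in at_right 0. norm c \<le> C * e"
    using C eventually_between_0_1 by eventually_elim (auto simp: mult_ac)
  moreover have "((\<lambda>e. C * e) \<longlongrightarrow> C * 0) (at_right (0::real))" by (intro tendsto_intros)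
  ultimately have "norm c \<le> C * 0" by (intro tendsto_lowerbound) auto
  then show ?thesis by simp
qed

section \<open>Third-order jets of curves\<close>

text \<open>A Taylor expansion at \<open>0\<close> with remainder of order four. The coefficients
  are arguments instead of derivatives, so operations on curves become algebra on
  coefficients.\<close>

definition jet :: "(real \<Rightarrow> 'a::real_normed_vector) \<Rightarrow> 'a \<Rightarrow> 'a \<Rightarrow> 'a \<Rightarrow> 'a \<Rightarrow> bool" where
  "jet F a b c d \<longleftrightarrow> Oh 4 (\<lambda>e. F e - (a + e *\<^sub>R b + e ^ 2 *\<^sub>R c + e ^ 3 *\<^sub>R d))"

lemma jet_poly: "jet (\<lambda>e. a + e *\<^sub>R b + e ^ 2 *\<^sub>R c + e ^ 3 *\<^sub>R d) a b c d"
  unfolding jet_def using Oh_power[of 4 4 0] by simp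

lemma jet_const: "jet (\<lambda>e. a) a 0 0 0"
  using jet_poly[of a 0 0 0] by simp

lemma jet_add:
  assumes "jet F a b c d" "jet G a' b' c' d'"
  shows "jet (\<lambda>e. F e + G e) (a + a') (b + b') (c + c') (d + d')"
  using Oh_add[OF assms[unfolded jet_def]] unfolding jet_def by (simp add: algebra_simps)

lemma jet_scaleR:
  assumes "jet F a b c d"
  shows "jet (\<lambda>e. r *\<^sub>R F e) (r *\<^sub>R a) (r *\<^sub>R b) (r *\<^sub>R c) (r *\<^sub>R d)"
  using Oh_scaleR[OF assms[unfolded jet_def], of r] unfolding jet_def by (simp add: algebra_simps)

lemma jet_diff:
  assumes "jet F a b c d" "jet G a' b' c' d'"
  shows "jet (\<lambda>e. F e - G e) (a - a') (b - b') (c - c') (d - d')"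
  using Oh_diff[OF assms[unfolded jet_def]] unfolding jet_def by (simp add: algebra_simps)

lemma Oh_jet_diff:
  assumes "jet F a b c d" "jet G a b c d" shows "Oh 4 (\<lambda>e. F e - G e)"
  using jet_diff[OF assms] by (simp add: jet_def)

lemma jet_Oh:
  assumes "jet F a b c d" "Oh 4 (\<lambda>e. G e - F e)" shows "jet G a b c d"
  using Oh_add[OF assms(2) assms(1)[unfolded jet_def]] unfolding jet_def by (simp add: algebra_simps)

text \<open>Only the last coefficient is compared: in the application the first three have already
  been computed to coincide.\<close>

lemma jet_unique:
  assumes "jet F a b c d" "jet F a b c d'" shows "d = d'"
proof -
  have "Oh (Suc 3) (\<lambda>e. e ^ 3 *\<^sub>R (d' - d))"
    using Oh_diff[OF assms[unfolded jet_def]] by (simp add: algebra_simps)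
  from Oh_power_cancel[OF this] show ?thesis by simp
qed

lemma jet_bounded: "jet F a b c d \<Longrightarrow> Oh 0 F"
proof -
  assume "jet F a b c d"
  then have "Oh 0 (\<lambda>e. F e - (a + e *\<^sub>R b + e ^ 2 *\<^sub>R c + e ^ 3 *\<^sub>R d))"
    unfolding jet_def by (rule Oh_mono) simp
  moreover have "Oh 0 (\<lambda>e. a + e ^ 1 *\<^sub>R b + e ^ 2 *\<^sub>R c + e ^ 3 *\<^sub>R d)"
    by (intro Oh_add Oh_const Oh_power) auto
  ultimately show "Oh 0 F" using Oh_add by fastforce
qed

lemma jet_linear:
  assumes "jet F 0 b c d" shows "Oh 1 F"
proof -
  have "Oh 1 (\<lambda>e. F e - (0 + e *\<^sub>R b + e ^ 2 *\<^sub>R c + e ^ 3 *\<^sub>R d))"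
    using assms unfolding jet_def by (rule Oh_mono) simp
  moreover have "Oh 1 (\<lambda>e. e ^ 1 *\<^sub>R b + e ^ 2 *\<^sub>R c + e ^ 3 *\<^sub>R d)"
    by (intro Oh_add Oh_const Oh_power) auto
  ultimately show "Oh 1 F" using Oh_add by fastforce
qed

lemma jet_mult:
  fixes F G :: "real \<Rightarrow> 'a::real_normed_algebra"
  assumes F: "jet F a b c d" and G: "jet G a' b' c' d'"
  shows "jet (\<lambda>e. F e * G e) (a * a') (a * b' + b * a') (a * c' + b * b' + c * a')
    (a * d' + b * c' + c * b' + d * a')"
proof -
  define P Q where "P e = a + e *\<^sub>R b + e ^ 2 *\<^sub>R c + e ^ 3 *\<^sub>R d"
    and "Q e = a' + e *\<^sub>R b' + e ^ 2 *\<^sub>R c' + e ^ 3 *\<^sub>R d'" for e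
  have "Oh (4 + 0) (\<lambda>e. (F e - P e) * G e)"
    using Oh_mult[OF F[unfolded jet_def] jet_bounded[OF G]] by (simp add: P_def)
  moreover have "Oh (0 + 4) (\<lambda>e. P e * (G e - Q e))"
    using Oh_mult[OF jet_bounded[OF jet_poly] G[unfolded jet_def]] by (simp add: P_def Q_def)
  \<comment> \<open>These are the terms of degree 4 to 6 in the product of the two cubic
    polynomials; the error of the product is \<open>(F - P) * G + P * (G - Q)\<close> plus these
    terms.\<close>
  moreover have "Oh 4 (\<lambda>e. e ^ 4 *\<^sub>R (b * d' + c * c' + d * b') + e ^ 5 *\<^sub>R (c * d' + d * c') + e ^ 6 *\<^sub>R (d * d'))"
    by (intro Oh_add Oh_power) auto
  ultimately have "Oh 4 (\<lambda>e. (F e - P e) * G e + P e * (G e - Q e) +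
     (e ^ 4 *\<^sub>R (b * d' + c * c' + d * b') + e ^ 5 *\<^sub>R (c * d' + d * c') + e ^ 6 *\<^sub>R (d * d')))"
    using Oh_add[OF Oh_add] by fastforce
  moreover have "P e * Q e = a * a' + e *\<^sub>R (a * b' + b * a') + e ^ 2 *\<^sub>R (a * c' + b * b' + c * a') +
     e ^ 3 *\<^sub>R (a * d' + b * c' + c * b' + d * a') +
     (e ^ 4 *\<^sub>R (b * d' + c * c' + d * b') + e ^ 5 *\<^sub>R (c * d' + d * c') + e ^ 6 *\<^sub>R (d * d'))" for e
    unfolding P_def Q_def by (simp add: algebra_simps eval_nat_numeral)
  then have "(F e - P e) * G e + P e * (G e - Q e) +
     (e ^ 4 *\<^sub>R (b * d' + c * c' + d * b') + e ^ 5 *\<^sub>R (c * d' + d * c') + e ^ 6 *\<^sub>R (d * d')) =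
     F e * G e - (a * a' + e *\<^sub>R (a * b' + b * a') + e ^ 2 *\<^sub>R (a * c' + b * b' + c * a') +
     e ^ 3 *\<^sub>R (a * d' + b * c' + c * b' + d * a'))" for e
    by (simp add: left_diff_distrib right_diff_distrib)
  ultimately show ?thesis unfolding jet_def by simp
qed

section \<open>Binomial expansion of powers\<close>

lemma powr_expansion:
  fixes r :: real
  shows "\<exists>C. \<forall>t. \<bar>t\<bar> \<le> 1/2 \<longrightarrow>
    \<bar>(1 + t) powr r - (1 + r * t + (r * (r - 1) / 2) * t ^ 2 + (r * (r - 1) * (r - 2) / 6) * t ^ 3)\<bar> \<le> C * t ^ 4"
proof -
  define g where "g n = r gchoose n" for n
  have g: "g 0 = 1" "g 1 = r" "g 2 = r * (r - 1) / 2" "g 3 = r * (r - 1) * (r - 2) / 6"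
    by (simp_all add: g_def gbinomial_prod_rev eval_nat_numeral)
  \<comment> \<open>Any point strictly between 1/2 and the radius of convergence 1 would do:
    convergence there makes the series absolutely convergent at 1/2. The factor 16 below undoes the
    shift by four terms.\<close>
  have s34: "summable (\<lambda>n. g n * (3/4) ^ n)"
    unfolding g_def by (rule sums_summable[OF gen_binomial_real]) simp
  have "summable (\<lambda>n. norm (g n * (1/2) ^ n))"
    by (rule powser_insidea[OF s34]) simp
  then have s: "summable (\<lambda>n. \<bar>g (n + 4)\<bar> * (1/2) ^ n)"
    using summable_ignore_initial_segment[of "\<lambda>n. norm (g n * (1/2) ^ n)" 4]
      summable_mult[of "\<lambda>n. norm (g (n + 4) * (1/2) ^ (n + 4))" 16]
    by (simp add: abs_mult power_add power_one_over)
  define C where "C = (\<Sum>n. \<bar>g (n + 4)\<bar> * (1/2) ^ n)"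
  have "\<bar>(1 + t) powr r - (1 + r * t + (r * (r - 1) / 2) * t ^ 2 + (r * (r - 1) * (r - 2) / 6) * t ^ 3)\<bar> \<le> C * t ^ 4"
    if t: "\<bar>t\<bar> \<le> 1/2" for t
  proof -
    have sums: "(\<lambda>n. g n * t ^ n) sums (1 + t) powr r"
      unfolding g_def using t by (intro gen_binomial_real) simp
    have S: "(\<lambda>n. g (n + 4) * t ^ (n + 4)) sums
      ((1 + t) powr r - (1 + r * t + (r * (r - 1) / 2) * t ^ 2 + (r * (r - 1) * (r - 2) / 6) * t ^ 3))"
    proof -
      have "{..<4::nat} = {0, 1, 2, 3}" by auto
      then have "(\<Sum>i<4. g i * t ^ i) = 1 + r * t + (r * (r - 1) / 2) * t ^ 2 + (r * (r - 1) * (r - 2) / 6) * t ^ 3"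
        by (simp add: g g(2)[unfolded One_nat_def])
      then show ?thesis using sums_split_initial_segment[OF sums, of 4] by (simp only:)
    qed
    have le: "\<bar>g (n + 4) * t ^ (n + 4)\<bar> \<le> (\<bar>g (n + 4)\<bar> * (1/2) ^ n) * t ^ 4" for n
    proof -
      have "\<bar>t\<bar> ^ n \<le> (1/2) ^ n" using t by (intro power_mono) auto
      then have "\<bar>g (n + 4)\<bar> * \<bar>t\<bar> ^ n * t ^ 4 \<le> \<bar>g (n + 4)\<bar> * (1/2) ^ n * t ^ 4"
        by (intro mult_right_mono mult_left_mono) auto
      moreover have "\<bar>g (n + 4) * t ^ (n + 4)\<bar> = \<bar>g (n + 4)\<bar> * \<bar>t\<bar> ^ n * t ^ 4"
        by (simp add: abs_mult power_add power_abs)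
      ultimately show ?thesis by simp
    qed
    have "norm (\<Sum>n. g (n + 4) * t ^ (n + 4)) \<le> (\<Sum>n. (\<bar>g (n + 4)\<bar> * (1/2) ^ n) * t ^ 4)"
      by (intro norm_suminf_le summable_mult2 s) (use le in simp)
    then show ?thesis using S s by (simp add: sums_iff C_def suminf_mult2)
  qed
  then show ?thesis by blast
qed

text \<open>A bound between real functions on the spectrum is a norm bound after functional
  calculus. Since the scalar constant is uniform in \<open>t\<close>, \<open>C\<close> is the same
  for all \<open>a\<close>, so the estimate can be used along a curve.\<close>

lemma cpower_expansion:
  shows "\<exists>C. \<forall>a :: 'a::cstar_algebra. star a = a \<longrightarrow> norm (a - 1) \<le> 1/2 \<longrightarrow>
    norm (cpower a r - (1 + r *\<^sub>R (a - 1) + (r * (r - 1) / 2) *\<^sub>R ((a - 1) * (a - 1)) +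
      (r * (r - 1) * (r - 2) / 6) *\<^sub>R ((a - 1) * (a - 1) * (a - 1)))) \<le> C * norm (a - 1) ^ 4"
proof -
  define c2 c3 where "c2 = r * (r - 1) / 2" and "c3 = r * (r - 1) * (r - 2) / 6"
  obtain C where C: "\<And>t. \<bar>t\<bar> \<le> 1/2 \<Longrightarrow> \<bar>(1 + t) powr r - (1 + r * t + c2 * t ^ 2 + c3 * t ^ 3)\<bar> \<le> C * t ^ 4"
    using powr_expansion[of r] unfolding c2_def c3_def by blast
  \<comment> \<open>The estimate at a single nonzero \<open>t\<close> forces \<open>C\<close> to be
    nonnegative, which is needed to replace \<open>\<bar>x - 1\<bar>\<close> by
    \<open>norm (a - 1)\<close>.\<close>
  have "0 \<le> C * (1/2) ^ 4" using C[of "1/2"] by (intro order_trans[OF abs_ge_zero]) auto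
  then have C0: "0 \<le> C" by (simp add: zero_le_mult_iff)
  show ?thesis unfolding c2_def[symmetric] c3_def[symmetric]
  proof (intro exI[of _ C] allI impI)
    fix a :: 'a assume sa: "star a = a" and n: "norm (a - 1) \<le> 1/2"
    have pd: "a \<in> posdef_cone" using n by (intro posdef_cone_near_one sa) auto
    have c: "continuous_on (rspec a) (\<lambda>x. x - 1)" "continuous_on (rspec a) (\<lambda>x. (x - 1) * (x - 1))"
       "continuous_on (rspec a) (\<lambda>x. (x - 1) * (x - 1) * (x - 1))"
      by (intro continuous_intros)+
    note cp = continuous_on_powr_rspec[OF pd, of r]
    define f where "f x = 1 + r * (x - 1) + c2 * ((x - 1) * (x - 1)) + c3 * ((x - 1) * (x - 1) * (x - 1))" for x
    have cf: "continuous_on (rspec a) f" unfolding f_def by (intro continuous_intros)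
    have h: "rcfc (\<lambda>x. x - 1) a = a - 1"
      using rcfc_diff[OF sa, of "\<lambda>x. x" "\<lambda>x. 1"] by (simp add: rcfc_id[OF sa] rcfc_const[OF sa] continuous_intros)
    have "rcfc f a = 1 + r *\<^sub>R (a - 1) + c2 *\<^sub>R ((a - 1) * (a - 1)) + c3 *\<^sub>R ((a - 1) * (a - 1) * (a - 1))"
      unfolding f_def
      by (simp add: rcfc_add[OF sa] rcfc_cmult[OF sa] rcfc_mult[OF sa] rcfc_const[OF sa] h c continuous_intros)
    then have "cpower a r - (1 + r *\<^sub>R (a - 1) + c2 *\<^sub>R ((a - 1) * (a - 1)) + c3 *\<^sub>R ((a - 1) * (a - 1) * (a - 1)))
      = rcfc (\<lambda>x. x powr r - f x) a"
      using rcfc_diff[OF sa cp cf] by (simp add: cpower_rcfc)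
    also have "norm \<dots> \<le> C * norm (a - 1) ^ 4"
    proof (rule norm_rcfc_le[OF sa])
      show "continuous_on (rspec a) (\<lambda>x. x powr r - f x)" by (intro continuous_on_diff cp cf)
      fix x assume "x \<in> rspec a"
      from abs_le_norm_rcfc[OF sa c(1) this] have x: "\<bar>x - 1\<bar> \<le> norm (a - 1)" by (simp add: h)
      then have "\<bar>(1 + (x - 1)) powr r - (1 + r * (x - 1) + c2 * (x - 1) ^ 2 + c3 * (x - 1) ^ 3)\<bar> \<le> C * (x - 1) ^ 4"
        using n by (intro C) simp
      moreover have "\<bar>x - 1\<bar> ^ 4 \<le> norm (a - 1) ^ 4" using x by (intro power_mono) auto
      then have "C * (x - 1) ^ 4 \<le> C * norm (a - 1) ^ 4" using C0 by (intro mult_left_mono) (auto simp: power_even_abs)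
      ultimately show "\<bar>x powr r - f x\<bar> \<le> C * norm (a - 1) ^ 4"
        by (simp add: f_def power2_eq_square power3_eq_cube)
    qed
    finally show "norm (cpower a r - (1 + r *\<^sub>R (a - 1) + c2 *\<^sub>R ((a - 1) * (a - 1)) +
      c3 *\<^sub>R ((a - 1) * (a - 1) * (a - 1)))) \<le> C * norm (a - 1) ^ 4" .
  qed
qed

lemma jet_near_one:
  fixes X :: "real \<Rightarrow> 'a::cstar_algebra"
  assumes "jet X 1 x1 x2 x3" "0 < d"
  shows "\<forall>\<^sub>F e in at_right 0. norm (X e - 1) \<le> d"
proof -
  have "Oh 1 (\<lambda>e. X e - 1)" using jet_diff[OF assms(1) jet_const[of 1]] by (intro jet_linear) simp
  then obtain C where C: "\<forall>\<^sub>F e in at_right 0. norm (X e - 1) \<le> C * e ^ 1" by (auto simp: Oh_def)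
  have "((\<lambda>e. C * e) \<longlongrightarrow> C * 0) (at_right (0::real))" by (intro tendsto_intros)
  then have "\<forall>\<^sub>F e in at_right 0. C * e < d" using assms(2) by (intro order_tendstoD(2)) auto
  with C show ?thesis by eventually_elim simp
qed

lemma jet_posdef:
  fixes X :: "real \<Rightarrow> 'a::cstar_algebra"
  assumes "jet X 1 x1 x2 x3" "\<forall>\<^sub>F e in at_right 0. star (X e) = X e"
  shows "\<forall>\<^sub>F e in at_right 0. X e \<in> posdef_cone"
proof -
  have "\<forall>\<^sub>F e in at_right 0. norm (X e - 1) \<le> 1/2" using assms by (intro jet_near_one) auto
  with assms(2) show ?thesis by eventually_elim (auto intro!: posdef_cone_near_one)
qed

lemma jet_cpower:
  fixes X :: "real \<Rightarrow> 'a::cstar_algebra"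
  assumes X: "jet X 1 x1 x2 x3" and sa: "\<forall>\<^sub>F e in at_right 0. X e \<in> posdef_cone"
  shows "jet (\<lambda>e. cpower (X e) r) 1 (r *\<^sub>R x1) (r *\<^sub>R x2 + (r * (r - 1) / 2) *\<^sub>R (x1 * x1))
    (r *\<^sub>R x3 + (r * (r - 1) / 2) *\<^sub>R (x1 * x2 + x2 * x1) + (r * (r - 1) * (r - 2) / 6) *\<^sub>R (x1 * x1 * x1))"
proof (rule jet_Oh)
  define c2 c3 where "c2 = r * (r - 1) / 2" and "c3 = r * (r - 1) * (r - 2) / 6"
  define H where "H e = X e - 1" for e
  have H: "jet H 0 x1 x2 x3" using jet_diff[OF X jet_const[of 1]] by (simp add: H_def[abs_def])
  have H2: "jet (\<lambda>e. H e * H e) 0 0 (x1 * x1) (x1 * x2 + x2 * x1)" using jet_mult[OF H H] by simp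
  have H3: "jet (\<lambda>e. H e * H e * H e) 0 0 0 (x1 * x1 * x1)" using jet_mult[OF H2 H] by simp
  show "jet (\<lambda>e. 1 + r *\<^sub>R H e + (r * (r - 1) / 2) *\<^sub>R (H e * H e) + (r * (r - 1) * (r - 2) / 6) *\<^sub>R (H e * H e * H e)) 1 (r *\<^sub>R x1)
    (r *\<^sub>R x2 + (r * (r - 1) / 2) *\<^sub>R (x1 * x1))
    (r *\<^sub>R x3 + (r * (r - 1) / 2) *\<^sub>R (x1 * x2 + x2 * x1) + (r * (r - 1) * (r - 2) / 6) *\<^sub>R (x1 * x1 * x1))"
    using jet_add[OF jet_add[OF jet_add[OF jet_const[of 1] jet_scaleR[OF H, of r]] jet_scaleR[OF H2, of c2]] jet_scaleR[OF H3, of c3]]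
    unfolding c2_def[symmetric] c3_def[symmetric] by simp
  obtain C where C: "\<And>a :: 'a. star a = a \<Longrightarrow> norm (a - 1) \<le> 1/2 \<Longrightarrow>
    norm (cpower a r - (1 + r *\<^sub>R (a - 1) + (r * (r - 1) / 2) *\<^sub>R ((a - 1) * (a - 1)) +
      (r * (r - 1) * (r - 2) / 6) *\<^sub>R ((a - 1) * (a - 1) * (a - 1)))) \<le> C * norm (a - 1) ^ 4"
    using cpower_expansion[of r, where 'a='a] by blast
  obtain K where K: "\<forall>\<^sub>F e in at_right 0. norm (H e) \<le> K * e ^ 1"
    using jet_linear[OF H] by (auto simp: Oh_def)
  have "\<forall>\<^sub>F e in at_right 0. norm (cpower (X e) r - (1 + r *\<^sub>R H e + (r * (r - 1) / 2) *\<^sub>R (H e * H e) + (r * (r - 1) * (r - 2) / 6) *\<^sub>R (H e * H e * H e)))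
    \<le> (\<bar>C\<bar> * K ^ 4) * e ^ 4"
    using K jet_near_one[OF X, of "1/2", simplified] sa
  proof eventually_elim
    case (elim e)
    then have "norm (cpower (X e) r - (1 + r *\<^sub>R H e + (r * (r - 1) / 2) *\<^sub>R (H e * H e) + (r * (r - 1) * (r - 2) / 6) *\<^sub>R (H e * H e * H e)))
      \<le> C * norm (H e) ^ 4"
      using C[of "X e"] by (simp add: H_def posdef_cone_sa)
    also have "\<dots> \<le> \<bar>C\<bar> * norm (H e) ^ 4" by (intro mult_right_mono) auto
    also have "\<dots> \<le> \<bar>C\<bar> * (K * e ^ 1) ^ 4" using elim by (intro mult_left_mono power_mono) auto
    finally show ?case by (simp add: power_mult_distrib mult.assoc)
  qed
  then show "Oh 4 (\<lambda>e. cpower (X e) r - (1 + r *\<^sub>R H e + (r * (r - 1) / 2) *\<^sub>R (H e * H e) + (r * (r - 1) * (r - 2) / 6) *\<^sub>R (H e * H e * H e)))"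
    by (auto simp: Oh_def)
qed


subsection \<open>The expansion of the Kubo-Ando power mean\<close>

lemma kubo_ando_power_mean_posdef:
  assumes "a \<in> posdef_cone" "b \<in> posdef_cone"
  shows "kubo_ando_power_mean p a b \<in> posdef_cone"
  unfolding kubo_ando_power_mean_def
  by (intro congruence_posdef cpower_posdef posdef_cone_scaleR posdef_cone_add posdef_cone_one assms) auto

text \<open>Coefficients of an outer power after scaling by \<open>s\<close> after an inner power,
  with \<open>r\<close>, \<open>c2\<close>, \<open>c3\<close> and \<open>q\<close>,
  \<open>d2\<close>, \<open>d3\<close> as binomial coefficients of the inner and the outer exponent.
  Symbolic names separate the noncommutative rearrangement from the evaluation of the
  scalars.\<close>

lemma composed_power_coeffs:
  fixes w1 w2 w3 :: "'a::real_algebra"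
  shows "q *\<^sub>R (s *\<^sub>R (r *\<^sub>R w2 + c2 *\<^sub>R (w1 * w1))) + d2 *\<^sub>R ((s *\<^sub>R r *\<^sub>R w1) * (s *\<^sub>R r *\<^sub>R w1)) =
      (q * s * r) *\<^sub>R w2 + (q * s * c2 + d2 * (s * r) * (s * r)) *\<^sub>R (w1 * w1)"
    and "q *\<^sub>R (s *\<^sub>R (r *\<^sub>R w3 + c2 *\<^sub>R (w1 * w2 + w2 * w1) + c3 *\<^sub>R (w1 * w1 * w1))) +
      d2 *\<^sub>R ((s *\<^sub>R r *\<^sub>R w1) * (s *\<^sub>R (r *\<^sub>R w2 + c2 *\<^sub>R (w1 * w1))) +
         (s *\<^sub>R (r *\<^sub>R w2 + c2 *\<^sub>R (w1 * w1))) * (s *\<^sub>R r *\<^sub>R w1)) +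
      d3 *\<^sub>R ((s *\<^sub>R r *\<^sub>R w1) * (s *\<^sub>R r *\<^sub>R w1) * (s *\<^sub>R r *\<^sub>R w1)) =
      (q * s * r) *\<^sub>R w3 + (q * s * c2 + d2 * (s * r) * (s * r)) *\<^sub>R (w1 * w2 + w2 * w1) +
      (q * s * c3 + (d2 * (s * r) * (s * c2) + d2 * (s * r) * (s * c2)) + d3 * (s * r) * (s * r) * (s * r)) *\<^sub>R (w1 * w1 * w1)"
proof -
  show "q *\<^sub>R (s *\<^sub>R (r *\<^sub>R w2 + c2 *\<^sub>R (w1 * w1))) + d2 *\<^sub>R ((s *\<^sub>R r *\<^sub>R w1) * (s *\<^sub>R r *\<^sub>R w1)) =
      (q * s * r) *\<^sub>R w2 + (q * s * c2 + d2 * (s * r) * (s * r)) *\<^sub>R (w1 * w1)"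
    by (simp add: algebra_simps)
qed (simp only: scaleR_add_left distrib_left distrib_right scaleR_add_right mult_scaleR_left mult_scaleR_right
  scaleR_scaleR mult.assoc ac_simps)

text \<open>Conjugation with \<open>U powr (1/2)\<close> turns powers of
  \<open>H = N * D * N\<close> into \<open>D\<close>, \<open>D * M * D\<close> and
  \<open>D * M * D * M * D\<close>, where \<open>D = V - U\<close> and \<open>M\<close> is the
  inverse of \<open>U\<close>. The half powers disappear, so no square root has to be expanded in
  the result.\<close>

lemma jet_kubo_ando:
  fixes U V :: "real \<Rightarrow> 'a::cstar_algebra"
  assumes p: "p \<noteq> 0" and U: "jet U 1 u1 u2 u3" and V: "jet V 1 v1 v2 v3"
    and posU: "\<forall>\<^sub>F e in at_right 0. U e \<in> posdef_cone" and posV: "\<forall>\<^sub>F e in at_right 0. V e \<in> posdef_cone"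
    and \<alpha>: "\<alpha> = (p - 1) / 8" and d: "d1 = v1 - u1" "d2 = v2 - u2"
  shows "jet (\<lambda>e. kubo_ando_power_mean p (U e) (V e)) 1 (u1 + (1/2) *\<^sub>R d1)
     (u2 + (1/2) *\<^sub>R d2 + \<alpha> *\<^sub>R (d1 * d1))
     (u3 + (1/2) *\<^sub>R (v3 - u3) + \<alpha> *\<^sub>R (d1 * d2 + d2 * d1 - d1 * u1 * d1) - (\<alpha> / 2) *\<^sub>R (d1 * d1 * d1))"
proof -
  define N R W M D where "N e = cpower (U e) (-1/2)" and "R e = cpower (U e) (1/2)" and "W e = N e * V e * N e"
    and "M e = cpower (U e) (-1)" and "D e = V e - U e" for e
  define \<beta> where "\<beta> = - \<alpha> / 2"
  define f where "f e = cpower ((1/2) *\<^sub>R (1 + cpower (W e) p)) (1/p)" for e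
  define H where "H e = W e - 1" for e
  have posW: "\<forall>\<^sub>F e in at_right 0. W e \<in> posdef_cone"
    using posU posV by eventually_elim (auto simp: W_def N_def intro!: congruence_posdef cpower_posdef)
  note jN = jet_cpower[OF U posU, of "-1/2", folded N_def]
  \<comment> \<open>These coefficients stay anonymous: they serve to show that \<open>f\<close> and
    the cubic polynomial in \<open>H\<close> have the same jet.\<close>
  obtain w1 w2 w3 where W: "jet W 1 w1 w2 w3"
    using jet_mult[OF jet_mult[OF jN V] jN, folded W_def] by simp
  have J2: "jet (\<lambda>e. (1/2) *\<^sub>R (1 + cpower (W e) p)) 1 ((1/2) *\<^sub>R p *\<^sub>R w1)
    ((1/2) *\<^sub>R (p *\<^sub>R w2 + (p * (p - 1) / 2) *\<^sub>R (w1 * w1)))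
    ((1/2) *\<^sub>R (p *\<^sub>R w3 + (p * (p - 1) / 2) *\<^sub>R (w1 * w2 + w2 * w1) + (p * (p - 1) * (p - 2) / 6) *\<^sub>R (w1 * w1 * w1)))"
    using jet_scaleR[OF jet_add[OF jet_const[of 1] jet_cpower[OF W posW, of p]], of "1/2"]
    by (simp only: add_0_left scaleR_half_double)
  have pos2: "\<forall>\<^sub>F e in at_right 0. (1/2) *\<^sub>R (1 + cpower (W e) p) \<in> posdef_cone"
    using posW by eventually_elim (auto intro!: cpower_posdef posdef_cone_scaleR posdef_cone_add posdef_cone_one)
  have c2: "(1/p) * (1/2) * p = 1/2"
    "(1/p) * (1/2) * (p * (p - 1) / 2) + ((1/p) * ((1/p) - 1) / 2) * ((1/2) * p) * ((1/2) * p) = \<alpha>"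
    "(1/p) * (1/2) * (p * (p - 1) * (p - 2) / 6) + (((1/p) * ((1/p) - 1) / 2) * ((1/2) * p) * ((1/2) * (p * (p - 1) / 2)) + ((1/p) * ((1/p) - 1) / 2) * ((1/2) * p) * ((1/2) * (p * (p - 1) / 2))) +
      ((1/p) * ((1/p) - 1) * ((1/p) - 2) / 6) * ((1/2) * p) * ((1/2) * p) * ((1/2) * p) = \<beta>"
    using p unfolding \<alpha> \<beta>_def by (simp_all add: field_simps power2_eq_square)
  have Jf: "jet f 1 ((1/2) *\<^sub>R w1) ((1/2) *\<^sub>R w2 + \<alpha> *\<^sub>R (w1 * w1))
      ((1/2) *\<^sub>R w3 + \<alpha> *\<^sub>R (w1 * w2 + w2 * w1) + \<beta> *\<^sub>R (w1 * w1 * w1))"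
    using jet_cpower[OF J2 pos2, of "1/p", folded f_def] p
    unfolding composed_power_coeffs c2 by simp
  have H: "jet H 0 w1 w2 w3" using jet_diff[OF W jet_const[of 1]] by (simp add: H_def[abs_def])
  have H2: "jet (\<lambda>e. H e * H e) 0 0 (w1 * w1) (w1 * w2 + w2 * w1)" using jet_mult[OF H H] by simp
  have H3: "jet (\<lambda>e. H e * H e * H e) 0 0 0 (w1 * w1 * w1)" using jet_mult[OF H2 H] by simp
  have "jet (\<lambda>e. 1 + (1/2) *\<^sub>R H e + \<alpha> *\<^sub>R (H e * H e) + \<beta> *\<^sub>R (H e * H e * H e)) 1 ((1/2) *\<^sub>R w1) ((1/2) *\<^sub>R w2 + \<alpha> *\<^sub>R (w1 * w1))
      ((1/2) *\<^sub>R w3 + \<alpha> *\<^sub>R (w1 * w2 + w2 * w1) + \<beta> *\<^sub>R (w1 * w1 * w1))"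
    using jet_add[OF jet_add[OF jet_add[OF jet_const[of 1] jet_scaleR[OF H, of "1/2"]] jet_scaleR[OF H2, of \<alpha>]] jet_scaleR[OF H3, of \<beta>]]
    by simp
  then have O: "Oh 4 (\<lambda>e. f e - (1 + (1/2) *\<^sub>R H e + \<alpha> *\<^sub>R (H e * H e) + \<beta> *\<^sub>R (H e * H e * H e)))"
    by (intro Oh_jet_diff[OF Jf])
  have OR: "Oh 0 R" unfolding R_def using jet_bounded[OF jet_cpower[OF U posU]] .
  have "Oh (0 + 4 + 0) (\<lambda>e. R e * (f e - (1 + (1/2) *\<^sub>R H e + \<alpha> *\<^sub>R (H e * H e) + \<beta> *\<^sub>R (H e * H e * H e))) * R e)"
    by (intro Oh_mult OR O)
  moreover have "\<forall>\<^sub>F e in at_right 0. R e * (f e - (1 + (1/2) *\<^sub>R H e + \<alpha> *\<^sub>R (H e * H e) + \<beta> *\<^sub>R (H e * H e * H e))) * R e =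
     kubo_ando_power_mean p (U e) (V e) -
      (U e + (1/2) *\<^sub>R D e + \<alpha> *\<^sub>R (D e * M e * D e) + \<beta> *\<^sub>R (D e * M e * D e * M e * D e))"
    using posU
  proof eventually_elim
    case (elim e)
    have NR: "R e * N e = 1" "N e * R e = 1" "N e * N e = M e" "R e * R e = U e"
      using elim by (simp_all add: N_def R_def M_def cpower_add cpower_0 cpower_1)
    have NR': "R e * (N e * x) = x" "N e * (R e * x) = x" "N e * (N e * x) = M e * x" "R e * (R e * x) = U e * x" for x
      using NR by (simp_all flip: mult.assoc)
    have HD: "H e = N e * D e * N e"
      unfolding H_def W_def D_def by (simp add: algebra_simps NR' NR flip: NR(4))
    have "R e * H e * R e = D e" "R e * (H e * H e) * R e = D e * M e * D e"
      "R e * (H e * H e * H e) * R e = D e * M e * D e * M e * D e"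
      unfolding HD by (simp_all add: mult.assoc NR NR')
    moreover have "kubo_ando_power_mean p (U e) (V e) = R e * f e * R e"
      by (simp add: kubo_ando_power_mean_def R_def f_def W_def N_def)
    ultimately show ?case by (simp add: distrib_left distrib_right left_diff_distrib right_diff_distrib NR)
  qed
  ultimately have O4: "Oh 4 (\<lambda>e. kubo_ando_power_mean p (U e) (V e) -
      (U e + (1/2) *\<^sub>R D e + \<alpha> *\<^sub>R (D e * M e * D e) + \<beta> *\<^sub>R (D e * M e * D e * M e * D e)))"
    using Oh_cong by fastforce
  have jD: "jet D 0 d1 d2 (v3 - u3)" unfolding D_def[abs_def] d using jet_diff[OF V U] by simp
  \<comment> \<open>\<open>D\<close> has no constant term, so up to third order only the constant
    and linear coefficients of \<open>M\<close> enter.\<close>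
  obtain m2 m3 where jM: "jet M 1 (- u1) m2 m3" unfolding M_def[abs_def] using jet_cpower[OF U posU, of "-1"] by simp
  obtain x3 where DM: "jet (\<lambda>e. D e * M e) 0 d1 (d2 - d1 * u1) x3" using jet_mult[OF jD jM] by simp
  have DMD: "jet (\<lambda>e. D e * M e * D e) 0 0 (d1 * d1) (d1 * d2 + d2 * d1 - d1 * u1 * d1)"
    using jet_mult[OF DM jD] by (simp add: algebra_simps)
  obtain x2 where DMDM: "jet (\<lambda>e. D e * M e * D e * M e) 0 0 (d1 * d1) x2" using jet_mult[OF DMD jM] by simp
  have DMDMD: "jet (\<lambda>e. D e * M e * D e * M e * D e) 0 0 0 (d1 * d1 * d1)" using jet_mult[OF DMDM jD] by simp
  show ?thesis
    using jet_add[OF jet_add[OF jet_add[OF U jet_scaleR[OF jD, of "1/2"]] jet_scaleR[OF DMD, of \<alpha>]] jet_scaleR[OF DMDMD, of \<beta>]]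
    by (intro jet_Oh[OF _ O4]) (simp add: \<beta>_def)
qed

section \<open>Commutativity from vanishing double commutators\<close>

text \<open>The hypothesis is tested on the self-adjoint element \<open>b * b\<close>. As
  \<open>c = [a, b]\<close> commutes with \<open>a\<close>, the Leibniz rule gives
  \<open>[a, [a, b * b]] = 2 * c * c\<close>, so \<open>c * c = 0\<close>; since \<open>c\<close> is
  skew-adjoint, the C*-identity yields \<open>c = 0\<close>. Real and imaginary parts extend this to
  all elements.\<close>

lemma commutative_if_double_commutators_vanish:
  assumes "\<And>a b :: 'a::cstar_algebra. star a = a \<Longrightarrow> star b = b \<Longrightarrow> a * (a * b - b * a) = (a * b - b * a) * a"
  shows "(x::'a) * y = y * x"
proof -
  have decomp: "\<exists>h k. star h = h \<and> star k = k \<and> x = h + scaleC \<i> k" for x :: 'a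
  proof (intro exI conjI)
    define h m k where "h = (1/2) *\<^sub>R (x + star x)" and "m = (1/2) *\<^sub>R (x - star x)" and "k = scaleC (- \<i>) m"
    have m: "star m = - m" by (simp add: m_def star_simps flip: scaleR_minus_right)
    show "star h = h" by (simp add: h_def star_simps add.commute)
    show "star k = k"
      by (simp add: k_def m star_minus star_scaleC scaleC_minus_left scaleC_minus_right)
    have "x = h + m" unfolding h_def m_def scaleR_add_right scaleR_diff_right by norm
    then show "x = h + scaleC \<i> k" unfolding k_def scaleC_scaleC by simp
  qed
  have comm: "a * (a * c - c * a) = (a * c - c * a) * a" if a: "star a = a" for a c :: 'a
  proof -
    obtain h k where hk: "star h = h" "star k = k" "c = h + scaleC \<i> k" using decomp by blast
    have "a * c - c * a = (a * h - h * a) + scaleC \<i> (a * k - k * a)"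
      by (simp add: hk algebra_simps mult_scaleC_left mult_scaleC_right scaleC_diff_right)
    then show ?thesis using assms[OF a hk(1)] assms[OF a hk(2)]
      by (simp add: distrib_left distrib_right mult_scaleC_left mult_scaleC_right)
  qed
  have sa: "a * b = b * a" if a: "star a = a" and b: "star b = b" for a b :: 'a
  proof -
    define c where "c = a * b - b * a"
    have ac: "a * c = c * a" using comm[OF a, of b] by (simp add: c_def)
    have "a * (b * b) - (b * b) * a = c * b + b * c" by (simp add: c_def algebra_simps)
    then have "a * (c * b + b * c) = (c * b + b * c) * a" using comm[OF a, of "b * b"] by simp
    moreover have "a * (c * b + b * c) - (c * b + b * c) * a = 2 *\<^sub>R (c * c)"
    proof -
      have "a * (c * b) = c * (a * b)" "b * (c * a) = b * (a * c)"
        by (simp_all add: ac[symmetric]) (simp add: ac flip: mult.assoc)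
      then have "a * (c * b + b * c) - (c * b + b * c) * a = c * (a * b - b * a) + (a * b - b * a) * c"
        by (simp add: algebra_simps)
      then show ?thesis by (simp add: scaleR_2 flip: c_def)
    qed
    ultimately have "c * c = 0" by simp
    moreover have "star c = - c" by (simp add: c_def star_simps a b)
    ultimately have "norm (star c * c) = 0" by simp
    then show ?thesis by (simp add: cstar_identity c_def)
  qed
  obtain h k where hk: "star h = h" "star k = k" "x = h + scaleC \<i> k" using decomp by blast
  obtain h' k' where hk': "star h' = h'" "star k' = k'" "y = h' + scaleC \<i> k'" using decomp by blast
  have *: "h * h' = h' * h" "h * k' = k' * h" "k * h' = h' * k" "k * k' = k' * k"
    by (intro sa hk hk')+
  then show ?thesis by (simp add: hk hk' algebra_simps mult_scaleC_left mult_scaleC_right scaleC_add_right)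
qed

lemma kubo_ando_self_distributive_imp_commutative:
  assumes p: "p \<in> {-1<..<1}" "p \<noteq> 0"
    and eq: "\<And>X Z :: 'a::cstar_algebra. X \<in> posdef_cone \<Longrightarrow> Z \<in> posdef_cone \<Longrightarrow>
      kubo_ando_power_mean p (kubo_ando_power_mean p X 1) (kubo_ando_power_mean p Z 1) =
      kubo_ando_power_mean p (kubo_ando_power_mean p X Z) 1"
  shows "(x::'a) * y = y * x"
proof (rule commutative_if_double_commutators_vanish)
  fix a b :: 'a assume a: "star a = a" and b: "star b = b"
  define \<alpha> where "\<alpha> = (p - 1) / 8"
  \<comment> \<open>Scaling by \<open>\<alpha>\<close> is hidden behind a linear map, so that the
    normalisations by \<open>norm\<close> meet numerical coefficients only; \<open>A (A v)\<close>
    carries the part quadratic in \<open>\<alpha>\<close>.\<close>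
  define A where "A v = \<alpha> *\<^sub>R v" for v :: 'a
  define m1 where "m1 u1 v1 = u1 + (1/2) *\<^sub>R (v1 - u1)" for u1 v1 :: 'a
  define m2 where "m2 u1 u2 v1 v2 = u2 + (1/2) *\<^sub>R (v2 - u2) + A ((v1 - u1) * (v1 - u1))" for u1 u2 v1 v2 :: 'a
  define m3 where "m3 u1 u2 u3 v1 v2 v3 = u3 + (1/2) *\<^sub>R (v3 - u3) +
     A ((v1 - u1) * (v2 - u2) + (v2 - u2) * (v1 - u1) - (v1 - u1) * u1 * (v1 - u1)) -
     (1/2) *\<^sub>R A ((v1 - u1) * (v1 - u1) * (v1 - u1))" for u1 u2 u3 v1 v2 v3 :: 'a
  let ?m = "kubo_ando_power_mean p"
  have K: "jet (\<lambda>e. ?m (U e) (V e)) 1 (m1 u1 v1) (m2 u1 u2 v1 v2) (m3 u1 u2 u3 v1 v2 v3)"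
    if "jet U 1 u1 u2 u3" "jet V 1 v1 v2 v3" "\<forall>\<^sub>F e in at_right 0. U e \<in> posdef_cone"
      "\<forall>\<^sub>F e in at_right 0. V e \<in> posdef_cone" for U V :: "real \<Rightarrow> 'a" and u1 u2 u3 v1 v2 v3
    using jet_kubo_ando[OF p(2) that \<alpha>_def refl refl] by (simp add: m1_def m2_def m3_def A_def)
  \<comment> \<open>The two directions have half-sum \<open>b\<close> and half-difference
    \<open>a\<close>, so the mean of \<open>X\<close> and \<open>Z\<close> starts with
    \<open>b\<close> and the terms odd in \<open>a\<close> cancel.\<close>
  define X Z :: "real \<Rightarrow> 'a" where "X e = 1 + e *\<^sub>R (b + a)" and "Z e = 1 + e *\<^sub>R (b - a)" for e
  have jX: "jet X 1 (b + a) 0 0" and jZ: "jet Z 1 (b - a) 0 0"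
    using jet_poly[of 1 "b + a" 0 0] jet_poly[of 1 "b - a" 0 0] by (simp_all add: X_def[abs_def] Z_def[abs_def])
  have pX: "\<forall>\<^sub>F e in at_right 0. X e \<in> posdef_cone" and pZ: "\<forall>\<^sub>F e in at_right 0. Z e \<in> posdef_cone"
    by (rule jet_posdef[OF jX] jet_posdef[OF jZ], simp add: X_def Z_def star_simps a b)+
  have p1: "\<forall>\<^sub>F e in at_right (0::real). 1 \<in> (posdef_cone :: 'a set)" by (simp add: posdef_cone_one)
  have pos: "\<forall>\<^sub>F e in at_right 0. ?m (F e) (G e) \<in> posdef_cone"
    if "\<forall>\<^sub>F e in at_right 0. F e \<in> posdef_cone" "\<forall>\<^sub>F e in at_right 0. G e \<in> posdef_cone" for F G :: "real \<Rightarrow> 'a"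
    using that by eventually_elim (rule kubo_ando_power_mean_posdef)
  note jU = K[OF jX jet_const pX p1] and jV = K[OF jZ jet_const pZ p1] and jT = K[OF jX jZ pX pZ]
  note jL = K[OF jU jV pos[OF pX p1] pos[OF pZ p1]]
  note jR = K[OF jT jet_const pos[OF pX pZ] p1]
  have "\<forall>\<^sub>F e in at_right 0. ?m (?m (X e) 1) (?m (Z e) 1) - ?m (?m (X e) (Z e)) 1 = 0"
    using pX pZ by eventually_elim (simp add: eq)
  then have "Oh 4 (\<lambda>e. ?m (?m (X e) 1) (?m (Z e) 1) - ?m (?m (X e) (Z e)) 1)"
    unfolding Oh_def by (intro exI[of _ 0]) (auto elim: eventually_mono)
  note jL' = jet_Oh[OF jR this]
  have A: "A (v + w) = A v + A w" "A (v - w) = A v - A w" "A (c *\<^sub>R v) = c *\<^sub>R A v"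
    "A v * w = A (v * w)" "w * A v = A (w * v)" "A 0 = 0" for v w c
    by (simp_all add: A_def algebra_simps)
  note lin = A distrib_left distrib_right left_diff_distrib right_diff_distrib scaleR_add_right scaleR_diff_right
    mult_scaleR_left mult_scaleR_right mult.assoc mult_zero_left mult_zero_right scaleR_zero_right
  define U1 U2 U3 V1 V2 V3 T1 T2 T3 where "U1 = m1 (b + a) 0" and "U2 = m2 (b + a) 0 0 0"
    and "U3 = m3 (b + a) 0 0 0 0 0" and "V1 = m1 (b - a) 0" and "V2 = m2 (b - a) 0 0 0"
    and "V3 = m3 (b - a) 0 0 0 0 0" and "T1 = m1 (b + a) (b - a)"
    and "T2 = m2 (b + a) 0 (b - a) 0" and "T3 = m3 (b + a) 0 0 (b - a) 0 0"
  note UVT = U1_def U2_def U3_def V1_def V2_def V3_def T1_def T2_def T3_def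
  have U1: "U1 = (1/2) *\<^sub>R b + (1/2) *\<^sub>R a" and V1: "V1 = (1/2) *\<^sub>R b - (1/2) *\<^sub>R a" and T1: "T1 = b"
    unfolding UVT m1_def by norm+
  have U2: "U2 = A (b * b) + A (b * a) + A (a * b) + A (a * a)"
    and V2: "V2 = A (b * b) - A (b * a) - A (a * b) + A (a * a)"
    and T2: "T2 = 4 *\<^sub>R A (a * a)"
    unfolding UVT m2_def lin by norm+
  \<comment> \<open>In \<open>T3\<close> the contributions in \<open>a * a * a\<close> cancel: the
    difference of the two directions is \<open>- 2 * a\<close>, and the two cubic terms of the mean
    give \<open>-4\<close> and \<open>+4\<close>.\<close>
  have U3: "U3 = - (1/2) *\<^sub>R A ((b + a) * (b + a) * (b + a))"
    and V3: "V3 = - (1/2) *\<^sub>R A ((b - a) * (b - a) * (b - a))"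
    and T3: "T3 = - 4 *\<^sub>R A (a * b * a)"
    unfolding UVT m3_def lin by norm+
  have "m1 U1 V1 = m1 T1 0" "m2 U1 U2 V1 V2 = m2 T1 T2 0 0"
    unfolding m1_def m2_def U1 V1 T1 U2 V2 T2 lin by norm+
  then have "m3 U1 U2 U3 V1 V2 V3 = m3 T1 T2 T3 0 0 0"
    using jet_unique[OF jL'[folded UVT]] jL[folded UVT] by metis
  \<comment> \<open>The bracket is \<open>[a, [a, b]]\<close> written out. It occurs once with
    \<open>\<alpha>\<close> and once with \<open>\<alpha> * \<alpha>\<close>, and these weights
    combine to the scalar \<open>(p - 1) * (p + 1) / 32\<close>, which is nonzero for the given
    \<open>p\<close>.\<close>
  moreover have "m3 T1 T2 T3 0 0 0 - m3 U1 U2 U3 V1 V2 V3 =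
      (1/2) *\<^sub>R A (a * a * b - 2 *\<^sub>R (a * b * a) + b * a * a) + 2 *\<^sub>R A (A (a * a * b - 2 *\<^sub>R (a * b * a) + b * a * a))"
    unfolding m3_def U1 V1 T1 U2 V2 T2 U3 V3 T3 lin by norm
  ultimately have "(1/2) *\<^sub>R A (a * a * b - 2 *\<^sub>R (a * b * a) + b * a * a) + 2 *\<^sub>R A (A (a * a * b - 2 *\<^sub>R (a * b * a) + b * a * a)) = 0"
    by simp
  then have "(\<alpha> / 2 + 2 * (\<alpha> * \<alpha>)) *\<^sub>R (a * a * b - 2 *\<^sub>R (a * b * a) + b * a * a) = 0"
    by (simp add: A_def scaleR_add_left)
  moreover have "\<alpha> / 2 + 2 * (\<alpha> * \<alpha>) = (p - 1) * (p + 1) / 32"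
    by (simp add: \<alpha>_def field_simps)
  ultimately have "a * a * b - 2 *\<^sub>R (a * b * a) + b * a * a = 0" using p(1) by auto
  moreover have "a * (a * b - b * a) - (a * b - b * a) * a = a * a * b - 2 *\<^sub>R (a * b * a) + b * a * a"
    by (simp add: algebra_simps scaleR_2)
  ultimately show "a * (a * b - b * a) = (a * b - b * a) * a" by simp
qed

subsection \<open>Jensen maps between positive definite cones\<close>

text \<open>Real linearity is deliberately not demanded: multiples are only taken by integers,
  limits run along reciprocals of integers, and the interpolation nodes further below are integers
  too.\<close>

definition sa_additive :: "('a::cstar_algebra \<Rightarrow> 'b::cstar_algebra) \<Rightarrow> bool" where
  "sa_additive S \<longleftrightarrow> (\<forall>h k. star h = h \<longrightarrow> star k = k \<longrightarrow> S (h + k) = S h + S k)"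

context
  fixes S :: "'a::cstar_algebra \<Rightarrow> 'b::cstar_algebra"
  assumes S: "sa_additive S"
begin

lemma sa_additive_add: "star h = h \<Longrightarrow> star k = k \<Longrightarrow> S (h + k) = S h + S k"
  using S by (simp add: sa_additive_def)

lemma sa_additive_zero: "S 0 = 0"
  using sa_additive_add[of 0 0] by simp

lemma sa_additive_minus: "star h = h \<Longrightarrow> S (- h) = - S h"
  using sa_additive_add[of h "- h"] by (simp add: star_minus sa_additive_zero eq_neg_iff_add_eq_0 add.commute)

lemma sa_additive_diff: "star h = h \<Longrightarrow> star k = k \<Longrightarrow> S (h - k) = S h - S k"
  using sa_additive_add[of h "- k"] by (simp add: star_minus sa_additive_minus)

lemma sa_additive_nat: "star h = h \<Longrightarrow> S (real n *\<^sub>R h) = real n *\<^sub>R S h"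
proof (induction n)
  case (Suc n)
  then show ?case using sa_additive_add[of h "real n *\<^sub>R h"] by (simp add: star_scaleR scaleR_add_left)
qed (simp add: sa_additive_zero)

lemma sa_additive_int: "star h = h \<Longrightarrow> S (of_int i *\<^sub>R h) = of_int i *\<^sub>R S h"
proof (cases i rule: int_cases2)
  case (nonpos n)
  assume "star h = h"
  then show ?thesis using sa_additive_minus[of "real n *\<^sub>R h"] nonpos by (simp add: sa_additive_nat star_scaleR)
qed (simp add: sa_additive_nat)

lemma sa_additive_sum:
  "(\<And>i. i \<in> I \<Longrightarrow> star (f i) = f i) \<Longrightarrow> S (sum f I) = (\<Sum>i\<in>I. S (f i))"
  by (induction I rule: infinite_finite_induct) (auto simp: sa_additive_zero sa_additive_add star_sum)

end

lemma pos_cone_limit: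
  assumes "\<And>n. x + inverse (real (Suc n)) *\<^sub>R c \<in> pos_cone"
  shows "x \<in> pos_cone"
proof -
  have "(\<lambda>n. x + inverse (real (Suc n)) *\<^sub>R c) \<longlonglongrightarrow> x + 0 *\<^sub>R c"
    by (intro tendsto_add tendsto_scaleR tendsto_const LIMSEQ_inverse_real_of_nat)
  from closed_sequentially[OF closed_pos_cone assms this] show ?thesis by simp
qed

text \<open>A positive \<open>q\<close> is approached by \<open>q + t\<close> with
  \<open>t = 1 / (n + 1)\<close>. For these \<open>t\<close>, additivity alone gives
  \<open>S t = t * S 1\<close>, so the limit is taken in the target cone and not through
  \<open>S\<close>.\<close>

lemma sa_additive_pos:
  assumes S: "sa_additive S" and pos: "\<And>a. a \<in> posdef_cone \<Longrightarrow> S a \<in> pos_cone" and q: "q \<in> pos_cone"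
  shows "S q \<in> pos_cone"
proof (rule pos_cone_limit)
  fix n
  define t where "t = inverse (real (Suc n))"
  have t: "t > 0" "real (Suc n) * t = 1" by (simp_all add: t_def)
  have "q + t *\<^sub>R 1 \<in> posdef_cone"
    using posdef_cone_add_pos[OF posdef_cone_scaleR[OF posdef_cone_one t(1)] q] by (simp add: add.commute)
  then have "S (q + t *\<^sub>R 1) \<in> pos_cone" by (rule pos)
  moreover have "real (Suc n) *\<^sub>R S (t *\<^sub>R 1) = S 1"
    using sa_additive_nat[OF S, of "t *\<^sub>R 1" "Suc n"] t by (simp add: star_scaleR)
  then have "t *\<^sub>R S 1 = S (t *\<^sub>R 1)" using t(2) by (metis mult.commute scaleR_one scaleR_scaleR)
  ultimately show "S q + inverse (real (Suc n)) *\<^sub>R S 1 \<in> pos_cone"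
    unfolding t_def[symmetric] using q by (simp add: sa_additive_add[OF S] star_scaleR pos_cone_sa)
qed

definition jensen_map :: "('a::cstar_algebra \<Rightarrow> 'b::cstar_algebra) \<Rightarrow> bool" where
  "jensen_map f \<longleftrightarrow> (\<forall>a\<in>posdef_cone. f a \<in> posdef_cone) \<and>
     (\<forall>a\<in>posdef_cone. \<forall>b\<in>posdef_cone. f ((1/2) *\<^sub>R (a + b)) = (1/2) *\<^sub>R (f a + f b))"

lemma selfadjoint_diff_posdef:
  fixes h :: "'a::cstar_algebra"
  assumes "star h = h"
  obtains a b where "a \<in> posdef_cone" "b \<in> posdef_cone" "h = a - b"
proof
  show "of_real (norm h + 1) + h \<in> posdef_cone" by (rule posdef_cone_shift[OF assms]) simp
  show "of_real (norm h + 1) \<in> (posdef_cone :: 'a set)" by (intro posdef_cone_of_real) (simp add: add_nonneg_pos)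
qed simp

text \<open>No continuity is needed: positivity of \<open>f\<close> on large and small multiples gives \<open>L a \<ge> 0\<close> and \<open>c \<ge> 0\<close>.\<close>

lemma jensen_map_affine:
  fixes f :: "'a::cstar_algebra \<Rightarrow> 'b::cstar_algebra"
  assumes f: "jensen_map f"
  obtains L c where "sa_additive L" "\<And>a. a \<in> posdef_cone \<Longrightarrow> L a \<in> pos_cone" "c \<in> pos_cone"
    "\<And>a. a \<in> posdef_cone \<Longrightarrow> f a = L a + c"
proof -
  have fpd: "f a \<in> posdef_cone" if "a \<in> posdef_cone" for a using f that by (auto simp: jensen_map_def)
  have J: "f a + f b = 2 *\<^sub>R f ((1/2) *\<^sub>R (a + b))" if "a \<in> posdef_cone" "b \<in> posdef_cone" for a b
    using f that by (auto simp: jensen_map_def)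
  \<comment> \<open>Every self-adjoint \<open>h\<close> is a difference of two positive definite
    elements; this fixes one such pair, and the next claim shows that any other pair gives the same
    value.\<close>
  define L where "L h = f (of_real (norm h + 1) + h) - f (of_real (norm h + 1))" for h
  have L: "L (a - b) = f a - f b" if ab: "a \<in> posdef_cone" "b \<in> posdef_cone" for a b
  proof -
    define h t where "h = a - b" and "t = (of_real (norm h + 1) :: 'a)"
    have "star h = h" using ab by (simp add: h_def star_diff posdef_cone_sa)
    then have th: "t + h \<in> posdef_cone" unfolding t_def by (rule posdef_cone_shift) simp
    have t: "t \<in> posdef_cone" unfolding t_def by (rule posdef_cone_of_real) (simp add: add_nonneg_pos)
    have "f (t + h) + f b = f a + f t"
      using J[OF th ab(2)] J[OF ab(1) t] by (simp add: h_def algebra_simps)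
    then have "f (t + h) = f a + f t - f b" by (simp only: eq_diff_eq)
    moreover have "L h = f (t + h) - f t" by (simp only: L_def t_def)
    ultimately show ?thesis by (simp add: h_def[symmetric])
  qed
  have L0: "L 0 = 0" using L[OF posdef_cone_one posdef_cone_one] by simp
  \<comment> \<open>Jensen's equation halves its arguments, and 0 is not at hand in the open cone to
    remove the factor. It is removed for \<open>L\<close> instead, by taking \<open>k = 0\<close>
    where \<open>L 0 = 0\<close>.\<close>
  have half: "L (h + k) = (1/2) *\<^sub>R (L (2 *\<^sub>R h) + L (2 *\<^sub>R k))" if h: "star h = h" and k: "star k = k" for h k
  proof -
    obtain a b where ab: "a \<in> posdef_cone" "b \<in> posdef_cone" "h = a - b" using h by (rule selfadjoint_diff_posdef)
    obtain c d where cd: "c \<in> posdef_cone" "d \<in> posdef_cone" "k = c - d" using k by (rule selfadjoint_diff_posdef)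
    have two: "2 *\<^sub>R x \<in> posdef_cone" if "x \<in> posdef_cone" for x :: 'a using that by (intro posdef_cone_scaleR) auto
    have "h + k = (a + c) - (b + d)" by (simp add: ab cd)
    then have "L (h + k) = f (a + c) - f (b + d)" using ab cd L posdef_cone_add by metis
    moreover have "f (x + y) = (1/2) *\<^sub>R (f (2 *\<^sub>R x) + f (2 *\<^sub>R y))" if "x \<in> posdef_cone" "y \<in> posdef_cone" for x y
      using J[OF two[OF that(1)] two[OF that(2)]] by (simp add: scaleR_add_right)
    moreover have "2 *\<^sub>R h = 2 *\<^sub>R a - 2 *\<^sub>R b" "2 *\<^sub>R k = 2 *\<^sub>R c - 2 *\<^sub>R d" by (simp_all add: ab cd scaleR_diff_right)
    ultimately show ?thesis using L[OF two two] ab cd by (simp add: scaleR_add_right scaleR_diff_right)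
  qed
  have "L h = (1/2) *\<^sub>R L (2 *\<^sub>R h)" if "star h = h" for h using half[OF that, of 0] L0 by simp
  then have add: "sa_additive L" unfolding sa_additive_def using half by (simp add: scaleR_add_right)
  define c where "c = f 1 - L 1"
  have fc: "f a = L a + c" if "a \<in> posdef_cone" for a
    using L[OF that posdef_cone_one] sa_additive_diff[OF add, of a 1] posdef_cone_sa[OF that]
    by (simp add: c_def algebra_simps)
  have La: "L a \<in> pos_cone" if a: "a \<in> posdef_cone" for a
  proof (rule pos_cone_limit)
    fix n
    have "real (Suc n) *\<^sub>R L a + c = f (real (Suc n) *\<^sub>R a)"
      using fc[of "real (Suc n) *\<^sub>R a"] a
      by (simp add: sa_additive_nat[OF add] posdef_cone_sa posdef_cone_scaleR del: of_nat_Suc)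
    then have "real (Suc n) *\<^sub>R L a + c \<in> pos_cone"
      using fpd[of "real (Suc n) *\<^sub>R a"] a by (simp add: posdef_cone_scaleR posdef_cone_pos del: of_nat_Suc)
    then have "inverse (real (Suc n)) *\<^sub>R (real (Suc n) *\<^sub>R L a + c) \<in> pos_cone"
      by (rule pos_cone_scaleR) simp
    then show "L a + inverse (real (Suc n)) *\<^sub>R c \<in> pos_cone"
      by (simp add: scaleR_add_right del: of_nat_Suc)
  qed
  have "c \<in> pos_cone"
  proof (rule pos_cone_limit)
    fix n
    define t where "t = inverse (real (Suc n))"
    have t: "t > 0" "real (Suc n) * t = 1" by (simp_all add: t_def)
    have pd: "t *\<^sub>R 1 \<in> (posdef_cone :: 'a set)" using posdef_cone_one t(1) by (rule posdef_cone_scaleR)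
    have "real (Suc n) *\<^sub>R L (t *\<^sub>R 1) = L 1"
      using sa_additive_nat[OF add, of "t *\<^sub>R 1" "Suc n"] t by (simp add: star_scaleR)
    then have "t *\<^sub>R L 1 = L (t *\<^sub>R 1)" using t(2) by (metis mult.commute scaleR_one scaleR_scaleR)
    then have "c + t *\<^sub>R L 1 = f (t *\<^sub>R 1)" using fc[OF pd] by simp
    then show "c + inverse (real (Suc n)) *\<^sub>R L 1 \<in> pos_cone"
      unfolding t_def[symmetric] using fpd[OF pd] by (simp add: posdef_cone_pos)
  qed
  with that add La fc show ?thesis by blast
qed

text \<open>Composing the two affine forms gives \<open>a = L' (L a) + (L' c + c')\<close>;
  comparing \<open>a = 1\<close> with \<open>a = 1 + 1\<close> makes the constant vanish. It is a
  sum of two positive elements, so each of them is 0, in particular \<open>c'\<close>.\<close>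

lemma jensen_map_linear:
  fixes f :: "'a::cstar_algebra \<Rightarrow> 'b::cstar_algebra" and g :: "'b \<Rightarrow> 'a"
  assumes f: "jensen_map f" and g: "jensen_map g" and gf: "\<And>a. a \<in> posdef_cone \<Longrightarrow> g (f a) = a"
  obtains L where "sa_additive L" "\<And>x. x \<in> posdef_cone \<Longrightarrow> g x = L x"
proof -
  obtain L c where L: "sa_additive L" "\<And>a. a \<in> posdef_cone \<Longrightarrow> L a \<in> pos_cone" "c \<in> pos_cone"
    "\<And>a. a \<in> posdef_cone \<Longrightarrow> f a = L a + c" using jensen_map_affine[OF f] by blast
  obtain L' c' where L': "sa_additive L'" "\<And>a. a \<in> posdef_cone \<Longrightarrow> L' a \<in> pos_cone" "c' \<in> pos_cone"
    "\<And>a. a \<in> posdef_cone \<Longrightarrow> g a = L' a + c'" using jensen_map_affine[OF g] by blast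
  have *: "a = L' (L a) + (L' c + c')" if a: "a \<in> posdef_cone" for a
  proof -
    have "f a \<in> posdef_cone" using f a by (simp add: jensen_map_def)
    then have "a = L' (f a) + c'" using L'(4) gf[OF a] by metis
    also have "L' (f a) = L' (L a) + L' c"
      using L(4)[OF a] sa_additive_add[OF L'(1)] pos_cone_sa L(2)[OF a] L(3) by metis
    finally show ?thesis by (simp add: add.assoc)
  qed
  have "L' (L (1 + 1)) = L' (L 1) + L' (L 1)"
    using sa_additive_add[OF L(1), of 1 1] sa_additive_add[OF L'(1), of "L 1" "L 1"] pos_cone_sa[OF L(2)[OF posdef_cone_one]]
    by simp
  then have "L' c + c' = 0"
    using *[OF posdef_cone_one] *[OF posdef_cone_add[OF posdef_cone_one posdef_cone_one]]
    by (metis add.assoc add.commute add_cancel_right_right add_left_cancel)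
  moreover have "L' c \<in> pos_cone" using sa_additive_pos[OF L'(1,2) L(3)] .
  ultimately have "- c' \<in> pos_cone" using minus_unique[of c' "L' c"] by (simp add: add.commute)
  then have "c' = 0" by (rule pos_cone_antisym[OF L'(3)])
  then show ?thesis using that L'(1,4) by simp
qed

subsection \<open>Kadison's inequality\<close>

text \<open>Tent functions at the integers: the partition of unity behind piecewise linear
  interpolation.\<close>

definition hat :: "int \<Rightarrow> real \<Rightarrow> real" where
  "hat i x = max 0 (1 - \<bar>x - of_int i\<bar>)"

text \<open>Only the nodes \<open>k\<close> and \<open>k + 1\<close> with
  \<open>k = \<lfloor>x\<rfloor>\<close> contribute, and the margin 1 in the hypothesis keeps both
  in range. Interpolation is exact for affine functions, and for the square it overshoots by
  \<open>t * (1 - t)\<close>, where \<open>t\<close> is the fractional part of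
  \<open>x\<close>.\<close>

lemma hat_sums:
  assumes "\<bar>x\<bar> \<le> of_int N - 1"
  shows "(\<Sum>i=-N..N. hat i x) = 1" "(\<Sum>i=-N..N. of_int i * hat i x) = x"
    "(\<Sum>i=-N..N. of_int (i * i) * hat i x) \<le> x * x + 1"
proof -
  define k where "k = \<lfloor>x\<rfloor>"
  have k: "of_int k \<le> x" "x < of_int k + 1" by (auto simp: k_def)
  have "of_int k \<ge> - of_int N + (0::real)" "of_int k + 1 \<le> of_int N + (0::real)"
    using assms k by linarith+
  then have sub: "{k, k + 1} \<subseteq> {-N..N}" by auto
  have z: "hat i x = 0" if "i \<in> {-N..N} - {k, k + 1}" for i
  proof -
    have "i \<le> k - 1 \<or> i \<ge> k + 2" using that by auto
    then have "of_int i \<le> of_int k - (1::real) \<or> of_int i \<ge> of_int k + (2::real)" by linarith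
    then show ?thesis using k by (auto simp: hat_def)
  qed
  have S: "(\<Sum>i=-N..N. g i * hat i x) = g k * (1 - (x - k)) + g (k + 1) * (x - k)" for g
  proof -
    have "(\<Sum>i=-N..N. g i * hat i x) = (\<Sum>i\<in>{k, k + 1}. g i * hat i x)"
      by (rule sum.mono_neutral_right) (use sub z in auto)
    then show ?thesis using k by (simp add: hat_def)
  qed
  show "(\<Sum>i=-N..N. hat i x) = 1" using S[of "\<lambda>_. 1"] by simp
  show "(\<Sum>i=-N..N. of_int i * hat i x) = x" using S[of of_int] by (simp add: algebra_simps)
  define t where "t = x - of_int k"
  have x: "x = of_int k + t" and t: "0 \<le> t" "t < 1" using k by (auto simp: t_def)
  have "(\<Sum>i=-N..N. of_int (i * i) * hat i x) = x * x + t * (1 - t)"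
    using S[of "\<lambda>i. of_int (i * i)"] by (simp add: x algebra_simps)
  moreover have "t * (1 - t) \<le> 1 * 1" using t by (intro mult_mono) auto
  ultimately show "(\<Sum>i=-N..N. of_int (i * i) * hat i x) \<le> x * x + 1" by simp
qed

definition unital_order_hom :: "('a::cstar_algebra \<Rightarrow> 'b::cstar_algebra) \<Rightarrow> bool" where
  "unital_order_hom S \<longleftrightarrow> sa_additive S \<and> (\<forall>a\<in>posdef_cone. S a \<in> posdef_cone) \<and> S 1 = 1"

lemma unital_order_hom_sa:
  assumes "unital_order_hom S" "star h = h"
  shows "star (S h) = S h"
proof -
  obtain a b where "a \<in> posdef_cone" "b \<in> posdef_cone" "h = a - b" using assms(2) by (rule selfadjoint_diff_posdef)
  then show ?thesis using assms(1) sa_additive_diff[of S a b]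
    by (simp add: unital_order_hom_def posdef_cone_sa star_diff)
qed

text \<open>
  Interpolating at the integers writes \<open>b = \<Sum>i. i E\<^sub>i\<close> with positive \<open>E\<^sub>i\<close> summing to 1; the
  inequality is \<open>0 \<le> \<Sum>i. (i - S b) (S E\<^sub>i) (i - S b)\<close> up to the interpolation error 1, which is
  removed by scaling \<open>b\<close>.
\<close>

lemma kadison_inequality_plus_one:
  fixes S :: "'a::cstar_algebra \<Rightarrow> 'b::cstar_algebra"
  assumes S: "unital_order_hom S" and b: "star b = b"
  shows "S (b * b) + 1 - S b * S b \<in> pos_cone"
proof -
  have add: "sa_additive S" and S1: "S 1 = 1" and pd: "\<And>a. a \<in> posdef_cone \<Longrightarrow> S a \<in> pos_cone"
    using S by (auto simp: unital_order_hom_def posdef_cone_pos)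
  have pos: "S q \<in> pos_cone" if "q \<in> pos_cone" for q
    by (rule sa_additive_pos[OF add pd that])
  define N where "N = \<lceil>norm b\<rceil> + 1"
  have N: "\<bar>x\<bar> \<le> of_int N - 1" if "x \<in> rspec b" for x
    using abs_le_norm_rspec[OF that] le_of_int_ceiling[of "norm b"] unfolding N_def by linarith
  define I where "I = {-N..N}"
  define E where "E i = rcfc (hat i) b" for i
  have ch: "continuous_on (rspec b) (hat i)" for i unfolding hat_def by (intro continuous_intros)
  have E: "E i \<in> pos_cone" for i unfolding E_def by (intro rcfc_pos b ch) (auto simp: hat_def)
  have Esa: "star (E i) = E i" for i using E pos_cone_sa by blast
  have "(\<Sum>i\<in>I. E i) = rcfc (\<lambda>x. \<Sum>i\<in>I. hat i x) b"
    unfolding E_def by (rule rcfc_sum[OF b, symmetric]) (auto simp: I_def ch)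
  also have "\<dots> = rcfc (\<lambda>x. 1) b"
    by (intro rcfc_cong b continuous_on_sum ch) (simp add: I_def hat_sums(1)[OF N])
  finally have E1: "(\<Sum>i\<in>I. E i) = 1" by (simp add: rcfc_const b)
  have w: "(\<Sum>i\<in>I. of_int (g i) *\<^sub>R E i) = rcfc (\<lambda>x. \<Sum>i\<in>I. of_int (g i) * hat i x) b" for g :: "int \<Rightarrow> int"
    using rcfc_sum[OF b, of I "\<lambda>i x. of_int (g i) * hat i x"] unfolding E_def
    by (simp add: I_def rcfc_cmult[OF b] ch continuous_intros)
  have "rcfc (\<lambda>x. \<Sum>i\<in>I. of_int i * hat i x) b = rcfc (\<lambda>x. x) b"
    by (intro rcfc_cong b continuous_intros ch) (simp add: I_def hat_sums(2)[OF N])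
  then have E2: "(\<Sum>i\<in>I. of_int i *\<^sub>R E i) = b" using w[of "\<lambda>i. i"] by (simp add: rcfc_id b)
  have "rcfc (\<lambda>x. (x * x + 1) - (\<Sum>i\<in>I. of_int (i * i) * hat i x)) b \<in> pos_cone"
    by (intro rcfc_pos b continuous_intros ch) (use hat_sums(3)[OF N] in \<open>simp add: I_def\<close>)
  moreover have "rcfc (\<lambda>x. (x * x + 1) - (\<Sum>i\<in>I. of_int (i * i) * hat i x)) b =
    (b * b + 1) - (\<Sum>i\<in>I. of_int (i * i) *\<^sub>R E i)"
    unfolding w by (subst rcfc_diff[OF b], (intro continuous_intros ch)+, subst rcfc_add[OF b], (intro continuous_intros)+)
      (simp add: square_rcfc[OF b] rcfc_const[OF b])
  ultimately have E3: "(b * b + 1) - (\<Sum>i\<in>I. of_int (i * i) *\<^sub>R E i) \<in> pos_cone" by simp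
  define q where "q i = S (E i)" for i
  have q: "q i \<in> pos_cone" for i unfolding q_def using E by (rule pos)
  have sw: "S (\<Sum>i\<in>I. of_int (g i) *\<^sub>R E i) = (\<Sum>i\<in>I. of_int (g i) *\<^sub>R q i)" for g
    unfolding q_def by (subst sa_additive_sum[OF add]) (auto simp: star_scaleR Esa sa_additive_int[OF add])
  have q1: "(\<Sum>i\<in>I. q i) = 1" using sw[of "\<lambda>_. 1"] by (simp add: E1 S1)
  have q2: "(\<Sum>i\<in>I. of_int i *\<^sub>R q i) = S b" using sw[of "\<lambda>i. i"] by (simp add: E2)
  have bb: "star (b * b) = b * b" by (simp add: star_mult b)
  have "S ((b * b + 1) - (\<Sum>i\<in>I. of_int (i * i) *\<^sub>R E i)) = S (b * b) + 1 - (\<Sum>i\<in>I. of_int (i * i) *\<^sub>R q i)"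
    using bb by (simp add: sa_additive_diff[OF add] sa_additive_add[OF add] star_add star_sum star_scaleR Esa S1 sw del: of_int_mult)
  then have q3: "S (b * b) + 1 - (\<Sum>i\<in>I. of_int (i * i) *\<^sub>R q i) \<in> pos_cone" using pos[OF E3] by simp
  have m: "star (S b) = S b" using unital_order_hom_sa[OF S b] .
  have "(\<Sum>i\<in>I. (of_int i - S b) * q i * (of_int i - S b)) \<in> pos_cone"
  proof (intro pos_cone_sum congruence_selfadjoint_pos q)
    fix i show "star (of_int i - S b) = of_int i - S b"
      using star_of_real[of "of_int i", where 'a='b] by (simp add: star_diff m)
  qed
  \<comment> \<open>Because \<open>q i\<close> sum to 1 and \<open>i * q i\<close> to
    \<open>S b\<close>, the two cross terms and the last term are \<open>S b * S b\<close> with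
    signs minus, minus and plus.\<close>
  moreover have "(\<Sum>i\<in>I. (of_int i - S b) * q i * (of_int i - S b)) = (\<Sum>i\<in>I. of_int (i * i) *\<^sub>R q i) - S b * S b"
  proof -
    have "(of_int i - S b) * q i * (of_int i - S b) =
      of_int (i * i) *\<^sub>R q i - (of_int i *\<^sub>R q i) * S b - S b * (of_int i *\<^sub>R q i) + S b * q i * S b" for i
    proof -
      have "(of_int i :: 'b) = of_int i *\<^sub>R 1" by (simp flip: of_real_def)
      then show ?thesis by (simp only: ) (simp add: algebra_simps)
    qed
    then have "(\<Sum>i\<in>I. (of_int i - S b) * q i * (of_int i - S b)) =
      (\<Sum>i\<in>I. of_int (i * i) *\<^sub>R q i) - (\<Sum>i\<in>I. of_int i *\<^sub>R q i) * S b - S b * (\<Sum>i\<in>I. of_int i *\<^sub>R q i) + S b * (\<Sum>i\<in>I. q i) * S b"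
      by (simp only: sum.distrib sum_subtractf sum_distrib_left sum_distrib_right)
    then show ?thesis by (simp add: q1 q2)
  qed
  ultimately have "(\<Sum>i\<in>I. of_int (i * i) *\<^sub>R q i) - S b * S b \<in> pos_cone" by (simp only:)
  from pos_cone_add[OF q3 this] show ?thesis by (simp del: of_int_mult)
qed

lemma kadison_inequality:
  fixes S :: "'a::cstar_algebra \<Rightarrow> 'b::cstar_algebra"
  assumes S: "unital_order_hom S" and b: "star b = b"
  shows "S (b * b) - S b * S b \<in> pos_cone"
proof -
  have add: "sa_additive S" using S by (simp add: unital_order_hom_def)
  have bb: "star (b * b) = b * b" by (simp add: star_mult b)
  define x where "x = S (b * b) - S b * S b"
  have *: "x + (inverse (real (Suc n)) * inverse (real (Suc n))) *\<^sub>R 1 \<in> pos_cone" for n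
  proof -
    \<comment> \<open>Integer scaling factors are the ones that the additive map \<open>S\<close> is
      known to respect. After division by \<open>r * r\<close> the error 1 becomes
      \<open>1 / (r * r)\<close>.\<close>
    define r where "r = real (Suc n)"
    have r: "r > 0" by (simp add: r_def)
    have "S (r *\<^sub>R b) = r *\<^sub>R S b" "S ((r *\<^sub>R b) * (r *\<^sub>R b)) = (r * r) *\<^sub>R S (b * b)"
      using sa_additive_nat[OF add b, of "Suc n"] sa_additive_nat[OF add bb, of "Suc n * Suc n"]
      by (simp_all add: r_def del: of_nat_Suc mult_Suc mult_Suc_right)
    then have "(r * r) *\<^sub>R x + 1 \<in> pos_cone"
      using kadison_inequality_plus_one[OF S, of "r *\<^sub>R b"] b
      by (simp add: x_def star_scaleR scaleR_diff_right algebra_simps)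
    then have "(inverse r * inverse r) *\<^sub>R ((r * r) *\<^sub>R x + 1) \<in> pos_cone" using r by (intro pos_cone_scaleR) auto
    moreover have "inverse r * inverse r * (r * r) = 1" using r by (simp add: field_simps)
    ultimately show ?thesis unfolding r_def[symmetric] by (simp only: scaleR_add_right scaleR_scaleR scaleR_one)
  qed
  have "(\<lambda>n. x + (inverse (real (Suc n)) * inverse (real (Suc n))) *\<^sub>R 1) \<longlonglongrightarrow> x + (0 * 0) *\<^sub>R 1"
    by (intro tendsto_add tendsto_scaleR tendsto_const tendsto_mult LIMSEQ_inverse_real_of_nat)
  from closed_sequentially[OF closed_pos_cone * this] show ?thesis by (simp add: x_def)
qed

text \<open>Kadison's inequality for \<open>T'\<close> at \<open>T h\<close>, pushed forward by
  \<open>T\<close>, is the reverse of the inequality for \<open>T\<close> at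
  \<open>h\<close>.\<close>

lemma unital_order_iso_square:
  fixes T :: "'a::cstar_algebra \<Rightarrow> 'b::cstar_algebra" and T' :: "'b \<Rightarrow> 'a"
  assumes T: "unital_order_hom T" and T': "unital_order_hom T'"
    and inv: "\<And>h. star h = h \<Longrightarrow> T' (T h) = h" "\<And>k. star k = k \<Longrightarrow> T (T' k) = k"
    and h: "star h = h"
  shows "T (h * h) = T h * T h"
proof -
  have Th: "star (T h) = T h" using unital_order_hom_sa[OF T h] .
  have hh: "star (h * h) = h * h" and ThTh: "star (T h * T h) = T h * T h" by (simp_all add: star_mult h Th)
  have pos: "T' (T h * T h) - h * h \<in> pos_cone" using kadison_inequality[OF T' Th] by (simp add: inv h)
  have add: "sa_additive T" and pd: "\<And>a. a \<in> posdef_cone \<Longrightarrow> T a \<in> pos_cone"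
    using T by (auto simp: unital_order_hom_def posdef_cone_pos)
  have "T (T' (T h * T h) - h * h) \<in> pos_cone"
    by (rule sa_additive_pos[OF add pd pos])
  then have "T h * T h - T (h * h) \<in> pos_cone"
    using sa_additive_diff[OF add unital_order_hom_sa[OF T' ThTh] hh] inv(2)[OF ThTh] by simp
  then have "T (h * h) - T h * T h = 0"
    by (intro pos_cone_antisym kadison_inequality[OF T h]) simp
  then show ?thesis by simp
qed

section \<open>Transport of commutativity to the first algebra\<close>

lemma unital_order_iso_commutative:
  fixes T :: "'a::cstar_algebra \<Rightarrow> 'b::cstar_algebra" and T' :: "'b \<Rightarrow> 'a"
  assumes T: "unital_order_hom T" and T': "unital_order_hom T'"
    and inv: "\<And>h. star h = h \<Longrightarrow> T' (T h) = h" "\<And>k. star k = k \<Longrightarrow> T (T' k) = k"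
    and comm: "\<And>u v :: 'b. u * v = v * u"
  shows "(x::'a) * y = y * x"
proof (rule commutative_if_double_commutators_vanish)
  fix a b :: 'a assume a: "star a = a" and b: "star b = b"
  have add: "sa_additive T" using T by (simp add: unital_order_hom_def)
  have sq: "T (h * h) = T h * T h" if "star h = h" for h
    using unital_order_iso_square[OF T T' _ _ that] inv by simp
  have jordan: "T (h * k + k * h) = 2 *\<^sub>R (T h * T k)" if hk: "star h = h" "star k = k" for h k
  proof -
    have s: "star (h * h) = h * h" "star (k * k) = k * k" "star (h * k + k * h) = h * k + k * h" "star (h + k) = h + k"
      using hk by (simp_all add: star_simps add.commute)
    have "T ((h + k) * (h + k)) = (T h + T k) * (T h + T k)"
      using sq[OF s(4)] hk by (simp add: sa_additive_add[OF add])
    moreover have "(h + k) * (h + k) = h * h + (h * k + k * h) + k * k" by (simp add: algebra_simps)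
    moreover have "T (h * h + (h * k + k * h) + k * k) = T (h * h) + T (h * k + k * h) + T (k * k)"
      using s by (simp add: sa_additive_add[OF add] star_add)
    ultimately show ?thesis using sq[OF hk(1)] sq[OF hk(2)] comm[of "T k" "T h"]
      by (simp add: algebra_simps scaleR_2)
  qed
  \<comment> \<open>In Jordan terms \<open>u\<close> is built from the square of \<open>a\<close>
    and from \<open>b\<close>, and \<open>v\<close> from \<open>a\<close> and the product of
    \<open>a\<close> with \<open>b\<close>. Doubling \<open>a * a\<close> in \<open>u\<close>
    matches the factor in \<open>v\<close>: both are sent to \<open>4 * T a * T a * T b\<close>,
    while \<open>u - v\<close> is \<open>[a, [a, b]]\<close>.\<close>
  define u v where "u = (a * a + a * a) * b + b * (a * a + a * a)" and "v = a * (a * b + b * a) + (a * b + b * a) * a"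
  have s: "star (a * a + a * a) = a * a + a * a" "star (a * b + b * a) = a * b + b * a" "star u = u" "star v = v"
    using a b by (simp_all add: u_def v_def star_simps add.commute)
  have "T u = 2 *\<^sub>R ((2 *\<^sub>R (T a * T a)) * T b)" unfolding u_def using jordan[OF s(1) b] jordan[OF a a] by simp
  moreover have "T v = 2 *\<^sub>R (T a * (2 *\<^sub>R (T a * T b)))" unfolding v_def using jordan[OF a s(2)] jordan[OF a b] by simp
  ultimately have "T u = T v" by (simp add: mult.assoc)
  then have "u = v" using inv(1)[OF s(3)] inv(1)[OF s(4)] by metis
  then show "a * (a * b - b * a) = (a * b - b * a) * a" by (simp add: u_def v_def algebra_simps)
qed

text \<open>The inverse bijection is again a Jensen map, so both directions extend additively to the
  self-adjoint parts without a constant term. The extensions are mutually inverse there, as each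
  self-adjoint element is a difference of elements of the cone.\<close>

lemma jensen_bij_commutative:
  fixes f :: "'a::cstar_algebra \<Rightarrow> 'b::cstar_algebra"
  assumes bij: "bij_betw f posdef_cone posdef_cone" and f: "jensen_map f" and f1: "f 1 = 1"
    and comm: "\<And>u v :: 'b. u * v = v * u"
  shows "(x::'a) * y = y * x"
proof -
  define g where "g = inv_into posdef_cone f"
  have gf: "g (f a) = a" if "a \<in> posdef_cone" for a
    using that bij by (simp add: g_def bij_betw_inv_into_left)
  have fg: "f (g x) = x" if "x \<in> posdef_cone" for x
    using that bij by (simp add: g_def bij_betw_inv_into_right)
  have gpd: "g x \<in> posdef_cone" if "x \<in> posdef_cone" for x
    using that bij_betw_apply[OF bij_betw_inv_into[OF bij]] by (simp add: g_def)
  have "g ((1/2) *\<^sub>R (x + y)) = (1/2) *\<^sub>R (g x + g y)" if "x \<in> posdef_cone" "y \<in> posdef_cone" for x y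
  proof -
    have "f ((1/2) *\<^sub>R (g x + g y)) = (1/2) *\<^sub>R (x + y)"
      using f that gpd by (simp add: jensen_map_def fg)
    moreover have "(1/2) *\<^sub>R (g x + g y) \<in> posdef_cone"
      using that gpd by (intro posdef_cone_scaleR posdef_cone_add) auto
    ultimately show ?thesis using gf by metis
  qed
  then have g: "jensen_map g" using gpd by (simp add: jensen_map_def)
  obtain T' where T': "sa_additive T'" "\<And>x. x \<in> posdef_cone \<Longrightarrow> g x = T' x" using jensen_map_linear[OF f g gf] by blast
  obtain T where T: "sa_additive T" "\<And>x. x \<in> posdef_cone \<Longrightarrow> f x = T x" using jensen_map_linear[OF g f fg] by blast
  have uT: "unital_order_hom T"
    using T f f1 posdef_cone_one unfolding unital_order_hom_def jensen_map_def by metis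
  have uT': "unital_order_hom T'"
    using T' g gf[OF posdef_cone_one] f1 posdef_cone_one unfolding unital_order_hom_def jensen_map_def by metis
  have "T' (T h) = h" if h: "star h = h" for h
  proof -
    obtain a b where ab: "a \<in> posdef_cone" "b \<in> posdef_cone" "h = a - b" using h by (rule selfadjoint_diff_posdef)
    then have "T a \<in> posdef_cone" "T b \<in> posdef_cone" using uT by (auto simp: unital_order_hom_def)
    then show ?thesis using ab T T' gf
      by (metis posdef_cone_sa sa_additive_diff)
  qed
  moreover have "T (T' h) = h" if h: "star h = h" for h
  proof -
    obtain a b where ab: "a \<in> posdef_cone" "b \<in> posdef_cone" "h = a - b" using h by (rule selfadjoint_diff_posdef)
    then have "T' a \<in> posdef_cone" "T' b \<in> posdef_cone" using uT' by (auto simp: unital_order_hom_def)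
    then show ?thesis using ab T T' fg
      by (metis posdef_cone_sa sa_additive_diff)
  qed
  ultimately show ?thesis using unital_order_iso_commutative[OF uT uT' _ _ comm] by blast
qed

section \<open>The Kubo-Ando mean in a commutative algebra\<close>

text \<open>With commuting factors the mean is \<open>a * cpower K (1/p)\<close>. Powers are
  multiplicative, so its \<open>p\<close>th power is \<open>cpower a p * K\<close>, and
  \<open>cpower a p\<close> cancels the negative power inside \<open>K\<close>.\<close>

lemma cpower_kubo_ando_commutative:
  fixes a b :: "'a::cstar_algebra"
  assumes comm: "\<And>u v :: 'a. u * v = v * u" and a: "a \<in> posdef_cone" and b: "b \<in> posdef_cone" and p: "p \<noteq> 0"
  shows "cpower (kubo_ando_power_mean p a b) p = (1/2) *\<^sub>R (cpower a p + cpower b p)"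
proof -
  note cm = cpower_mult_commutative[OF comm]
  define W where "W = cpower a (-1/2) * b * cpower a (-1/2)"
  define K where "K = (1/2) *\<^sub>R (1 + cpower W p)"
  have "W = cpower a (-1/2) * cpower a (-1/2) * b" unfolding W_def using comm by (metis mult.assoc)
  then have W: "W = cpower a (-1) * b" using cpower_add[OF a, of "-1/2" "-1/2"] by simp
  have Wpd: "W \<in> posdef_cone" unfolding W by (intro cm cpower_posdef a b)
  have Wp: "cpower W p = cpower a (- p) * cpower b p"
    unfolding W using cm(2)[OF cpower_posdef[OF a] b] by (simp add: cpower_cpower[OF a])
  have K: "K \<in> posdef_cone" unfolding K_def by (intro posdef_cone_scaleR posdef_cone_add posdef_cone_one cpower_posdef Wpd) auto
  have "kubo_ando_power_mean p a b = cpower a (1/2) * cpower K (1/p) * cpower a (1/2)"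
    by (simp add: kubo_ando_power_mean_def K_def W_def)
  also have "\<dots> = a * cpower K (1/p)" using cpower_half[OF a] comm by (metis mult.assoc)
  finally have "cpower (kubo_ando_power_mean p a b) p = cpower a p * cpower (cpower K (1/p)) p"
    using cm(2)[OF a cpower_posdef[OF K]] by simp
  also have "\<dots> = cpower a p * K" using p by (simp add: cpower_cpower[OF K] cpower_1[OF K])
  also have "\<dots> = (1/2) *\<^sub>R (cpower a p + (cpower a p * cpower a (- p)) * cpower b p)"
    by (simp add: K_def Wp algebra_simps)
  finally show ?thesis by (simp add: cpower_minus[OF a])
qed

theorem theorem3:
  fixes p :: real
    and \<phi> :: "'a::cstar_algebra \<Rightarrow> 'b::cstar_algebra"
  assumes "p \<in> {-1<..<1}" and "p \<noteq> 0"
    and "bij_betw \<phi> posdef_cone posdef_cone"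
    and "continuous_on posdef_cone \<phi>"
    and "\<And>A B. A \<in> posdef_cone \<Longrightarrow> B \<in> posdef_cone \<Longrightarrow>
           \<phi> (conv_power_mean p A B) = kubo_ando_power_mean p (\<phi> A) (\<phi> B)"
  shows "(\<forall>x y :: 'a. x * y = y * x) \<and> (\<forall>x y :: 'b. x * y = y * x)"
proof -
  let ?m = "kubo_ando_power_mean p"
  define \<psi> where "\<psi> A = \<phi> (cpower A (1/p))" for A
  have "bij_betw (\<phi> \<circ> (\<lambda>A. cpower A (1/p))) posdef_cone posdef_cone"
    using assms(2) by (intro bij_betw_trans[OF bij_betw_cpower assms(3)]) auto
  then have bij: "bij_betw \<psi> posdef_cone posdef_cone" by (simp add: \<psi>_def[abs_def] o_def)
  have \<psi>pd: "\<psi> A \<in> posdef_cone" if "A \<in> posdef_cone" for A using bij_betw_apply[OF bij that] .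
  have mid: "(1/2) *\<^sub>R (A + B) \<in> posdef_cone" if "A \<in> posdef_cone" "B \<in> posdef_cone" for A B :: 'a
    using that by (intro posdef_cone_scaleR posdef_cone_add) auto
  have \<psi>: "\<psi> ((1/2) *\<^sub>R (A + B)) = ?m (\<psi> A) (\<psi> B)" if "A \<in> posdef_cone" "B \<in> posdef_cone" for A B
    using assms(5)[OF cpower_posdef[OF that(1)] cpower_posdef[OF that(2)], of "1/p" "1/p"] that assms(2)
    by (simp add: conv_power_mean_def \<psi>_def cpower_cpower cpower_1)
  have commB: "u * v = v * u" for u v :: 'b
  proof (rule kubo_ando_self_distributive_imp_commutative[OF assms(1,2)])
    fix X Z :: 'b assume XZ: "X \<in> posdef_cone" "Z \<in> posdef_cone"
    have surj: "\<exists>A\<in>posdef_cone. Y = \<psi> A" if "Y \<in> posdef_cone" for Y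
      using that bij_betw_imp_surj_on[OF bij] by (auto simp: image_iff)
    \<comment> \<open>The unit of the second algebra has a preimage \<open>I\<close> under
      \<open>\<psi>\<close> that may differ from 1; the identity of arithmetic means used below
      holds for any \<open>I\<close>.\<close>
    obtain A C I where A: "A \<in> posdef_cone" "X = \<psi> A" and C: "C \<in> posdef_cone" "Z = \<psi> C"
      and I: "I \<in> posdef_cone" "1 = \<psi> I"
      using surj[OF XZ(1)] surj[OF XZ(2)] surj[OF posdef_cone_one] by blast
    have "?m (?m X 1) (?m Z 1) = \<psi> ((1/2) *\<^sub>R ((1/2) *\<^sub>R (A + I) + (1/2) *\<^sub>R (C + I)))"
      by (simp only: A(2) C(2) I(2) \<psi>[symmetric] A(1) C(1) I(1) mid)
    also have "(1/2) *\<^sub>R ((1/2) *\<^sub>R (A + I) + (1/2) *\<^sub>R (C + I)) = (1/2) *\<^sub>R ((1/2) *\<^sub>R (A + C) + I)"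
      unfolding scaleR_add_right by norm
    also have "\<psi> \<dots> = ?m (?m X Z) 1"
      by (simp only: A(2) C(2) I(2) \<psi>[symmetric] A(1) C(1) I(1) mid)
    finally show "?m (?m X 1) (?m Z 1) = ?m (?m X Z) 1" .
  qed
  define \<omega> where "\<omega> A = cpower (\<psi> A) p" for A
  have \<omega>pd: "\<omega> A \<in> posdef_cone" if "A \<in> posdef_cone" for A
    unfolding \<omega>_def by (intro cpower_posdef \<psi>pd that)
  \<comment> \<open>\<open>\<omega> 1\<close> may be any positive definite element. Congruence by
    its inverse square root is a bijection of the cone that respects arithmetic means and sends
    \<open>\<omega> 1\<close> to 1.\<close>
  define N R where "N = cpower (\<omega> 1) (-1/2)" and "R = cpower (\<omega> 1) (1/2)"
  note e = \<omega>pd[OF posdef_cone_one]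
  have NR: "N * R = 1" "R * N = 1" "R * R = \<omega> 1" and Npd: "N \<in> posdef_cone" and Rpd: "R \<in> posdef_cone"
    unfolding N_def R_def using e by (simp_all add: cpower_add cpower_0 cpower_1 cpower_posdef)
  define f where "f A = N * \<omega> A * N" for A
  have "bij_betw (\<lambda>X. N * X * N) posdef_cone posdef_cone"
  proof (rule bij_betw_byWitness[where f'="\<lambda>X. R * X * R"])
    show "\<forall>X\<in>posdef_cone. R * (N * X * N) * R = X" "\<forall>X\<in>posdef_cone. N * (R * X * R) * N = X"
      using NR by (metis mult.assoc mult.left_neutral mult.right_neutral)+
  qed (use Npd Rpd in \<open>auto intro!: congruence_posdef\<close>)
  then have "bij_betw ((\<lambda>X. N * X * N) \<circ> ((\<lambda>X. cpower X p) \<circ> \<psi>)) posdef_cone posdef_cone"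
    using assms(2) bij by (intro bij_betw_trans[OF bij_betw_trans[OF bij bij_betw_cpower]]) auto
  then have "bij_betw f posdef_cone posdef_cone" by (simp add: f_def[abs_def] \<omega>_def o_def)
  moreover have "jensen_map f"
    unfolding jensen_map_def
  proof (intro conjI ballI)
    fix A B :: 'a assume A: "A \<in> posdef_cone" and B: "B \<in> posdef_cone"
    show "f A \<in> posdef_cone" unfolding f_def by (intro congruence_posdef \<omega>pd A Npd)
    have "\<omega> ((1/2) *\<^sub>R (A + B)) = (1/2) *\<^sub>R (\<omega> A + \<omega> B)"
      using cpower_kubo_ando_commutative[OF commB \<psi>pd[OF A] \<psi>pd[OF B] assms(2)] by (simp add: \<omega>_def \<psi>[OF A B])
    then show "f ((1/2) *\<^sub>R (A + B)) = (1/2) *\<^sub>R (f A + f B)" by (simp add: f_def algebra_simps)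
  qed
  moreover have "f 1 = 1" unfolding f_def using NR by (metis mult.assoc mult.left_neutral)
  ultimately have "u * v = v * u" for u v :: 'a using jensen_bij_commutative[OF _ _ _ commB] by blast
  with commB show ?thesis by blast
qed

end
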